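(* Let $(X,d)$ be a doubling and compact metric space with more than one point. If $X$ is linearly connected and satisfies the UWS condition, then the Ahlfors regular conformal dimension of $X$ is equal to one: $\dim_{AR}X=1$.
   Context: Doubling: there is a constant $N$ such that every ball of $X$ can be covered by $N$ balls of half its radius. Linearly connected (bounded turning): there is a constant $C$ such that for all $x,y\in X$ there is a continuum (compact connected set) $J\subset X$ containing $x$ and $y$ with $\mathrm{diam}\,J\le C\,d(x,y)$. UWS condition (uniformly well spread local cut points), for a connected compact metric space $X$: there exists a constant $C\ge 1$ such that for any point $x\in X$ and any $r>0$ there is a finite set $P\subset B(x,r)$ such that (1) $\#P\le C$, and (2) no connected component of $X\setminus P$ intersects both $B(x,\frac r2)$ and $X\setminus\overline{B}(x,r)$. Ahlfors regular (AR) conformal dimension: $$\dim_{AR}(X,d):=\inf\{\dim_H(X,\theta):\ \theta \text{ is AR and } \theta\sim_{qs}d\},$$ where $\dim_H$ is Hausdorff dimension; $\theta\sim_{qs}d$ means that $\theta$ is a distance on $X$ for which there is an increasing homeomorphism $\eta:[0,\infty)\to[0,\infty)$ with $\frac{\theta(x,a)}{\theta(y,a)}\le\eta\left(\frac{d(x,a)}{d(y,a)}\right)$ for all distinct $x,y,a\in X$; and $\theta$ is AR of dimension $\alpha>0$ if there are a Radon measure $\mu$ on $X$ and a constant $K\ge1$ with $K^{-1}r^\alpha\le\mu(B_r)\le Kr^\alpha$ for every $\theta$-ball $B_r$ of radius $0< r\le\mathrm{diam}_\theta X$. *)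

theory Defs
  imports "HOL-Analysis.Analysis"
begin

context Metric_space
begin

text \<open>Extended-valued, so that unbounded sets have diameter \<open>\<infinity>\<close>; the empty set has diameter 0.\<close>

definition mdiam :: "'a set \<Rightarrow> ennreal" where
  "mdiam S = (SUP (x, y) \<in> S \<times> S. ennreal (d x y))"

definition doubling :: bool where
  "doubling \<longleftrightarrow> (\<exists>N::nat. \<forall>x\<in>M. \<forall>r>0. \<exists>S. S \<subseteq> M \<and> finite S \<and> card S \<le> N \<and>
     mball x r \<subseteq> (\<Union>y\<in>S. mball y (r / 2)))"

definition linearly_connected :: bool where
  "linearly_connected \<longleftrightarrow> (\<exists>C::real. \<forall>x\<in>M. \<forall>y\<in>M. \<exists>J.
     compactin mtopology J \<and> connectedin mtopology J \<and> x \<in> J \<and> y \<in> J \<and>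
     mdiam J \<le> ennreal (C * d x y))"

definition UWS :: bool where
  "UWS \<longleftrightarrow> (\<exists>C::real. C \<ge> 1 \<and> (\<forall>x\<in>M. \<forall>r>0. \<exists>P. finite P \<and> P \<subseteq> mball x r \<and>
     real (card P) \<le> C \<and>
     \<not> (\<exists>K \<in> connected_components_of (subtopology mtopology (M - P)).
          K \<inter> mball x (r / 2) \<noteq> {} \<and> K \<inter> (M - mcball x r) \<noteq> {})))"


subsection \<open>Hausdorff dimension\<close>

text \<open>The contribution \<open>diam(S)\<^sup>s\<close> of one covering set. The case distinction implements the
  conventions \<open>0\<^sup>0 = 1\<close> for nonempty sets and \<open>diam({})\<^sup>0 = 0\<close>, because \<open>0 powr 0 = 0\<close>
  in the library. It is only applied to sets of finite diameter.\<close>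

definition diam_pow :: "real \<Rightarrow> 'a set \<Rightarrow> ennreal" where
  "diam_pow s S = (if S = {} then 0 else if s = 0 then 1 else ennreal (enn2real (mdiam S) powr s))"

definition hausdorff_premeasure :: "real \<Rightarrow> real \<Rightarrow> 'a set \<Rightarrow> ennreal" where
  "hausdorff_premeasure s \<delta> A =
     (INF U \<in> {U :: nat \<Rightarrow> 'a set. (\<forall>i. U i \<subseteq> M \<and> mdiam (U i) \<le> ennreal \<delta>) \<and> A \<subseteq> (\<Union>i. U i)}.
        (\<Sum>i. diam_pow s (U i)))"

definition hausdorff_measure :: "real \<Rightarrow> 'a set \<Rightarrow> ennreal" where
  "hausdorff_measure s A = (SUP \<delta> \<in> {0<..}. hausdorff_premeasure s \<delta> A)"

definition hausdorff_dim :: ennreal where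
  "hausdorff_dim = (INF s \<in> {s. 0 \<le> s \<and> hausdorff_measure s M = 0}. ennreal s)"


subsection \<open>Ahlfors regularity\<close>

definition radon_measure :: "'a measure \<Rightarrow> bool" where
  "radon_measure \<mu> \<longleftrightarrow>
     space \<mu> = M \<and> sets \<mu> = sigma_sets M {U. openin mtopology U} \<and>
     (\<forall>K. compactin mtopology K \<longrightarrow> emeasure \<mu> K < \<infinity>) \<and>
     (\<forall>A \<in> sets \<mu>. emeasure \<mu> A = (INF U \<in> {U. openin mtopology U \<and> A \<subseteq> U}. emeasure \<mu> U)) \<and>
     (\<forall>U. openin mtopology U \<longrightarrow>
        emeasure \<mu> U = (SUP K \<in> {K. compactin mtopology K \<and> K \<subseteq> U}. emeasure \<mu> K))"

definition ahlfors_regular_of_dim :: "real \<Rightarrow> bool" where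
  "ahlfors_regular_of_dim \<alpha> \<longleftrightarrow> (\<exists>\<mu>. radon_measure \<mu> \<and> (\<exists>K::real. K \<ge> 1 \<and>
     (\<forall>x\<in>M. \<forall>r::real. 0 < r \<and> ennreal r \<le> mdiam M \<longrightarrow>
        ennreal (r powr \<alpha> / K) \<le> emeasure \<mu> (mball x r) \<and>
        emeasure \<mu> (mball x r) \<le> ennreal (K * r powr \<alpha>))))"

definition ahlfors_regular :: bool where
  "ahlfors_regular \<longleftrightarrow> (\<exists>\<alpha>>0. ahlfors_regular_of_dim \<alpha>)"

end


subsection \<open>Quasisymmetric distances and the conformal dimension\<close>

definition quasisymmetric :: "'a set \<Rightarrow> ('a \<Rightarrow> 'a \<Rightarrow> real) \<Rightarrow> ('a \<Rightarrow> 'a \<Rightarrow> real) \<Rightarrow> bool" where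
  "quasisymmetric X \<theta> d \<longleftrightarrow> Metric_space X \<theta> \<and>
     (\<exists>\<eta> :: real \<Rightarrow> real. strict_mono_on {0..} \<eta> \<and> (\<exists>\<eta>'. homeomorphism {0..} {0..} \<eta> \<eta>') \<and>
        (\<forall>x\<in>X. \<forall>y\<in>X. \<forall>a\<in>X. x \<noteq> y \<and> x \<noteq> a \<and> y \<noteq> a \<longrightarrow>
           \<theta> x a / \<theta> y a \<le> \<eta> (d x a / d y a)))"

text \<open>The infimum is taken in \<open>[0, \<infinity>]\<close>; it is \<open>\<infinity>\<close> if no admissible distance exists.\<close>

definition AR_conformal_dim :: "'a set \<Rightarrow> ('a \<Rightarrow> 'a \<Rightarrow> real) \<Rightarrow> ennreal" where
  "AR_conformal_dim X d =
     (INF \<theta> \<in> {\<theta>. quasisymmetric X \<theta> d \<and> Metric_space.ahlfors_regular X \<theta>}.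
        Metric_space.hausdorff_dim X \<theta>)"

end

(* The bound from below holds because a quasisymmetric distance induces the same topology, and a connected
   space with more than one point has Hausdorff dimension at least 1.

   For the bound from above, fix p > 1. On maximal separated sets S n at the scales R n = D / a^n one
   constructs densities m n, to be thought of as the mass of a ball of radius R n: the mass of each net point
   is distributed exactly among its children, m n varies by bounded factors at scale R n, and the points of
   S n give a proportion of about k^(-p) of their mass to each of the boundedly many times k points in which
   the UWS condition cuts k concentric annuli around the cut points nearby. The total of these proportions is
   about k^(1 - p), so that for k large they leave mass to spare. Put q(x, y) = m n (x)^(1/p) + m n (y)^(1/p)
   where R n is comparable to d(x, y). A chain of points that leaves a ball of radius R n either jumps far or
   passes near k heavy points, one in each annulus, and by induction on the length of the chain it has
   q-length at least k * (m n / k^p)^(1/p) = m n^(1/p) up to a constant that does not deteriorate. Hence the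
   chain metric of q is comparable to q. It is quasisymmetric to d, and the limit of the masses is Ahlfors
   regular of dimension p for it. *)
theory Submission
  imports Defs
begin

subsection \<open>Nets in doubling spaces\<close>

text \<open>The constants must be fixed in a definite order. The UWS bound \<open>B\<close> and the
  bound \<open>A\<close> on kernel sums come from the space; \<open>k\<close> is found from
  \<open>A\<close>, \<open>B\<close> and \<open>p\<close>; only afterwards is the ratio
  \<open>a\<close> of the scales known, since \<open>k\<close> annuli of ratio 8 have to fit between
  \<open>R (Suc n)\<close> and \<open>R n\<close>. So the share of the heavy points must be
  estimated without any power of \<open>a\<close>, although the number of children may grow with
  \<open>a\<close>. Kernels that decay exponentially at the new scale achieve this. The cuts come in
  two rounds because the masses are fixed before any chain is known. Annuli around a net point
  \<open>v\<close> would not do: a chain starts only within \<open>R n\<close> of \<open>v\<close>,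
  possibly outside the small annuli. A UWS set around \<open>v\<close> supplies boundedly many
  centres \<open>z\<close>; a fine chain comes within a tenth of \<open>R (Suc n)\<close> of one of
  them and then has to cross all \<open>k\<close> annuli around it. The induction tolerates no loss
  per level. Every change of base point in it is paid by the masses of the heavy points, and its
  constant is set by the long jumps alone.\<close>

context Metric_space
begin

definition separated :: "real \<Rightarrow> 'a set \<Rightarrow> bool" where
  "separated r T \<longleftrightarrow> finite T \<and> T \<subseteq> M \<and> (\<forall>x\<in>T. \<forall>y\<in>T. x \<noteq> y \<longrightarrow> r \<le> d x y)"

lemma doubling_iterate:
  assumes N: "\<And>x r. x \<in> M \<Longrightarrow> r > 0 \<Longrightarrow>
      \<exists>S. S \<subseteq> M \<and> finite S \<and> card S \<le> N \<and> mball x r \<subseteq> (\<Union>y\<in>S. mball y (r / 2))"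
    and "x \<in> M" "r > 0"
  shows "\<exists>S. S \<subseteq> M \<and> finite S \<and> card S \<le> N ^ j \<and> mball x (2 ^ j * r) \<subseteq> (\<Union>y\<in>S. mball y r)"
  using assms(2)
proof (induction j arbitrary: x)
  case 0
  show ?case by (rule exI[of _ "{x}"]) (use 0 in auto)
next
  case (Suc j)
  have "2 ^ Suc j * r > 0" using assms(3) by simp
  from N[OF Suc.prems this] obtain S where S: "S \<subseteq> M" "finite S" "card S \<le> N"
    "mball x (2 ^ Suc j * r) \<subseteq> (\<Union>y\<in>S. mball y (2 ^ j * r))" by auto
  have "\<forall>y\<in>S. \<exists>T. T \<subseteq> M \<and> finite T \<and> card T \<le> N ^ j \<and> mball y (2 ^ j * r) \<subseteq> (\<Union>z\<in>T. mball z r)"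
    using Suc.IH S(1) by blast
  then obtain T where T: "\<And>y. y \<in> S \<Longrightarrow> T y \<subseteq> M \<and> finite (T y) \<and> card (T y) \<le> N ^ j
      \<and> mball y (2 ^ j * r) \<subseteq> (\<Union>z\<in>T y. mball z r)" by metis
  have "card (\<Union>y\<in>S. T y) \<le> (\<Sum>y\<in>S. card (T y))" by (rule card_UN_le[OF S(2)])
  also have "\<dots> \<le> (\<Sum>y\<in>S. N ^ j)" by (rule sum_mono) (use T in auto)
  also have "\<dots> \<le> N ^ Suc j" using S(3) by simp
  finally have "card (\<Union>y\<in>S. T y) \<le> N ^ Suc j" .
  moreover have "mball x (2 ^ Suc j * r) \<subseteq> (\<Union>z\<in>(\<Union>y\<in>S. T y). mball z r)"
  proof
    fix z assume "z \<in> mball x (2 ^ Suc j * r)"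
    then obtain y where y: "y \<in> S" "z \<in> mball y (2 ^ j * r)" using S(4) by auto
    then have "z \<in> (\<Union>w\<in>T y. mball w r)" using T[OF y(1)] by (meson subsetD)
    then show "z \<in> (\<Union>z\<in>(\<Union>y\<in>S. T y). mball z r)" using y(1) by auto
  qed
  moreover have "(\<Union>y\<in>S. T y) \<subseteq> M" "finite (\<Union>y\<in>S. T y)"
    using S(2) T by (meson UN_least, blast)
  ultimately show ?case by blast
qed

text \<open>A ball of radius \<open>r / 2\<close> contains at most one point of an
  \<open>r\<close>-separated set, so choosing a ball for each point is injective.\<close>

lemma card_separated_le:
  assumes T: "separated r T" and S: "finite S" "T \<subseteq> (\<Union>y\<in>S. mball y (r / 2))"
  shows "card T \<le> card S"
proof -
  have "\<forall>t\<in>T. \<exists>y\<in>S. t \<in> mball y (r / 2)" using S(2) by blast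
  then obtain f where f: "\<And>t. t \<in> T \<Longrightarrow> f t \<in> S \<and> t \<in> mball (f t) (r / 2)" by metis
  have "inj_on f T"
  proof (rule inj_onI, rule ccontr)
    fix x y assume xy: "x \<in> T" "y \<in> T" "f x = f y" "x \<noteq> y"
    then have "r \<le> d x y" using T by (simp add: separated_def)
    moreover have "d x y \<le> d x (f x) + d (f x) y"
      using f[OF xy(1)] f[OF xy(2)] by (intro triangle) auto
    moreover have "d x (f x) < r / 2" "d (f x) y < r / 2"
      using f[OF xy(1)] f[OF xy(2)] xy(3) by (auto simp: commute)
    ultimately show False by linarith
  qed
  then show ?thesis using f by (intro card_inj_on_le[OF _ _ S(1)]) auto
qed

text \<open>A separated set of largest cardinality will do, as a point far from it could be added.
  Total boundedness bounds the cardinalities.\<close>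

lemma ex_net:
  assumes "compact_space mtopology" "r > 0"
  shows "\<exists>T. separated r T \<and> (\<forall>x\<in>M. \<exists>v\<in>T. d x v < r)"
proof -
  have "mtotally_bounded M"
    using assms(1) compactin_imp_mtotally_bounded by (simp add: compact_space_def)
  then obtain K where K: "finite K" "K \<subseteq> M" "M \<subseteq> (\<Union>y\<in>K. mball y (r / 2))"
    using assms(2) unfolding mtotally_bounded_def by (metis half_gt_zero)
  have "\<forall>T. separated r T \<longrightarrow> card T < Suc (card K)"
  proof (intro allI impI)
    fix T assume T: "separated r T"
    then have "T \<subseteq> (\<Union>y\<in>K. mball y (r / 2))" using K(3) by (auto simp: separated_def)
    from card_separated_le[OF T K(1) this] show "card T < Suc (card K)" by simp
  qed
  moreover have "separated r {}" by (simp add: separated_def)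
  ultimately have "\<exists>T. separated r T \<and> (\<forall>T'. separated r T' \<longrightarrow> card T' \<le> card T)"
    by (rule ex_has_greatest_nat[rotated])
  then obtain T where T: "separated r T" "\<And>T'. separated r T' \<Longrightarrow> card T' \<le> card T"
    by auto
  have "\<exists>v\<in>T. d x v < r" if x: "x \<in> M" for x
  proof (rule ccontr)
    assume "\<not> (\<exists>v\<in>T. d x v < r)"
    then have far: "\<And>v. v \<in> T \<Longrightarrow> r \<le> d x v" by force
    then have "x \<notin> T" using assms(2) x mdist_zero by force
    moreover have "separated r (insert x T)"
      using T(1) far x by (auto simp: separated_def commute)
    ultimately show False using T(2)[of "insert x T"] T(1) by (simp add: separated_def)
  qed
  then show ?thesis using T(1) by blast
qed

text \<open>The exponential beats the polynomial growth of nets, uniformly over all scales.\<close>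

lemma ex_kernel_bound:
  assumes doubling
  shows "\<exists>A\<ge>1. \<forall>r>0. \<forall>T. separated r T \<longrightarrow> (\<forall>x\<in>M. (\<Sum>c\<in>T. exp (- d x c / (8 * r))) \<le> A)"
proof -
  obtain N :: nat where N: "\<And>x r. x \<in> M \<Longrightarrow> r > 0 \<Longrightarrow>
      \<exists>S. S \<subseteq> M \<and> finite S \<and> card S \<le> N \<and> mball x r \<subseteq> (\<Union>y\<in>S. mball y (r / 2))"
    using assms unfolding doubling_def by blast
  \<comment> \<open>With this \<open>k\<close>, the at most \<open>N ^ j\<close> points of the
    \<open>j\<close>-th dyadic shell, each of weight at most \<open>B / (2 ^ k) ^ j\<close>,
    contribute at most \<open>B / 2 ^ j\<close>, and the shells sum to \<open>2 * B\<close>.\<close>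
  obtain k :: nat where k: "2 * real N \<le> 2 ^ k"
    using real_arch_pow[of 2 "2 * real N"] less_imp_le by auto
  \<comment> \<open>\<open>B\<close> comes from \<open>u ^ k / fact k \<le> exp u\<close> at
    \<open>u = 2 ^ j / 32\<close>, a lower bound for \<open>d x c / (8 * r)\<close> on the
    \<open>j\<close>-th shell.\<close>
  define B :: real where "B = fact k * 32 ^ k"
  have B1: "B \<ge> 1"
    using mult_mono[of 1 "fact k :: real" 1 "32 ^ k"] by (simp add: B_def fact_ge_1 one_le_power)
  have pow_le_exp: "u ^ k / fact k \<le> exp u" if "u \<ge> 0" for u :: real
  proof -
    have "(\<Sum>n\<in>{k}. u ^ n /\<^sub>R fact n) \<le> (\<Sum>n. u ^ n /\<^sub>R fact n)"
      using that by (intro sum_le_suminf summable_exp_generic) auto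
    then show ?thesis by (simp add: exp_def divide_inverse mult.commute)
  qed
  have main: "(\<Sum>c\<in>T. exp (- d x c / (8 * r))) \<le> 2 * B"
    if r: "r > 0" and T: "separated r T" and x: "x \<in> M" for r T x
  proof -
    have ex: "\<exists>j::nat. d x c < 2 ^ j * (r / 2)" for c
    proof -
      obtain j :: nat where "d x c / (r / 2) < 2 ^ j" using real_arch_pow[of 2 "d x c / (r / 2)"] by auto
      then show ?thesis using r by (auto simp: pos_divide_less_eq)
    qed
    define J where "J c = (LEAST j::nat. d x c < 2 ^ j * (r / 2))" for c
    have J: "d x c < 2 ^ J c * (r / 2)" for c unfolding J_def by (rule LeastI_ex[OF ex])
    have J': "J c = 0 \<or> 2 ^ J c * (r / 4) \<le> d x c" for c
    proof (cases "J c")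
      case (Suc i)
      then have "\<not> d x c < 2 ^ i * (r / 2)" using not_less_Least[of i] unfolding J_def by (metis lessI)
      then show ?thesis using Suc by (simp add: not_less mult.commute)
    qed auto
    have e: "exp (- d x c / (8 * r)) \<le> B / (2 ^ k) ^ J c" for c
    proof (cases "J c = 0")
      case True
      have "exp (- d x c / (8 * r)) \<le> 1" using r by simp
      also note B1
      finally show ?thesis using True by simp
    next
      case False
      then have "2 ^ J c * (r / 4) \<le> d x c" using J'[of c] by simp
      then have u: "2 ^ J c / 32 \<le> d x c / (8 * r)" using r by (simp add: pos_le_divide_eq)
      have "(2 ^ J c / 32) ^ k / fact k \<le> exp (2 ^ J c / 32 :: real)"
        by (rule pow_le_exp) simp
      also have "\<dots> \<le> exp (d x c / (8 * r))" using u by simp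
      finally have "(2 ^ J c) ^ k / 32 ^ k / fact k \<le> exp (d x c / (8 * r))"
        by (simp add: power_divide)
      moreover have "(2 ^ J c) ^ k = ((2 ^ k) ^ J c :: real)"
        by (simp only: power_mult[symmetric] mult.commute)
      ultimately have "(2 ^ k) ^ J c / B \<le> exp (d x c / (8 * r))"
        by (simp add: B_def mult.commute)
      then have "inverse (exp (d x c / (8 * r))) \<le> inverse ((2 ^ k) ^ J c / B)"
        using B1 by (intro le_imp_inverse_le) auto
      then show ?thesis by (simp add: exp_minus)
    qed
    have fT: "finite T" using T by (simp add: separated_def)
    have cJ: "card {c \<in> T. J c = j} \<le> N ^ j" for j
    proof -
      obtain S where S: "S \<subseteq> M" "finite S" "card S \<le> N ^ j"
          "mball x (2 ^ j * (r / 2)) \<subseteq> (\<Union>y\<in>S. mball y (r / 2))"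
        using doubling_iterate[OF N x, of "r / 2" j] r by auto
      have "{c \<in> T. J c = j} \<subseteq> mball x (2 ^ j * (r / 2))"
        using J T x by (auto simp: separated_def)
      moreover have "separated r {c \<in> T. J c = j}" using T by (auto simp: separated_def)
      ultimately have "card {c \<in> T. J c = j} \<le> card S" using S by (intro card_separated_le) auto
      then show ?thesis using S(3) by linarith
    qed
    obtain n where n: "J ` T \<subseteq> {..<n}" using fT by (meson finite_imageI finite_nat_iff_bounded)
    have "(\<Sum>c\<in>T. exp (- d x c / (8 * r))) \<le> (\<Sum>c\<in>T. B / (2 ^ k) ^ J c)"
      by (intro sum_mono e)
    also have "\<dots> = (\<Sum>j\<in>{..<n}. \<Sum>c\<in>{c \<in> T. J c = j}. B / (2 ^ k) ^ J c)"
      by (rule sum.group[symmetric]) (use fT n in auto)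
    also have "\<dots> = (\<Sum>j<n. real (card {c \<in> T. J c = j}) * (B / (2 ^ k) ^ j))"
      by (intro sum.cong) auto
    also have "\<dots> \<le> (\<Sum>j<n. B * (1 / 2) ^ j)"
    proof (rule sum_mono)
      fix j
      have "real (card {c \<in> T. J c = j}) \<le> real N ^ j"
        using cJ[of j] by (metis of_nat_le_iff of_nat_power)
      also have "\<dots> \<le> (2 ^ k / 2) ^ j" using k by (intro power_mono) auto
      finally have "real (card {c \<in> T. J c = j}) * (B / (2 ^ k) ^ j) \<le> (2 ^ k / 2) ^ j * (B / (2 ^ k) ^ j)"
        using B1 by (intro mult_right_mono) auto
      also have "\<dots> = B * (1 / 2) ^ j" by (simp add: power_divide)
      finally show "real (card {c \<in> T. J c = j}) * (B / (2 ^ k) ^ j) \<le> B * (1 / 2) ^ j" .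
    qed
    also have "\<dots> = B * (\<Sum>j<n. (1 / 2) ^ j)" by (simp add: sum_distrib_left)
    also have "\<dots> \<le> B * 2" using B1 by (intro mult_left_mono) (auto simp: sum_gp_strict)
    finally show ?thesis by simp
  qed
  show ?thesis by (rule exI[of _ "2 * B"]) (use main B1 in auto)
qed

end

subsection \<open>Refining a density\<close>

context Metric_space
begin

text \<open>The constant 2 leaves room: the kernels of \<open>refine_density\<close> have rate 1 at
  the new scale, and the rest pays for truncating them and for the variation of the old
  density.\<close>

definition loglip :: "real \<Rightarrow> ('a \<Rightarrow> real) \<Rightarrow> bool" where
  "loglip R w \<longleftrightarrow> (\<forall>x\<in>M. w x > 0) \<and> (\<forall>x\<in>M. \<forall>y\<in>M. w x \<le> exp (2 * d x y / R) * w y)"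

text \<open>In the definition of \<open>w'\<close>, the exponential kernels \<open>E\<close> spread the mass \<open>\<kappa> * w v\<close> of the points of \<open>H v\<close>
  so that it varies slowly, the coefficients \<open>b v\<close> restore the conservation of mass, and \<open>\<delta> * w\<close> is large
  enough to absorb the truncation of the kernels in \<open>\<beta>\<close>, which keeps the bump at \<open>v\<close> among the children of \<open>v\<close>.
  The bound on \<open>\<kappa>\<close> does not involve \<open>a\<close>.\<close>

lemma refine_density:
  fixes R a A \<kappa> N :: real and w :: "'a \<Rightarrow> real"
  defines "\<delta> \<equiv> 4 * exp (1 - a / 2)"
  assumes A: "\<And>r T x. r > 0 \<Longrightarrow> separated r T \<Longrightarrow> x \<in> M \<Longrightarrow> (\<Sum>c\<in>T. exp (- d x c / (8 * r))) \<le> A"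
    and A1: "A \<ge> 1" and R: "R > 0" and a: "a \<ge> 6" and aA: "16 * exp 3 * A \<le> exp (3 * a / 8)"
    and \<kappa>: "\<kappa> \<ge> 0" "\<kappa> * exp 18 * A\<^sup>2 * N \<le> 1 / 4"
    and w: "loglip R w"
    and S: "separated R S" and S': "separated (R / a) S'" "\<And>x. x \<in> M \<Longrightarrow> \<exists>c\<in>S'. d x c < R / a"
    and g: "\<And>c. c \<in> S' \<Longrightarrow> g c \<in> S \<and> d c (g c) < R"
      "\<And>c v. c \<in> S' \<Longrightarrow> v \<in> S \<Longrightarrow> d c v < R / 2 \<Longrightarrow> g c = v"
    and H: "\<And>v. v \<in> S \<Longrightarrow> finite (H v) \<and> H v \<subseteq> mball v (5 * R) \<and> real (card (H v)) \<le> N"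
  shows "\<exists>w'. loglip (R / a) w' \<and> (\<forall>x\<in>M. \<delta> * w x \<le> w' x) \<and>
     (\<forall>v\<in>S. (\<Sum>c | c \<in> S' \<and> g c = v. w' c) = w v) \<and> (\<forall>v\<in>S. \<forall>h\<in>H v. \<kappa> * w v \<le> w' h)"
proof -
  \<comment> \<open>This is the value of \<open>E\<close> at distance \<open>R / 2\<close>, so
    \<open>\<beta> v\<close> vanishes at every point of \<open>S'\<close> whose parent is not
    \<open>v\<close>.\<close>
  define \<epsilon> where "\<epsilon> = exp (- a / 2)"
  define E where "E x y = exp (- a * d x y / R)" for x y
  define \<beta> where "\<beta> v x = max 0 (E x v - \<epsilon>)" for v x
  define ch where "ch v = {c \<in> S'. g c = v}" for v
  define hv where "hv x = (\<Sum>v\<in>S. \<Sum>h\<in>H v. \<kappa> * w v * E x h)" for x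
  define G where "G x = \<delta> * w x + hv x" for x
  define b where "b v = (w v - (\<Sum>c\<in>ch v. G c)) / (\<Sum>c\<in>ch v. \<beta> v c)" for v
  define w' where "w' x = G x + (\<Sum>v\<in>S. b v * \<beta> v x)" for x
  have \<delta>: "\<delta> = 4 * exp 1 * \<epsilon>" "\<delta> > 0" by (simp_all add: \<delta>_def \<epsilon>_def mult.assoc flip: exp_add)
  have SM: "S \<subseteq> M" "finite S" and S'M: "S' \<subseteq> M" "finite S'" using S S'(1) by (auto simp: separated_def)
  have ra: "R / a > 0" using R a by simp
  have wpos: "w x > 0" if "x \<in> M" for x using w that by (auto simp: loglip_def)
  have wlip: "w x \<le> exp (2 * d x y / R) * w y" if "x \<in> M" "y \<in> M" for x y
    using w that by (auto simp: loglip_def)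
  have Epos: "E x y > 0" for x y by (simp add: E_def)
  have Elip: "E x h \<le> exp (a * d x y / R) * E y h" if "x \<in> M" "y \<in> M" "h \<in> M" for x y h
  proof -
    have "d y h \<le> d x y + d x h" using triangle[of y x h] that by (simp add: commute)
    then have "a * d y h / R \<le> a * (d x y + d x h) / R"
      using R a by (intro divide_right_mono mult_left_mono) auto
    then have "- a * d x h / R \<le> a * d x y / R + - a * d y h / R"
      by (simp add: distrib_left add_divide_distrib)
    then show ?thesis by (simp add: E_def flip: exp_add)
  qed
  have Hsub: "H v \<subseteq> M" "finite (H v)" if "v \<in> S" for v using H[OF that] by auto
  have \<beta>0: "\<beta> v x \<ge> 0" for v x by (simp add: \<beta>_def)
  have \<beta>near: "d x v < R / 2" if "\<beta> v x > 0" for x v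
  proof -
    have "exp (- a / 2) < exp (- a * d x v / R)"
      using that by (simp add: \<beta>_def E_def \<epsilon>_def max_def split: if_splits)
    then have "a * (d x v / R) < a * (1 / 2)" by simp
    then have "d x v / R < 1 / 2" using a by (subst (asm) mult_less_cancel_left_pos) auto
    then show ?thesis using R by (simp add: pos_divide_less_eq)
  qed
  have hv0: "hv x \<ge> 0" for x
    unfolding hv_def using \<kappa> wpos SM Epos by (intro sum_nonneg mult_nonneg_nonneg) (auto intro: less_imp_le)
  \<comment> \<open>One quarter of \<open>w v\<close> pays for \<open>\<delta> * w\<close> and one
    quarter for the heavy points; what is left makes the coefficients \<open>b v\<close>
    nonnegative.\<close>
  have Gsum: "(\<Sum>c\<in>ch v. G c) \<le> w v / 2" if v: "v \<in> S" for v
  proof -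
    have vM: "v \<in> M" using v SM by auto
    have chM: "ch v \<subseteq> S'" "finite (ch v)" using S'M by (auto simp: ch_def)
    have sep: "separated (R / a) (ch v)" using S'(1) chM by (auto simp: separated_def)
    have dch: "d c v < R" "c \<in> M" if "c \<in> ch v" for c using that g(1)[of c] S'M by (auto simp: ch_def)
    \<comment> \<open>Children are counted by their kernel weights: each lies within
      \<open>R\<close> of \<open>v\<close> and weighs at least \<open>exp (- a / 8)\<close>. Their
      number, at most \<open>A * exp (a / 8)\<close>, is beaten by the factor
      \<open>exp (- a / 2)\<close> in \<open>\<delta>\<close>.\<close>
    have "(\<Sum>c\<in>ch v. exp (- (a / 8))) \<le> (\<Sum>c\<in>ch v. exp (- d v c / (8 * (R / a))))"
      using R a less_imp_le[OF dch(1)] by (intro sum_mono) (auto simp: field_simps commute)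
    also have "\<dots> \<le> A" by (rule A[OF ra sep vM])
    finally have "real (card (ch v)) * exp (- (a / 8)) \<le> A" by simp
    then have card: "real (card (ch v)) \<le> A * exp (a / 8)" by (simp add: exp_minus field_simps)
    have "(\<Sum>c\<in>ch v. \<delta> * w c) \<le> (\<Sum>c\<in>ch v. \<delta> * (exp 2 * w v))"
    proof (rule sum_mono)
      fix c assume c: "c \<in> ch v"
      have "w c \<le> exp (2 * d c v / R) * w v" by (rule wlip[OF dch(2)[OF c] vM])
      also have "\<dots> \<le> exp 2 * w v" using dch(1)[OF c] R wpos[OF vM] by (intro mult_right_mono) (auto simp: field_simps)
      finally show "\<delta> * w c \<le> \<delta> * (exp 2 * w v)" using \<delta>(2) by (intro mult_left_mono) auto
    qed
    also have "\<dots> = real (card (ch v)) * (\<delta> * exp 2 * w v)" by simp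
    also have "\<dots> \<le> A * exp (a / 8) * (\<delta> * exp 2 * w v)"
      using card \<delta> wpos[OF vM] by (intro mult_right_mono) auto
    also have "\<dots> = (A * 4 * exp 3 * exp (- (3 * a / 8))) * w v"
    proof -
      have "exp (a / 8) * \<delta> * exp 2 = 4 * exp 3 * exp (- (3 * a / 8))"
        unfolding \<delta>_def by (simp flip: exp_add add: mult.assoc mult.left_commute[of "exp _" 4])
      moreover have "A * exp (a / 8) * (\<delta> * exp 2 * w v) = A * (exp (a / 8) * \<delta> * exp 2) * w v"
        by (simp add: mult_ac)
      ultimately show ?thesis by (simp add: mult.assoc)
    qed
    also have "\<dots> \<le> 1 / 4 * w v"
      using aA wpos[OF vM] by (intro mult_right_mono) (auto simp: exp_minus field_simps)
    finally have p1: "(\<Sum>c\<in>ch v. \<delta> * w c) \<le> 1 / 4 * w v" .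
    have term_le: "(\<Sum>c\<in>ch v. \<kappa> * w u * E c h) \<le> \<kappa> * w v * exp 18 * exp (- d v u / (8 * R)) * A"
      if u: "u \<in> S" and h: "h \<in> H u" for u h
    proof -
      have uM: "u \<in> M" and hM: "h \<in> M" using u h SM Hsub by auto
      define t where "t = d v u / R"
      have t0: "t \<ge> 0" using R by (simp add: t_def)
      have "\<kappa> * w u * E c h \<le> \<kappa> * w v * exp 18 * exp (- d v u / (8 * R)) * exp (- d h c / (8 * (R / a)))" if c: "c \<in> ch v" for c
      proof -
        have "d u h < 5 * R" using H[OF u] h by auto
        moreover have "d v u \<le> d v c + d c h + d h u"
          using triangle[of v c u] triangle[of c h u] vM uM hM dch(2)[OF c] by linarith
        ultimately have "d v u - 6 * R < d c h" using dch(1)[OF c] by (simp add: commute)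
        then have "(d v u - 6 * R) / R < d c h / R" using R by (intro divide_strict_right_mono)
        then have t6: "t - 6 < d c h / R" using R by (simp add: t_def diff_divide_distrib)
        \<comment> \<open>The exponent is split in halves. As \<open>a / 2 \<ge> 3\<close>, the
          first half gives \<open>exp (18 - 3 * t)\<close>, with 18 = 3 * 6 from the distances
          \<open>R\<close> and \<open>5 * R\<close> to \<open>v\<close> and \<open>u\<close>:
          \<open>exp (- 2 * t)\<close> absorbs the change of \<open>w\<close> from \<open>v\<close>
          to \<open>u\<close>, and \<open>exp (- t)\<close> is summable over \<open>u\<close>. The
          second half is summable over the children. Neither sum grows with
          \<open>a\<close>.\<close>
        have 1: "- a * d c h / R = - (a / 2) * (d c h / R) - (a / 2) * (d c h / R)" by (simp add: field_simps)
        have 2: "- (a / 2) * (d c h / R) \<le> 18 - 3 * t"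
        proof (cases "t \<ge> 6")
          case True
          have "3 * (t - 6) \<le> (a / 2) * (d c h / R)" using True a t6 by (intro mult_mono) auto
          then show ?thesis by simp
        next
          case False
          have "(a / 2) * (d c h / R) \<ge> 0" using a R by simp
          then show ?thesis using False by simp
        qed
        have "(a / 2) * (d c h / R) \<ge> (a / 8) * (d c h / R)" using a R by (intro mult_right_mono) auto
        moreover have "- d h c / (8 * (R / a)) = - ((a / 8) * (d c h / R))" by (simp add: commute)
        ultimately have 3: "- (a / 2) * (d c h / R) \<le> - d h c / (8 * (R / a))" by linarith
        have "E c h \<le> exp ((18 - 3 * t) + (- d h c / (8 * (R / a))))"
          unfolding E_def exp_le_cancel_iff using 1 2 3 by linarith
        moreover have "w u \<le> exp (2 * t) * w v" using wlip[OF uM vM] by (simp add: t_def commute)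
        ultimately have "w u * E c h \<le> (exp (2 * t) * w v) * exp ((18 - 3 * t) + (- d h c / (8 * (R / a))))"
          using Epos wpos[OF vM] by (intro mult_mono) (auto intro: less_imp_le)
        also have "\<dots> = w v * exp 18 * exp (- t) * exp (- d h c / (8 * (R / a)))"
          by (simp add: mult.assoc mult.left_commute[of "exp _" "w v"] flip: exp_add)
        also have "\<dots> \<le> w v * exp 18 * exp (- d v u / (8 * R)) * exp (- d h c / (8 * (R / a)))"
          using wpos[OF vM] t0 R by (intro mult_mono) (auto simp: t_def field_simps)
        finally have "\<kappa> * (w u * E c h) \<le> \<kappa> * (w v * exp 18 * exp (- d v u / (8 * R)) * exp (- d h c / (8 * (R / a))))"
          using \<kappa> by (intro mult_left_mono) auto
        then show ?thesis by (simp add: mult.assoc)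
      qed
      then have "(\<Sum>c\<in>ch v. \<kappa> * w u * E c h) \<le>
          (\<Sum>c\<in>ch v. \<kappa> * w v * exp 18 * exp (- d v u / (8 * R)) * exp (- d h c / (8 * (R / a))))"
        by (rule sum_mono)
      also have "\<dots> = \<kappa> * w v * exp 18 * exp (- d v u / (8 * R)) * (\<Sum>c\<in>ch v. exp (- d h c / (8 * (R / a))))"
        by (simp add: sum_distrib_left)
      also have "\<dots> \<le> \<kappa> * w v * exp 18 * exp (- d v u / (8 * R)) * A"
        using A[OF ra sep hM] \<kappa> wpos[OF vM] by (intro mult_left_mono) auto
      finally show ?thesis .
    qed
    define K where "K = \<kappa> * w v * exp 18 * A"
    have K0: "K \<ge> 0" using \<kappa> wpos[OF vM] A1 by (simp add: K_def)
    have "(\<Sum>c\<in>ch v. hv c) = (\<Sum>u\<in>S. \<Sum>h\<in>H u. \<Sum>c\<in>ch v. \<kappa> * w u * E c h)"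
      unfolding hv_def by (subst sum.swap, rule sum.cong[OF refl], subst sum.swap) simp
    also have "\<dots> \<le> (\<Sum>u\<in>S. \<Sum>h\<in>H u. K * exp (- d v u / (8 * R)))"
      using term_le by (intro sum_mono) (auto simp: K_def mult.commute mult.left_commute)
    also have "\<dots> \<le> (\<Sum>u\<in>S. N * (K * exp (- d v u / (8 * R))))"
      using H K0 by (intro sum_mono) (auto intro!: mult_right_mono)
    also have "\<dots> = N * K * (\<Sum>u\<in>S. exp (- d v u / (8 * R)))" by (simp add: sum_distrib_left mult.assoc)
    also have "\<dots> \<le> N * K * A"
    proof -
      have "N \<ge> 0" using H[OF v] by (meson of_nat_0_le_iff order_trans)
      then show ?thesis using A[OF R S vM] K0 by (intro mult_left_mono) auto
    qed
    also have "\<dots> = (\<kappa> * exp 18 * A\<^sup>2 * N) * w v" by (simp add: K_def power2_eq_square)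
    also have "\<dots> \<le> 1 / 4 * w v" using \<kappa>(2) wpos[OF vM] by (intro mult_right_mono) auto
    finally show ?thesis using p1 by (simp add: G_def sum.distrib)
  qed
  \<comment> \<open>Some point of \<open>S'\<close> lies within \<open>R / a\<close> of
    \<open>v\<close>, where \<open>E\<close> is at least \<open>exp (- 1) \<ge> 1 / 3\<close>;
    truncation removes at most 1 / 12.\<close>
  have \<beta>sum: "(\<Sum>c\<in>ch v. \<beta> v c) \<ge> 1 / 4" if v: "v \<in> S" for v
  proof -
    have vM: "v \<in> M" using v SM by auto
    obtain c where c: "c \<in> S'" "d v c < R / a" using S'(2)[OF vM] by blast
    have "R / a \<le> R / 2" using R a by (intro divide_left_mono) auto
    then have "d c v < R / 2" using c(2) commute[of v c] by linarith
    then have "g c = v" using c v by (intro g(2))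
    then have "c \<in> ch v" using c by (simp add: ch_def)
    then have "(\<Sum>c\<in>ch v. \<beta> v c) \<ge> \<beta> v c" using \<beta>0 S'M by (intro member_le_sum) (auto simp: ch_def)
    moreover have "a * d c v / R \<le> 1" using c R a by (simp add: field_simps commute)
    then have "E c v \<ge> exp (- 1)" by (simp add: E_def)
    moreover have "exp (- 1 :: real) \<ge> 1 / 3" using exp_le by (simp add: exp_minus field_simps)
    moreover have "\<epsilon> \<le> 1 / 12"
    proof -
      have "(2::real) * 2 * 2 * 2 \<le> exp 1 * exp 1 * exp 1 * exp 1"
        using exp_ge_add_one_self[of "1::real"] by (intro mult_mono) auto
      moreover have "exp 1 * exp 1 * exp 1 = (exp 3 :: real)" by (simp flip: exp_add)
      moreover have "exp 3 \<le> exp (a / 2)" using a by simp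
      moreover have "(5/2::real) * (5/2) * (5/2) \<le> exp 1 * exp 1 * exp 1"
        using exp_lower_Taylor_quadratic[of 1] by (intro mult_mono) auto
      ultimately have "12 \<le> exp (a / 2)" by linarith
      then show ?thesis by (simp add: \<epsilon>_def exp_minus field_simps)
    qed
    ultimately show ?thesis by (simp add: \<beta>_def)
  qed
  have b: "0 \<le> b v" "b v \<le> 4 * w v" "(\<Sum>c\<in>ch v. b v * \<beta> v c) = w v - (\<Sum>c\<in>ch v. G c)" if v: "v \<in> S" for v
  proof -
    have vM: "v \<in> M" using v SM by auto
    have G0: "(\<Sum>c\<in>ch v. G c) \<ge> 0"
      using hv0 \<delta>(2) wpos S'M by (intro sum_nonneg) (auto simp: G_def ch_def intro!: add_nonneg_nonneg mult_nonneg_nonneg less_imp_le[OF wpos])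
    have s: "(\<Sum>c\<in>ch v. \<beta> v c) \<ge> 1 / 4" "(\<Sum>c\<in>ch v. \<beta> v c) > 0" using \<beta>sum[OF v] by auto
    have num: "0 \<le> w v - (\<Sum>c\<in>ch v. G c)" using Gsum[OF v] wpos[OF vM] by simp
    show "0 \<le> b v" unfolding b_def using s num by (intro divide_nonneg_nonneg) auto
    have "b v \<le> w v / (1 / 4)" unfolding b_def using s num G0 wpos[OF vM] by (intro frac_le) auto
    then show "b v \<le> 4 * w v" by simp
    have "(\<Sum>c\<in>ch v. b v * \<beta> v c) = b v * (\<Sum>c\<in>ch v. \<beta> v c)" by (simp add: sum_distrib_left)
    then show "(\<Sum>c\<in>ch v. b v * \<beta> v c) = w v - (\<Sum>c\<in>ch v. G c)" unfolding b_def using s by simp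
  qed
  have uniq: "u = v" if "u \<in> S" "v \<in> S" "x \<in> M" "d x u < R / 2" "d x v < R / 2" for u v x
  proof (rule ccontr)
    assume "u \<noteq> v"
    then have "R \<le> d u v" using S that by (simp add: separated_def)
    also have "\<dots> \<le> d x u + d x v" using triangle[of u x v] that SM by (auto simp: commute)
    finally show False using that by simp
  qed
  have bsum0: "(\<Sum>v\<in>S. b v * \<beta> v x) \<ge> 0" for x using b(1) \<beta>0 by (intro sum_nonneg) auto
  have w'_ge: "G x \<le> w' x" for x using bsum0 by (simp add: w'_def)
  have ge1: "\<delta> * w x \<le> w' x" for x using w'_ge[of x] hv0[of x] by (simp add: G_def)
  have cons: "(\<Sum>c\<in>ch v. w' c) = w v" if v: "v \<in> S" for v
  proof -
    have "(\<Sum>u\<in>S. b u * \<beta> u c) = b v * \<beta> v c" if c: "c \<in> ch v" for c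
    proof -
      have "\<beta> u c = 0" if u: "u \<in> S" "u \<noteq> v" for u
      proof (rule ccontr)
        assume "\<beta> u c \<noteq> 0"
        then have "\<beta> u c > 0" using \<beta>0[of u c] by simp
        then have "g c = u" using \<beta>near c u by (intro g(2)) (auto simp: ch_def)
        then show False using c u by (simp add: ch_def)
      qed
      then show ?thesis using sum.mono_neutral_right[of S "{v}" "\<lambda>u. b u * \<beta> u c"] SM v by auto
    qed
    then have "(\<Sum>c\<in>ch v. w' c) = (\<Sum>c\<in>ch v. G c) + (\<Sum>c\<in>ch v. b v * \<beta> v c)"
      by (simp add: w'_def sum.distrib)
    then show ?thesis using b(3)[OF v] by simp
  qed
  have heavy: "\<kappa> * w v \<le> w' h" if v: "v \<in> S" and h: "h \<in> H v" for v h
  proof -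
    have hM: "h \<in> M" using v h Hsub by auto
    have nn: "0 \<le> \<kappa> * w u * E h k" if "u \<in> S" for u k
      using \<kappa> wpos that SM Epos by (intro mult_nonneg_nonneg) (auto intro: less_imp_le)
    have "\<kappa> * w v * E h h \<le> (\<Sum>k\<in>H v. \<kappa> * w v * E h k)"
      using Hsub[OF v] h nn[OF v] by (intro member_le_sum) auto
    also have "\<dots> \<le> hv h" unfolding hv_def
      using SM v nn by (intro member_le_sum[of v S "\<lambda>v. \<Sum>k\<in>H v. \<kappa> * w v * E h k"]) (auto intro!: sum_nonneg)
    also have "\<dots> \<le> G h" using \<delta> wpos[OF hM] by (simp add: G_def)
    also have "\<dots> \<le> w' h" by (rule w'_ge)
    finally show ?thesis using hM by (simp add: E_def)
  qed
  have lip: "w' x \<le> exp (2 * d x y / (R / a)) * w' y" if x: "x \<in> M" and y: "y \<in> M" for x y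
  proof -
    define s where "s = a * d x y / R"
    have s0: "s \<ge> 0" using R a by (simp add: s_def)
    have w1: "w x \<le> exp (s / 2) * w y"
    proof -
      have "2 * d x y \<le> (a / 2) * d x y" using a by (intro mult_right_mono) auto
      then have "2 * d x y / R \<le> s / 2" unfolding s_def using R by (simp add: field_simps)
      then have "exp (2 * d x y / R) * w y \<le> exp (s / 2) * w y" using wpos[OF y] by (intro mult_right_mono) auto
      then show ?thesis using wlip[OF x y] by linarith
    qed
    have "hv x \<le> (\<Sum>v\<in>S. \<Sum>h\<in>H v. exp s * (\<kappa> * w v * E y h))"
      unfolding hv_def
    proof (intro sum_mono)
      fix v h assume v: "v \<in> S" and h: "h \<in> H v"
      have "E x h \<le> exp s * E y h" unfolding s_def using x y h Hsub[OF v] by (intro Elip) auto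
      then have "\<kappa> * w v * E x h \<le> \<kappa> * w v * (exp s * E y h)"
        using \<kappa> wpos v SM by (intro mult_left_mono) (auto intro!: mult_nonneg_nonneg less_imp_le[OF wpos])
      then show "\<kappa> * w v * E x h \<le> exp s * (\<kappa> * w v * E y h)" by (simp add: mult.left_commute)
    qed
    then have hv1: "hv x \<le> exp s * hv y" by (simp add: hv_def sum_distrib_left)
    \<comment> \<open>Truncated kernels are not log-Lipschitz: near the edge there is an additive
      error \<open>(exp s - 1) * \<epsilon>\<close>. Since
      \<open>b v \<le> 4 * w v \<le> 4 * exp 1 * w x\<close> and
      \<open>\<delta> = 4 * exp 1 * \<epsilon>\<close>, this error is what raises
      \<open>\<delta> * w x\<close> to \<open>exp s * (\<delta> * w x)\<close>.\<close>
    have bump: "(\<Sum>v\<in>S. b v * \<beta> v x) \<le> exp s * (\<Sum>v\<in>S. b v * \<beta> v y) + (exp s - 1) * (\<delta> * w x)"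
    proof (cases "\<exists>v\<in>S. \<beta> v x > 0")
      case False
      then have "\<And>v. v \<in> S \<Longrightarrow> \<beta> v x = 0" using \<beta>0 by (metis antisym_conv2)
      then have "(\<Sum>v\<in>S. b v * \<beta> v x) = 0" by simp
      then show ?thesis using bsum0[of y] s0 \<delta> wpos[OF x] by simp
    next
      case True
      then obtain v where v: "v \<in> S" "\<beta> v x > 0" by blast
      have vM: "v \<in> M" using v SM by auto
      have dv: "d x v < R / 2" using \<beta>near[OF v(2)] .
      have "\<beta> u x = 0" if "u \<in> S" "u \<noteq> v" for u
        using that \<beta>0[of u x] \<beta>near[of u x] uniq[OF that(1) v(1) x _ dv] by fastforce
      then have "(\<Sum>v\<in>S. b v * \<beta> v x) = b v * \<beta> v x"
        using sum.mono_neutral_right[of S "{v}" "\<lambda>u. b u * \<beta> u x"] SM v by auto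
      also have "\<dots> \<le> b v * (exp s * \<beta> v y + (exp s - 1) * \<epsilon>)"
      proof (rule mult_left_mono[OF _ b(1)[OF v(1)]])
        have "E x v \<le> exp s * E y v" unfolding s_def using x y vM by (intro Elip) auto
        moreover have "exp s * (E y v - \<epsilon>) \<le> exp s * \<beta> v y" by (simp add: \<beta>_def)
        ultimately have "E x v - \<epsilon> \<le> exp s * \<beta> v y + (exp s - 1) * \<epsilon>" by (simp add: algebra_simps)
        then show "\<beta> v x \<le> exp s * \<beta> v y + (exp s - 1) * \<epsilon>" using v(2) by (simp add: \<beta>_def split: if_splits)
      qed
      also have "\<dots> = exp s * (b v * \<beta> v y) + (exp s - 1) * (b v * \<epsilon>)" by (simp add: algebra_simps)
      also have "\<dots> \<le> exp s * (\<Sum>v\<in>S. b v * \<beta> v y) + (exp s - 1) * (\<delta> * w x)"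
      proof (intro add_mono mult_left_mono)
        show "b v * \<beta> v y \<le> (\<Sum>v\<in>S. b v * \<beta> v y)"
          using SM v b(1) \<beta>0 by (intro member_le_sum[of v S "\<lambda>v. b v * \<beta> v y"]) auto
        have "w v \<le> exp (2 * d v x / R) * w x" by (rule wlip[OF vM x])
        also have "\<dots> \<le> exp 1 * w x" using dv R wpos[OF x] by (intro mult_right_mono) (auto simp: commute field_simps)
        finally have "4 * w v \<le> 4 * exp 1 * w x" by simp
        then have "b v \<le> 4 * exp 1 * w x" using b(2)[OF v(1)] by simp
        then have "b v * \<epsilon> \<le> 4 * exp 1 * w x * \<epsilon>" by (intro mult_right_mono) (auto simp: \<epsilon>_def)
        then show "b v * \<epsilon> \<le> \<delta> * w x" by (simp add: \<delta>(1) mult.commute mult.left_commute)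
      qed (use s0 in auto)
      finally show ?thesis .
    qed
    have "w' x \<le> \<delta> * w x + exp s * hv y + (exp s * (\<Sum>v\<in>S. b v * \<beta> v y) + (exp s - 1) * (\<delta> * w x))"
      using hv1 bump by (simp add: w'_def G_def)
    also have "\<dots> = exp s * (\<delta> * w x) + exp s * (hv y + (\<Sum>v\<in>S. b v * \<beta> v y))"
      by (simp add: algebra_simps)
    also have "\<dots> \<le> exp s * (\<delta> * (exp (s / 2) * w y)) + exp (2 * s) * (hv y + (\<Sum>v\<in>S. b v * \<beta> v y))"
      using w1 \<delta> s0 hv0[of y] bsum0[of y] by (intro add_mono mult_left_mono mult_right_mono) auto
    also have "\<dots> \<le> exp (2 * s) * (\<delta> * w y) + exp (2 * s) * (hv y + (\<Sum>v\<in>S. b v * \<beta> v y))"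
    proof -
      have "exp s * exp (s / 2) \<le> exp (2 * s)" using s0 by (simp flip: exp_add)
      then have "(exp s * exp (s / 2)) * (\<delta> * w y) \<le> exp (2 * s) * (\<delta> * w y)"
        using \<delta> wpos[OF y] by (intro mult_right_mono) auto
      then show ?thesis by (simp add: mult.assoc mult.left_commute)
    qed
    also have "\<dots> = exp (2 * s) * w' y" by (simp add: w'_def G_def algebra_simps)
    finally show ?thesis by (simp add: s_def mult_ac)
  qed
  have "w' x > 0" if "x \<in> M" for x using ge1[of x] \<delta> wpos[OF that] by (smt (verit) mult_pos_pos)
  then have "loglip (R / a) w'" using lip by (simp add: loglip_def)
  then show ?thesis using ge1 cons heavy by (auto simp: ch_def)
qed

end

subsection \<open>Chains and cut points\<close>

context Metric_space
begin

lemma mdiam_leD: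
  assumes "mdiam J \<le> ennreal c" "x \<in> J" "y \<in> J" "c \<ge> 0"
  shows "d x y \<le> c"
proof -
  have "ennreal (d x y) \<le> mdiam J"
    unfolding mdiam_def using assms(2,3) by (intro SUP_upper2[of "(x, y)"]) auto
  then have "ennreal (d x y) \<le> ennreal c" using assms(1) by (rule order_trans)
  then show ?thesis using assms(4) by (simp add: ennreal_le_iff)
qed

text \<open>Linear connectedness joins the points of a fine chain by small continua; their union is connected,
  so it cannot avoid a set that separates the two ends.\<close>

lemma chain_meets_cut:
  assumes lc: "\<And>x y. x \<in> M \<Longrightarrow> y \<in> M \<Longrightarrow> \<exists>J. compactin mtopology J \<and> connectedin mtopology J \<and>
      x \<in> J \<and> y \<in> J \<and> mdiam J \<le> ennreal (C * d x y)" and C: "C \<ge> 0"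
    and y: "\<And>l. y l \<in> M" and ef: "e \<le> f"
    and jump: "\<And>l. e \<le> l \<Longrightarrow> l < f \<Longrightarrow> d (y l) (y (Suc l)) \<le> \<eta>"
    and cut: "\<not> (\<exists>K \<in> connected_components_of (subtopology mtopology (M - P)).
          K \<inter> mball x (r / 2) \<noteq> {} \<and> K \<inter> (M - mcball x r) \<noteq> {})"
    and x: "x \<in> M" "d x (y e) < r / 2" "r < d x (y f)"
  shows "\<exists>l h. e \<le> l \<and> l < f \<and> h \<in> P \<and> h \<in> M \<and> d (y l) h \<le> C * \<eta>"
proof (rule ccontr)
  assume neg: "\<not> ?thesis"
  have "\<exists>J. compactin mtopology J \<and> connectedin mtopology J \<and>
      y l \<in> J \<and> y (Suc l) \<in> J \<and> mdiam J \<le> ennreal (C * d (y l) (y (Suc l)))" for l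
    by (rule lc[OF y y])
  then obtain J where J: "\<And>l. connectedin mtopology (J l)" "\<And>l. y l \<in> J l" "\<And>l. y (Suc l) \<in> J l"
     "\<And>l. mdiam (J l) \<le> ennreal (C * d (y l) (y (Suc l)))" by metis
  define U where "U n = insert (y e) (\<Union>l\<in>{e..<n}. J l)" for n
  have U: "connectedin mtopology (U n) \<and> y n \<in> U n" if "e \<le> n" for n
    using that
  proof (induction n rule: dec_induct)
    case base
    then show ?case using y by (simp add: U_def connectedin_sing)
  next
    case (step n)
    have "U (Suc n) = U n \<union> J n" using step(1) by (auto simp: U_def less_Suc_eq)
    moreover have "connectedin mtopology (U n \<union> J n)"
      using step J(1,2) by (intro connectedin_Un) auto
    ultimately show ?case using J(3) by simp
  qed
  have JM: "J l \<subseteq> M" for l using connectedin_subset_topspace[OF J(1)] by simp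
  have JP: "h \<notin> P" if l: "e \<le> l" "l < f" and h: "h \<in> J l" for l h
  proof
    assume hP: "h \<in> P"
    have "d (y l) h \<le> C * d (y l) (y (Suc l))" using mdiam_leD[OF J(4) J(2) h] C by simp
    also have "\<dots> \<le> C * \<eta>" using jump[OF l] C by (rule mult_left_mono)
    finally show False using neg l h hP JM by blast
  qed
  have "y e \<notin> P"
  proof
    assume "y e \<in> P"
    have "e < f" using x ef by (metis le_neq_implies_less less_trans field_sum_of_halves add_less_same_cancel1 nonneg not_less order_less_le_trans)
    moreover have "d (y e) (y e) \<le> C * \<eta>"
      using C jump[of e] \<open>e < f\<close> y by (simp add: order_trans[OF nonneg])
    ultimately show False using neg \<open>y e \<in> P\<close> y by blast
  qed
  then have "U f \<inter> P = {}" using JP by (auto simp: U_def)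
  moreover have "U f \<subseteq> M" using U[OF ef] connectedin_subset_topspace by fastforce
  ultimately have "connectedin (subtopology mtopology (M - P)) (U f)"
    using U[OF ef] by (auto simp: connectedin_subtopology)
  moreover have "y f \<in> topspace (subtopology mtopology (M - P))"
    using U[OF ef] \<open>U f \<inter> P = {}\<close> \<open>U f \<subseteq> M\<close> by auto
  ultimately obtain K where K: "K \<in> connected_components_of (subtopology mtopology (M - P))" "U f \<subseteq> K"
    using U[OF ef] by (metis connected_component_of_maximal connected_component_in_connected_components_of)
  have "y e \<in> K \<inter> mball x (r / 2)" using K(2) x y by (auto simp: U_def)
  moreover have "y f \<in> K \<inter> (M - mcball x r)" using K(2) U[OF ef] x y by auto
  ultimately show False using cut K(1) by blast
qed

text \<open>Otherwise the open ball and the complement of the closed ball would disconnect the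
  space; for \<open>r = 0\<close> the point is \<open>x\<close> itself.\<close>

lemma sphere_point:
  assumes connected: "connected_space mtopology" and "x \<in> M" "y \<in> M" "0 \<le> r" "r < d x y"
  shows "\<exists>z\<in>M. d x z = r"
proof (rule ccontr)
  assume neg: "\<not> ?thesis"
  then have "r \<noteq> 0" using assms(2) by force
  then have r: "r > 0" using assms by simp
  have "openin mtopology (mball x r)" "openin mtopology (M - mcball x r)" by auto
  moreover have "topspace mtopology \<subseteq> mball x r \<union> (M - mcball x r)"
    using neg assms(2) by force
  moreover have "mball x r \<inter> (M - mcball x r) = {}" by auto
  moreover have "mball x r \<noteq> {}" "M - mcball x r \<noteq> {}" using assms r by auto
  ultimately show False using connected unfolding connected_space_def by blast
qed

end

text \<open>\<open>m n x\<close> stands for the mass of the ball of radius \<open>R n\<close> around \<open>x\<close>, and \<open>P x r\<close> for the set given by the UWS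
  condition. In \<open>heavy\<close>, \<open>z\<close> is a cut point near \<open>v\<close> and \<open>h\<close> a cut point for the \<open>j\<close>-th annulus around \<open>z\<close>; the
  factor \<open>exp 3\<close> pays for moving from \<open>h\<close> and \<open>v\<close> to points nearby.\<close>

locale cut_tower = Metric_space M d for M :: "'a set" and d +
  fixes a D \<delta> p A C :: real and k :: nat
    and S :: "nat \<Rightarrow> 'a set" and g :: "nat \<Rightarrow> 'a \<Rightarrow> 'a" and m :: "nat \<Rightarrow> 'a \<Rightarrow> real"
    and P :: "'a \<Rightarrow> real \<Rightarrow> 'a set"
    and R :: "nat \<Rightarrow> real"
  assumes R_def: "\<And>n. R n = D / a ^ n"
    and compact: "compact_space mtopology"
    and connected: "connected_space mtopology"
    and nonempty: "M \<noteq> {}"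
    and D: "D > 0" "\<And>x y. x \<in> M \<Longrightarrow> y \<in> M \<Longrightarrow> d x y < D" "\<And>x. x \<in> M \<Longrightarrow> \<exists>y\<in>M. D / 8 < d x y"
    and k: "k \<ge> 1" and a: "a \<ge> 10 * 8 ^ k" "a \<ge> 10 * C"
    and C: "C \<ge> 0"
    and \<delta>: "0 < \<delta>" "\<delta> < 1" and p: "p > 1"
    and S: "\<And>n. separated (R n) (S n)" "\<And>n x. x \<in> M \<Longrightarrow> \<exists>v\<in>S n. d x v < R n"
    and kernel: "\<And>n x. x \<in> M \<Longrightarrow> (\<Sum>v\<in>S n. exp (- d x v / (8 * R n))) \<le> A"
    and g: "\<And>n c. c \<in> S (Suc n) \<Longrightarrow> g n c \<in> S n \<and> d c (g n c) < R n"
      "\<And>n c v. c \<in> S (Suc n) \<Longrightarrow> v \<in> S n \<Longrightarrow> d c v < R n / 2 \<Longrightarrow> g n c = v"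
    and m: "\<And>n. loglip (R n) (m n)" "\<And>n x. x \<in> M \<Longrightarrow> \<delta> * m n x \<le> m (Suc n) x"
      "\<And>n v. v \<in> S n \<Longrightarrow> (\<Sum>c | c \<in> S (Suc n) \<and> g n c = v. m (Suc n) c) = m n v"
      "\<And>x. x \<in> M \<Longrightarrow> m 0 x = 1"
    and linear: "\<And>x y. x \<in> M \<Longrightarrow> y \<in> M \<Longrightarrow> \<exists>J. compactin mtopology J \<and> connectedin mtopology J \<and>
      x \<in> J \<and> y \<in> J \<and> mdiam J \<le> ennreal (C * d x y)"
    and cut: "\<And>x r. x \<in> M \<Longrightarrow> r > 0 \<Longrightarrow> P x r \<subseteq> mball x r \<and>
      \<not> (\<exists>K \<in> connected_components_of (subtopology mtopology (M - P x r)).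
          K \<inter> mball x (r / 2) \<noteq> {} \<and> K \<inter> (M - mcball x r) \<noteq> {})"
    and heavy: "\<And>n v z j h. v \<in> S n \<Longrightarrow> z \<in> P v (4 * R n) \<Longrightarrow> j < k \<Longrightarrow>
      h \<in> P z (3 * (R n * 8 ^ j / 8 ^ k)) \<Longrightarrow> exp 3 / real k powr p * m n v \<le> m (Suc n) h"
begin

section \<open>Scales and the decay of masses\<close>

lemma a80: "a \<ge> 80"
proof -
  have "(8::real) ^ 1 \<le> 8 ^ k" using k by (intro power_increasing) auto
  then show ?thesis using a(1) by simp
qed

lemma R_pos: "R n > 0" using D a80 by (simp add: R_def)

lemma R_Suc: "R (Suc n) = R n / a" by (simp add: R_def)

lemma R_Suc_le: "80 * R (Suc n) \<le> R n"
  using a80 R_pos[of n] by (simp add: R_Suc pos_divide_le_eq)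

lemma R_antimono: "i \<le> j \<Longrightarrow> R j \<le> R i"
proof (rule lift_Suc_antimono_le[of R])
  show "R (Suc n) \<le> R n" for n using R_Suc_le[of n] R_pos[of "Suc n"] by linarith
qed

lemma R_small: "e > 0 \<Longrightarrow> \<exists>n. R n < e"
proof -
  assume e: "e > 0"
  obtain n where "D / e < a ^ n" using real_arch_pow[of a "D / e"] a80 by auto
  then have "R n < e" using e a80 by (simp add: R_def field_simps)
  then show ?thesis by blast
qed

lemma m_pos: "x \<in> M \<Longrightarrow> m n x > 0" using m(1) by (simp add: loglip_def)

lemma m_lip: "x \<in> M \<Longrightarrow> y \<in> M \<Longrightarrow> d x y \<le> t * R n \<Longrightarrow> m n x \<le> exp (2 * t) * m n y"
proof -
  assume xy: "x \<in> M" "y \<in> M" "d x y \<le> t * R n"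
  have "m n x \<le> exp (2 * d x y / R n) * m n y" using m(1) xy by (simp add: loglip_def)
  also have "\<dots> \<le> exp (2 * t) * m n y"
    using xy R_pos[of n] m_pos[OF xy(2), of n] by (intro mult_right_mono) (auto simp: field_simps)
  finally show ?thesis .
qed

lemma S_sub: "v \<in> S n \<Longrightarrow> v \<in> M" using S(1) by (auto simp: separated_def)

lemma S_finite: "finite (S n)" using S(1) by (auto simp: separated_def)

text \<open>A second child is what forces masses to decay. By connectedness there is a point at
  distance \<open>R n / 8\<close> from \<open>v\<close>; a net point close to it and one close to
  \<open>v\<close> are distinct and both lie within \<open>R n / 2\<close> of
  \<open>v\<close>.\<close>

lemma two_children:
  assumes v: "v \<in> S n"
  shows "\<exists>c\<in>S (Suc n). \<exists>c'\<in>S (Suc n). c \<noteq> c' \<and> g n c = v \<and> g n c' = v"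
proof -
  have vM: "v \<in> M" by (rule S_sub[OF v])
  obtain y where y: "y \<in> M" "D / 8 < d v y" using D(3)[OF vM] by blast
  have "R n \<le> D" using R_antimono[of 0 n] by (simp add: R_def)
  then obtain z where z: "z \<in> M" "d v z = R n / 8"
    using sphere_point[OF connected vM y(1), of "R n / 8"] y(2) R_pos[of n] by auto
  obtain c where c: "c \<in> S (Suc n)" "d v c < R (Suc n)" using S(2)[OF vM] by blast
  obtain c' where c': "c' \<in> S (Suc n)" "d z c' < R (Suc n)" using S(2)[OF z(1)] by blast
  note M = S_sub[OF c(1)] S_sub[OF c'(1)]
  have t: "d v c' \<le> d v z + d z c'" "d v z \<le> d v c' + d z c'"
    using triangle[of v z c'] triangle[of v c' z] vM z M by (auto simp: commute)
  have "g n c = v" using c v R_Suc_le[of n] R_pos[of n] by (intro g(2)) (auto simp: commute)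
  moreover have "g n c' = v" using t c' v z(2) R_Suc_le[of n] R_pos[of n] by (intro g(2)) (auto simp: commute)
  moreover have "c \<noteq> c'" using t c c' z(2) R_Suc_le[of n] R_pos[of n] by auto
  ultimately show ?thesis using c c' by blast
qed

text \<open>A sibling keeps at least the share \<open>\<delta> * exp (- 2)\<close> of the parent's
  mass, so \<open>\<sigma>\<close> bounds the share of a single child.\<close>

definition \<sigma> where "\<sigma> = 1 - \<delta> * exp (- 2)"

lemma \<sigma>: "0 < \<sigma>" "\<sigma> < 1"
proof -
  have "\<delta> * exp (- 2) < 1 * 1" using \<delta> by (intro mult_strict_mono) auto
  then show "0 < \<sigma>" "\<sigma> < 1" using \<delta> by (auto simp: \<sigma>_def)
qed

lemma child_le:
  assumes c: "c \<in> S (Suc n)"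
  shows "m (Suc n) c \<le> \<sigma> * m n (g n c)"
proof -
  define v where "v = g n c"
  have v: "v \<in> S n" using g(1)[OF c] by (simp add: v_def)
  obtain c' where c': "c' \<in> S (Suc n)" "c' \<noteq> c" "g n c' = v" using two_children[OF v] by metis
  have "m n v \<le> exp (2 * 1) * m n c'"
    using g(1)[OF c'(1)] c' S_sub v by (intro m_lip) (auto simp: commute less_imp_le)
  then have "exp (- 2) * m n v \<le> m n c'" by (simp add: exp_minus field_simps)
  then have "\<delta> * (exp (- 2) * m n v) \<le> \<delta> * m n c'" using \<delta> by (intro mult_left_mono) auto
  also have "\<dots> \<le> m (Suc n) c'" by (rule m(2)[OF S_sub[OF c'(1)]])
  finally have 1: "\<delta> * exp (- 2) * m n v \<le> m (Suc n) c'" by (simp add: mult.assoc)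
  have "(\<Sum>c\<in>{c, c'}. m (Suc n) c) \<le> (\<Sum>c | c \<in> S (Suc n) \<and> g n c = v. m (Suc n) c)"
    using c c' S_finite S_sub by (intro sum_mono2) (auto simp: v_def intro: less_imp_le[OF m_pos])
  also have "\<dots> = m n v" by (rule m(3)[OF v])
  finally have "m (Suc n) c + m (Suc n) c' \<le> m n v" using c'(2) by simp
  then show ?thesis using 1 by (simp add: \<sigma>_def v_def algebra_simps)
qed

text \<open>The distance bound telescopes: a step shorter than \<open>R (n + j)\<close> is shorter
  than \<open>2 * (R (n + j) - R (n + Suc j))\<close>.\<close>

lemma ancestor:
  assumes "c \<in> S (n + j)"
  shows "\<exists>v\<in>S n. m (n + j) c \<le> \<sigma> ^ j * m n v \<and> d c v \<le> 2 * (R n - R (n + j))"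
  using assms
proof (induction j arbitrary: c)
  case 0
  then show ?case using S_sub by (intro bexI[of _ c]) auto
next
  case (Suc j)
  define c' where "c' = g (n + j) c"
  have c: "c \<in> S (Suc (n + j))" using Suc.prems by simp
  have c': "c' \<in> S (n + j)" "d c c' < R (n + j)" using g(1)[OF c] by (auto simp: c'_def)
  obtain v where v: "v \<in> S n" "m (n + j) c' \<le> \<sigma> ^ j * m n v" "d c' v \<le> 2 * (R n - R (n + j))"
    using Suc.IH[OF c'(1)] by blast
  have "m (Suc (n + j)) c \<le> \<sigma> * m (n + j) c'" using child_le[OF c] by (simp add: c'_def)
  also have "\<dots> \<le> \<sigma> * (\<sigma> ^ j * m n v)" using v(2) \<sigma> by (intro mult_left_mono) auto
  finally have 1: "m (n + Suc j) c \<le> \<sigma> ^ Suc j * m n v" by simp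
  have "d c v \<le> d c c' + d c' v" using S_sub c c' v by (intro triangle) auto
  moreover have "80 * R (n + Suc j) \<le> R (n + j)" "R (n + Suc j) > 0"
    using R_Suc_le[of "n + j"] R_pos[of "n + Suc j"] by auto
  ultimately have "d c v \<le> 2 * (R n - R (n + Suc j))" using c'(2) v(3) by argo
  with 1 v(1) show ?case by blast
qed

text \<open>Passing from \<open>x\<close> to a net point at the fine scale costs
  \<open>exp 2\<close>, and returning from its ancestor, within \<open>3 * R n\<close> of
  \<open>x\<close>, costs \<open>exp 6\<close>.\<close>

lemma m_decay:
  assumes x: "x \<in> M"
  shows "m (n + j) x \<le> exp 8 * \<sigma> ^ j * m n x"
proof -
  obtain c where c: "c \<in> S (n + j)" "d x c < R (n + j)" using S(2)[OF x] by blast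
  obtain v where v: "v \<in> S n" "m (n + j) c \<le> \<sigma> ^ j * m n v" "d c v \<le> 2 * (R n - R (n + j))"
    using ancestor[OF c(1)] by blast
  note M = S_sub[OF c(1)] S_sub[OF v(1)]
  have "d v x \<le> d c v + d x c" using triangle[of v c x] M x by (simp add: commute)
  also have "\<dots> \<le> 3 * R n" using v c R_antimono[of n "n + j"] R_pos[of "n + j"] by simp
  finally have "m n v \<le> exp (2 * 3) * m n x" using M x by (intro m_lip) auto
  then have 1: "\<sigma> ^ j * m n v \<le> \<sigma> ^ j * (exp 6 * m n x)" using \<sigma> by (intro mult_left_mono) auto
  have "m (n + j) x \<le> exp (2 * 1) * m (n + j) c" using c M x by (intro m_lip) auto
  also have "\<dots> \<le> exp 2 * (\<sigma> ^ j * (exp 6 * m n x))" using v(2) 1 by simp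
  also have "\<dots> = exp 8 * \<sigma> ^ j * m n x"
    using exp_add[of "2::real" 6] by (simp add: mult_ac)
  finally show ?thesis .
qed

lemma m_quasi_decreasing:
  assumes "x \<in> M" "n \<le> l"
  shows "m l x \<le> exp 8 * m n x"
proof -
  have "m l x \<le> exp 8 * \<sigma> ^ (l - n) * m n x" using m_decay[OF assms(1), of n "l - n"] assms(2) by simp
  also have "\<dots> \<le> exp 8 * 1 * m n x"
    using \<sigma> m_pos[OF assms(1), of n] by (intro mult_right_mono mult_left_mono power_le_one) auto
  finally show ?thesis by simp
qed

lemma m_growth:
  assumes "x \<in> M"
  shows "\<delta> ^ j * m n x \<le> m (n + j) x"
proof (induction j)
  case (Suc j)
  have "\<delta> ^ Suc j * m n x = \<delta> * (\<delta> ^ j * m n x)" by simp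
  also have "\<dots> \<le> \<delta> * m (n + j) x" using Suc \<delta> by (intro mult_left_mono) auto
  also have "\<dots> \<le> m (n + Suc j) x" using m(2)[OF assms, of "n + j"] by simp
  finally show ?case .
qed simp

section \<open>Weights of jumps and the lengths of chains\<close>

definition lev :: "real \<Rightarrow> nat" where
  "lev t = (LEAST n. R (Suc n) < t)"

lemma lev:
  assumes "t > 0"
  shows "R (Suc (lev t)) < t" "t \<le> D \<Longrightarrow> t \<le> R (lev t)"
proof -
  obtain n where "R n < t" using R_small[OF assms] by blast
  moreover have "R (Suc n) \<le> R n" by (intro R_antimono) simp
  ultimately have ex: "\<exists>n. R (Suc n) < t" by (meson le_less_trans)
  show "R (Suc (lev t)) < t" unfolding lev_def by (rule LeastI_ex[OF ex])
  assume t: "t \<le> D"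
  show "t \<le> R (lev t)"
  proof (cases "lev t")
    case 0
    then show ?thesis using t by (simp add: R_def)
  next
    case (Suc l)
    then have "\<not> R (Suc l) < t" unfolding lev_def using not_less_Least by (metis lessI)
    then show ?thesis using Suc by simp
  qed
qed

lemma lev_le: "R (Suc n) < t \<Longrightarrow> lev t \<le> n"
  unfolding lev_def by (rule Least_le)

text \<open>For \<open>x = y\<close> the level is an unspecified value of \<open>LEAST\<close>, and
  \<open>q x x\<close> is positive on \<open>M\<close>. The chain metric still vanishes there
  because it admits the chain without steps.\<close>

definition q :: "'a \<Rightarrow> 'a \<Rightarrow> real" where
  "q x y = m (lev (d x y)) x powr (1 / p) + m (lev (d x y)) y powr (1 / p)"

lemma q_nonneg: "q x y \<ge> 0" by (simp add: q_def)

lemma q_commute: "q x y = q y x" by (simp add: q_def commute)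

text \<open>This is what one long jump yields: \<open>exp 20\<close> for moving the base point by
  \<open>10 * R n\<close>, \<open>\<delta>\<close> for descending one level, \<open>exp 8\<close>
  for the quasi-monotonicity of the masses.\<close>

definition chain_const :: real where
  "chain_const = (exp (- 28) * \<delta>) powr (1 / p)"

lemma chain_const_pos: "chain_const > 0" using \<delta> by (simp add: chain_const_def)

text \<open>A fine chain leaving \<open>y e\<close> must pass a cut point \<open>z\<close>, and on its way out it
  crosses \<open>k\<close> disjoint annuli around \<open>z\<close>, in each of which it comes close to a cut point of weight at least
  \<open>1 / k\<close> of that of \<open>y e\<close>; the constant is reproduced exactly, so that the induction closes.\<close>

lemma chain_inequality:
  assumes "\<And>l. y l \<in> M" "e \<le> f" "10 * R n \<le> d (y e) (y f)"
  shows "chain_const * m n (y e) powr (1 / p) \<le> (\<Sum>l\<in>{e..<f}. q (y l) (y (Suc l)))"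
  using assms(2,3)
proof (induction "f - e" arbitrary: e f n rule: less_induct)
  case less
  note y = assms(1)
  define L where "L i j = (\<Sum>l\<in>{i..<j}. q (y l) (y (Suc l)))" for i j
  have L_add: "L i j + L j l = L i l" if "i \<le> j" "j \<le> l" for i j l
    unfolding L_def using that by (rule sum.atLeastLessThan_concat)
  have L_nonneg: "L i j \<ge> 0" for i j unfolding L_def by (intro sum_nonneg q_nonneg)
  define m0 where "m0 = m n (y e)"
  have m0: "m0 > 0" using m_pos[OF y] by (simp add: m0_def)
  \<comment> \<open>The chain is cut at its first exit, so that all earlier points stay within
    \<open>10 * R n\<close> of \<open>y e\<close>.\<close>
  define f' where "f' = (LEAST j. e \<le> j \<and> 10 * R n \<le> d (y e) (y j))"
  have f': "e \<le> f'" "10 * R n \<le> d (y e) (y f')"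
    unfolding f'_def using LeastI[of "\<lambda>j. e \<le> j \<and> 10 * R n \<le> d (y e) (y j)" f] less.prems by auto
  have f'f: "f' \<le> f" unfolding f'_def by (rule Least_le) (use less.prems in auto)
  have inside: "d (y e) (y j) < 10 * R n" if "e \<le> j" "j < f'" for j
    using not_less_Least[of j "\<lambda>j. e \<le> j \<and> 10 * R n \<le> d (y e) (y j)"] that unfolding f'_def by force
  have "chain_const * m0 powr (1 / p) \<le> L e f'"
  \<comment> \<open>A jump longer than \<open>R (n + 2)\<close> has level at most
    \<open>n + 1\<close>, however long it is, and masses at coarser levels are at least those at
    level \<open>n + 1\<close> up to \<open>exp 8\<close>. This single term suffices.\<close>
  proof (cases "\<exists>l. e \<le> l \<and> l < f' \<and> R (Suc (Suc n)) < d (y l) (y (Suc l))")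
    case True
    then obtain l where l: "e \<le> l" "l < f'" "R (Suc (Suc n)) < d (y l) (y (Suc l))" by blast
    define i where "i = lev (d (y l) (y (Suc l)))"
    have i: "i \<le> Suc n" unfolding i_def by (rule lev_le[OF l(3)])
    have "m0 \<le> exp (2 * 10) * m n (y l)" unfolding m0_def
      using inside[OF l(1,2)] y by (intro m_lip) auto
    then have "\<delta> * m0 \<le> exp 20 * (\<delta> * m n (y l))" using \<delta> by simp
    also have "\<dots> \<le> exp 20 * m (Suc n) (y l)" using m(2)[OF y, of n] by simp
    also have "\<dots> \<le> exp 20 * (exp 8 * m i (y l))" using m_quasi_decreasing[OF y i] by simp
    also have "\<dots> = exp 28 * m i (y l)" by (simp flip: exp_add mult.assoc)
    finally have "exp (- 28) * \<delta> * m0 \<le> m i (y l)" by (simp add: exp_minus field_simps)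
    then have "(exp (- 28) * \<delta> * m0) powr (1 / p) \<le> m i (y l) powr (1 / p)"
      using \<delta> m0 p by (intro powr_mono2) auto
    then have "chain_const * m0 powr (1 / p) \<le> m i (y l) powr (1 / p)"
      using \<delta> m0 by (simp add: chain_const_def powr_mult)
    also have "\<dots> \<le> q (y l) (y (Suc l))" by (simp add: q_def i_def)
    also have "\<dots> \<le> L e f'" unfolding L_def
      using l q_nonneg by (intro member_le_sum[of l "{e..<f'}" "\<lambda>l. q (y l) (y (Suc l))"]) auto
    finally show ?thesis .
  next
    case False
    then have jump: "d (y l) (y (Suc l)) \<le> R (Suc (Suc n))" if "e \<le> l" "l < f'" for l using that by force
    have small: "C * R (Suc (Suc n)) \<le> R (Suc n) / 10"
      using a a80 R_pos[of "Suc n"] mult_right_mono[of "10 * C" a "R (Suc n)"] by (simp add: R_Suc[of "Suc n"] field_simps)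
    obtain v where v: "v \<in> S n" "d (y e) v < R n" using S(2)[OF y] by blast
    have vM: "v \<in> M" by (rule S_sub[OF v(1)])
    have far: "9 * R n < d v (y f')"
      using triangle[of "y e" v "y f'"] f'(2) v(2) y vM by (simp add: commute)
    \<comment> \<open>The start lies within \<open>R n\<close> of \<open>v\<close>, inside half the
      radius \<open>4 * R n\<close>, and the exit point is beyond \<open>9 * R n\<close>. So the
      chain crosses this cut, and its end stays at least \<open>T k = R n\<close> away from every
      point of \<open>PP\<close>.\<close>
    define PP where "PP = P v (4 * R n)"
    have cut1: "PP \<subseteq> mball v (4 * R n)"
      "\<not> (\<exists>K \<in> connected_components_of (subtopology mtopology (M - PP)).
          K \<inter> mball v (4 * R n / 2) \<noteq> {} \<and> K \<inter> (M - mcball v (4 * R n)) \<noteq> {})"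
      using cut[OF vM, of "4 * R n"] R_pos[of n] by (auto simp: PP_def)
    obtain l z where l: "e \<le> l" "l < f'" and z: "z \<in> PP" "z \<in> M" "d (y l) z \<le> C * R (Suc (Suc n))"
      using chain_meets_cut[where y = y and C = C and P = PP and x = v and r = "4 * R n" and e = e and f = f',
          OF linear C y f'(1) jump cut1(2) vM] v(2) far R_pos[of n] by (auto simp: commute)
    have dz: "d v z < 4 * R n" using z(1) cut1(1) by auto
    have zf: "R n \<le> d z (y f')" using triangle[of v z "y f'"] vM z y dz far R_pos[of n] by simp
    have zl: "d z (y l) \<le> R (Suc n) / 10" using z small by (simp add: commute)
    define T where "T j = R n * 8 ^ j / 8 ^ k" for j :: nat
    define w where "w = chain_const * m0 powr (1 / p) / real k"
    have T_pos: "T j > 0" for j using R_pos[of n] by (simp add: T_def)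
    have T_Suc: "T (Suc j) = 8 * T j" for j by (simp add: T_def)
    have T_ge: "10 * R (Suc n) \<le> T j" for j
    proof -
      have "10 * R (Suc n) \<le> R n / 8 ^ k"
        using a(1) R_pos[of n] a80 mult_right_mono[OF a(1), of "R n"] by (simp add: R_Suc field_simps)
      also have "\<dots> \<le> T j" using R_pos[of n] by (simp add: T_def divide_right_mono)
      finally show ?thesis .
    qed
    \<comment> \<open>Reaching distance \<open>T j\<close> from \<open>z\<close> costs
      \<open>j\<close> portions \<open>w\<close>. From its first arrival \<open>b'\<close> at
      distance \<open>T j\<close> the chain leads from less than \<open>3 * T j / 2\<close> to at
      least \<open>8 * T j\<close>, across the cut of radius \<open>3 * T j\<close>. Past that cut
      point it still travels more than \<open>10 * R (Suc n)\<close>, so the outer induction, one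
      level deeper, yields the next portion, disjoint from the earlier ones.\<close>
    have step: "real j * w \<le> L l b" if "j \<le> k" "l \<le> b" "b \<le> f'" "T j \<le> d z (y b)" for j b
      using that
    proof (induction j arbitrary: b)
      case 0
      then show ?case using L_nonneg by simp
    next
      case (Suc j)
      define b' where "b' = (LEAST i. l \<le> i \<and> T j \<le> d z (y i))"
      have "T j \<le> d z (y b)" using Suc.prems T_Suc[of j] T_pos[of j] by simp
      then have b': "l \<le> b'" "T j \<le> d z (y b')"  "b' \<le> b" 
        unfolding b'_def using LeastI[of "\<lambda>i. l \<le> i \<and> T j \<le> d z (y i)" b] Suc.prems
        by (auto intro: Least_le)
      have R1: "R (Suc n) > 0" "80 * R (Suc (Suc n)) \<le> R (Suc n)" using R_pos R_Suc_le by auto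
      \<comment> \<open>This supplies the predecessor of \<open>b'\<close>, which bounds the
        overshoot at the first arrival, and makes the piece from \<open>i\<close> to
        \<open>b\<close> strictly shorter than the chain from \<open>e\<close> to
        \<open>f\<close>.\<close>
      have "l \<noteq> b'" using b'(2) zl T_ge[of j] R1 by auto
      then obtain b0 where b0: "b' = Suc b0" "l \<le> b0" using b'(1) by (cases b') auto
      have "d z (y b0) < T j" using not_less_Least[of b0 "\<lambda>i. l \<le> i \<and> T j \<le> d z (y i)"] b0
        unfolding b'_def by force
      moreover have "d (y b0) (y b') \<le> R (Suc (Suc n))"
        using jump[of b0] b0 l b'(3) Suc.prems by simp
      moreover have "d z (y b') \<le> d z (y b0) + d (y b0) (y b')" using z y by (intro triangle) auto
      ultimately have near: "d z (y b') < 3 * T j / 2" using T_ge[of j] R1 by argo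
      define Q where "Q = P z (3 * T j)"
      have cut2: "Q \<subseteq> mball z (3 * T j)"
        "\<not> (\<exists>K \<in> connected_components_of (subtopology mtopology (M - Q)).
          K \<inter> mball z (3 * T j / 2) \<noteq> {} \<and> K \<inter> (M - mcball z (3 * T j)) \<noteq> {})"
        using cut[OF z(2), of "3 * T j"] T_pos[of j] by (auto simp: Q_def)
      have jump': "d (y i) (y (Suc i)) \<le> R (Suc (Suc n))" if "b' \<le> i" "i < b" for i
        using that b'(1) l Suc.prems by (intro jump) auto
      have "3 * T j < d z (y b)" using Suc.prems T_Suc[of j] T_pos[of j] by simp
      then obtain i h where i: "b' \<le> i" "i < b" and h: "h \<in> Q" "h \<in> M" "d (y i) h \<le> C * R (Suc (Suc n))"
        using chain_meets_cut[where y = y and C = C and P = Q and x = z and r = "3 * T j" and e = b' and f = b,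
            OF linear C y b'(3) jump' cut2(2) z(2) near] by blast
      have "d z h < 3 * T j" using h(1) cut2(1) by auto
      moreover have "d z (y i) \<le> d z h + d (y i) h" using triangle[of z h "y i"] z h y by (simp add: commute)
      moreover have "d z (y b) \<le> d z (y i) + d (y i) (y b)" using z y by (intro triangle) auto
      ultimately have "10 * R (Suc n) \<le> d (y i) (y b)"
        using h(3) small Suc.prems(4) T_Suc[of j] T_ge[of j] R1 by argo
      moreover have "b - i < f - e" using i b'(1) b0 l Suc.prems f'f by linarith
      ultimately have IH: "chain_const * m (Suc n) (y i) powr (1 / p) \<le> L i b"
        unfolding L_def using less.hyps[of b i "Suc n"] i by simp
      have "exp 3 / real k powr p * m n v \<le> m (Suc n) h"
        using heavy[OF v(1), of z j h] z(1) h(1) Suc.prems(1) by (auto simp: PP_def Q_def T_def)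
      moreover have "m (Suc n) h \<le> exp (2 * (1 / 2)) * m (Suc n) (y i)"
        using h small R1 y by (intro m_lip) (auto simp: commute)
      moreover have "m0 \<le> exp (2 * 1) * m n v" unfolding m0_def using v vM y by (intro m_lip) auto
      \<comment> \<open>The factor \<open>exp 3\<close> is spent here: \<open>exp 1\<close> between
        \<open>h\<close> and \<open>y i\<close>, and \<open>exp 2\<close> between \<open>v\<close>
        and \<open>y e\<close>.\<close>
      ultimately have "m0 / real k powr p \<le> m (Suc n) (y i)"
      proof -
        assume 1: "exp 3 / real k powr p * m n v \<le> m (Suc n) h"
          and 2: "m (Suc n) h \<le> exp (2 * (1 / 2)) * m (Suc n) (y i)" and 3: "m0 \<le> exp (2 * 1) * m n v"
        have "exp 1 * (m0 / real k powr p) \<le> exp 1 * (exp 2 * m n v / real k powr p)"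
          using 3 by (intro mult_left_mono divide_right_mono) auto
        also have "\<dots> = (exp 1 * exp 2) / real k powr p * m n v" by simp
        also have "\<dots> = exp 3 / real k powr p * m n v" by (simp flip: exp_add)
        also have "\<dots> \<le> exp 1 * m (Suc n) (y i)" using 1 2 by simp
        finally show ?thesis by (subst (asm) mult_le_cancel_left_pos) auto
      qed
      then have "(m0 / real k powr p) powr (1 / p) \<le> m (Suc n) (y i) powr (1 / p)"
        using m0 p k by (intro powr_mono2) auto
      moreover have "(m0 / real k powr p) powr (1 / p) = m0 powr (1 / p) / real k"
        using m0 p k by (simp add: powr_divide powr_powr)
      ultimately have "chain_const * (m0 powr (1 / p) / real k) \<le> chain_const * m (Suc n) (y i) powr (1 / p)"
        using chain_const_pos by (intro mult_left_mono) auto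
      then have "w \<le> L i b" using IH by (simp add: w_def)
      also have "L i b \<le> L b' b" using L_add[of b' i b] L_nonneg[of b' i] i by simp
      finally have "w \<le> L b' b" .
      moreover have "real j * w \<le> L l b'" using b' Suc.prems by (intro Suc.IH) auto
      ultimately have "real (Suc j) * w \<le> L l b' + L b' b" by (simp add: algebra_simps)
      then show ?case using L_add[of l b' b] b' by simp
    qed
    have "real k * w \<le> L l f'" using l zf by (intro step) (auto simp: T_def)
    also have "\<dots> \<le> L e f'" using L_add[of e l f'] L_nonneg[of e l] l by simp
    finally show ?thesis using k by (simp add: w_def)
  qed
  also have "\<dots> \<le> L e f" using L_add[OF f'(1) f'f] L_nonneg[of f' f] by simp
  finally show ?case by (simp add: L_def m0_def)
qed

end

subsection \<open>The chain metric\<close>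

context cut_tower
begin

section \<open>Roots of the masses and their change across levels\<close>

definition w :: "nat \<Rightarrow> 'a \<Rightarrow> real" where
  "w n x = m n x powr (1 / p)"

lemma w_pos: "x \<in> M \<Longrightarrow> w n x > 0"
  using m_pos[of x n] by (simp add: w_def)

text \<open>As \<open>K \<ge> 1\<close> and \<open>1 / p < 1\<close>, constants valid for
  \<open>m\<close> may be kept for its \<open>p\<close>-th root.\<close>

lemma root_mult_le:
  assumes "K \<ge> 1" "u \<ge> 0" "u \<le> K * v"
  shows "u powr (1 / p) \<le> K * v powr (1 / p)"
proof -
  have v: "v \<ge> 0" using assms by (smt (verit) mult_nonneg_nonneg zero_le_mult_iff)
  have "u powr (1 / p) \<le> (K * v) powr (1 / p)" using assms p by (intro powr_mono2) auto
  also have "\<dots> = K powr (1 / p) * v powr (1 / p)" using assms v by (simp add: powr_mult)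
  also have "\<dots> \<le> K powr 1 * v powr (1 / p)" using assms p by (intro mult_right_mono powr_mono) auto
  finally show ?thesis using assms by simp
qed

lemma w_growth:
  assumes "x \<in> M"
  shows "\<delta> ^ j * w n x \<le> w (n + j) x"
proof -
  have "m n x \<le> (1 / \<delta> ^ j) * m (n + j) x"
    using m_growth[OF assms, of j n] \<delta> by (simp add: field_simps)
  then have "w n x \<le> (1 / \<delta> ^ j) * w (n + j) x"
    unfolding w_def using \<delta> m_pos[OF assms, of n] by (intro root_mult_le) (auto simp: power_le_one)
  then show ?thesis using \<delta> by (simp add: field_simps)
qed

lemma w_decay:
  assumes "x \<in> M"
  shows "w (n + j) x \<le> exp 8 * (\<sigma> powr (1 / p)) ^ j * w n x"
proof -
  have "w (n + j) x \<le> exp 8 * (\<sigma> ^ j * m n x) powr (1 / p)"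
    unfolding w_def using m_decay[OF assms, of n j] m_pos[OF assms, of "n + j"]
    by (intro root_mult_le) auto
  also have "(\<sigma> ^ j * m n x) powr (1 / p) = (\<sigma> powr (1 / p)) ^ j * w n x"
    using \<sigma> m_pos[OF assms, of n] by (simp add: w_def powr_mult powr_powr mult.commute flip: powr_realpow)
  finally show ?thesis by simp
qed

lemma w_quasi_decreasing:
  assumes "x \<in> M" "n \<le> l"
  shows "w l x \<le> exp 8 * w n x"
  unfolding w_def using m_quasi_decreasing[OF assms] m_pos[OF assms(1), of l] by (intro root_mult_le) auto

text \<open>The exponents satisfy \<open>a powr \<alpha> = 1 / \<sigma> powr (1 / p)\<close> and
  \<open>a powr \<beta> = 1 / \<delta>\<close>, which turns the decay and growth of \<open>w\<close>
  per level into powers of the ratio of radii.\<close>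

definition \<alpha> where "\<alpha> = - ln (\<sigma> powr (1 / p)) / ln a"

definition \<beta> where "\<beta> = - ln \<delta> / ln a"

lemma ln_a: "ln a > 0"
  using a80 by simp

lemma \<alpha>_\<beta>_pos: "\<alpha> > 0" "\<beta> > 0"
proof -
  have "ln \<sigma> < 0" using \<sigma> by simp
  then have "1 / p * ln \<sigma> < 0" using p by (intro mult_pos_neg) auto
  then have "ln (\<sigma> powr (1 / p)) < 0" using \<sigma> by (simp add: ln_powr)
  moreover have "ln \<delta> < 0" using \<delta> by simp
  ultimately show "\<alpha> > 0" "\<beta> > 0" 
    unfolding \<alpha>_def \<beta>_def using ln_a by (simp_all only: divide_pos_pos neg_0_less_iff_less)
qed

text \<open>The \<open>\<beta>\<close> term serves when \<open>l\<close> is the finer level, the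
  \<open>\<alpha>\<close> term when \<open>n\<close> is. Their sum covers both cases by one
  increasing function of the ratio, the source of \<open>\<eta>\<close>.\<close>

lemma w_ratio:
  assumes "x \<in> M"
  shows "w n x \<le> exp 8 * ((R n / R l) powr \<alpha> + (R n / R l) powr \<beta>) * w l x"
proof (cases "l \<ge> n")
  case True
  have R: "R n / R l = a ^ (l - n)" using True D a80 by (simp add: R_def power_diff)
  have "(a ^ (l - n)) powr \<beta> = (a powr \<beta>) ^ (l - n)" using a80 by (simp add: powr_power powr_powr mult.commute flip: powr_realpow)
  also have "a powr \<beta> = 1 / \<delta>" using a80 ln_a \<delta> by (simp add: \<beta>_def powr_def exp_minus inverse_eq_divide)
  finally have "(R n / R l) powr \<beta> = 1 / \<delta> ^ (l - n)" by (simp add: R power_divide)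
  moreover have "w n x \<le> 1 / \<delta> ^ (l - n) * w l x"
    using w_growth[OF assms, of "l - n" n] True \<delta> by (simp add: field_simps)
  ultimately have "w n x \<le> 1 * (0 + (R n / R l) powr \<beta>) * w l x" by simp
  also have "\<dots> \<le> exp 8 * ((R n / R l) powr \<alpha> + (R n / R l) powr \<beta>) * w l x"
    using w_pos[OF assms, of l] by (intro mult_right_mono mult_mono add_mono) auto
  finally show ?thesis .
next
  case False
  have R: "R n / R l = 1 / a ^ (n - l)" using False D a80 by (simp add: R_def power_diff)
  have "(1 / a ^ (n - l)) powr \<alpha> = 1 / (a powr \<alpha>) ^ (n - l)"
    using a80 by (simp add: powr_divide powr_power powr_powr mult.commute flip: powr_realpow)
  also have "a powr \<alpha> = 1 / (\<sigma> powr (1 / p))"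
    using a80 ln_a \<sigma> by (simp add: \<alpha>_def powr_def exp_minus inverse_eq_divide)
  finally have "(R n / R l) powr \<alpha> = (\<sigma> powr (1 / p)) ^ (n - l)" by (simp add: R power_divide)
  moreover have "w n x \<le> exp 8 * (\<sigma> powr (1 / p)) ^ (n - l) * w l x"
    using w_decay[OF assms, of l "n - l"] False by simp
  ultimately have "w n x \<le> exp 8 * ((R n / R l) powr \<alpha> + 0) * w l x" by simp
  also have "\<dots> \<le> exp 8 * ((R n / R l) powr \<alpha> + (R n / R l) powr \<beta>) * w l x"
    using w_pos[OF assms, of l] by (intro mult_right_mono mult_left_mono add_mono) auto
  finally show ?thesis .
qed

section \<open>The infimum over chains and its comparison with the weights\<close>

definition chain_sums :: "'a \<Rightarrow> 'a \<Rightarrow> real set" where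
  "chain_sums x z = {\<Sum>l<n. q (y l) (y (Suc l)) | y n. range y \<subseteq> M \<and> y 0 = x \<and> y n = z}"

text \<open>The value 0 outside \<open>M\<close> keeps \<open>\<theta>\<close> nonnegative and
  symmetric for all arguments, as \<open>Metric_space\<close> demands.\<close>

definition \<theta> :: "'a \<Rightarrow> 'a \<Rightarrow> real" where
  "\<theta> x z = (if x \<in> M \<and> z \<in> M then Inf (chain_sums x z) else 0)"

lemma chain_sums_nonneg: "s \<in> chain_sums x z \<Longrightarrow> 0 \<le> s"
  by (auto simp: chain_sums_def intro!: sum_nonneg q_nonneg)

lemma chain_sums_bdd: "bdd_below (chain_sums x z)"
  using chain_sums_nonneg by (rule bdd_belowI)

lemma q_in_chain_sums: "x \<in> M \<Longrightarrow> z \<in> M \<Longrightarrow> q x z \<in> chain_sums x z"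
  unfolding chain_sums_def
  by (intro CollectI exI[of _ "\<lambda>l. if l = 0 then x else z"] exI[of _ "1::nat"]) auto

lemma \<theta>_greatest:
  assumes "x \<in> M" "z \<in> M" "\<And>s. s \<in> chain_sums x z \<Longrightarrow> c \<le> s"
  shows "c \<le> \<theta> x z"
  using assms q_in_chain_sums[OF assms(1,2)] by (auto simp: \<theta>_def intro!: cInf_greatest)

lemma \<theta>_le: "x \<in> M \<Longrightarrow> z \<in> M \<Longrightarrow> s \<in> chain_sums x z \<Longrightarrow> \<theta> x z \<le> s"
  by (auto simp: \<theta>_def intro!: cInf_lower chain_sums_bdd)

lemma chain_sums_commute: "s \<in> chain_sums x z \<Longrightarrow> s \<in> chain_sums z x"
proof -
  assume "s \<in> chain_sums x z"
  then obtain y n where y: "range y \<subseteq> M" "y 0 = x" "y n = z" "s = (\<Sum>l<n. q (y l) (y (Suc l)))"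
    by (auto simp: chain_sums_def)
  have "s = (\<Sum>l<n. q (y (n - Suc l)) (y (Suc (n - Suc l))))"
    unfolding y(4) by (rule sum.nat_diff_reindex[symmetric])
  also have "\<dots> = (\<Sum>l<n. q (y (n - l)) (y (n - Suc l)))"
    by (intro sum.cong) (auto simp: q_commute Suc_diff_Suc)
  finally show ?thesis unfolding chain_sums_def
    using y by (intro CollectI exI[of _ "\<lambda>l. y (n - l)"] exI[of _ n]) auto
qed

lemma chain_sums_add:
  assumes "s \<in> chain_sums x u" "s' \<in> chain_sums u z"
  shows "s + s' \<in> chain_sums x z"
proof -
  obtain y n where y: "range y \<subseteq> M" "y 0 = x" "y n = u" "s = (\<Sum>l<n. q (y l) (y (Suc l)))"
    using assms(1) by (auto simp: chain_sums_def)
  obtain y' n' where y': "range y' \<subseteq> M" "y' 0 = u" "y' n' = z" "s' = (\<Sum>l<n'. q (y' l) (y' (Suc l)))"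
    using assms(2) by (auto simp: chain_sums_def)
  define Y where "Y l = (if l \<le> n then y l else y' (l - n))" for l
  have "(\<Sum>l<n + n'. q (Y l) (Y (Suc l))) = (\<Sum>l<n. q (Y l) (Y (Suc l))) + (\<Sum>l\<in>{n..<n + n'}. q (Y l) (Y (Suc l)))"
    by (simp add: sum.atLeastLessThan_concat flip: atLeast0LessThan)
  also have "(\<Sum>l<n. q (Y l) (Y (Suc l))) = s" unfolding y(4) by (intro sum.cong) (auto simp: Y_def)
  also have "(\<Sum>l\<in>{n..<n + n'}. q (Y l) (Y (Suc l))) = (\<Sum>l<n'. q (Y (l + n)) (Y (Suc (l + n))))"
    using sum.shift_bounds_nat_ivl[of "\<lambda>l. q (Y l) (Y (Suc l))" 0 n n'] by (simp add: atLeast0LessThan add.commute)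
  also have "\<dots> = s'" unfolding y'(4)
    by (intro sum.cong) (auto simp: Y_def y(3) y'(2))
  finally have "s + s' = (\<Sum>l<n + n'. q (Y l) (Y (Suc l)))" by simp
  moreover have "range Y \<subseteq> M" using y(1) y'(1) by (auto simp: Y_def)
  moreover have "Y 0 = x" "Y (n + n') = z" using y y' by (auto simp: Y_def)
  ultimately show ?thesis unfolding chain_sums_def by blast
qed

lemma \<theta>_lower:
  assumes "x \<in> M" "z \<in> M" "10 * R n \<le> d x z"
  shows "chain_const * w n x \<le> \<theta> x z"
proof (rule \<theta>_greatest[OF assms(1,2)])
  fix s assume "s \<in> chain_sums x z"
  then obtain y l where y: "range y \<subseteq> M" "y 0 = x" "y l = z" "s = (\<Sum>l<l. q (y l) (y (Suc l)))"
    by (auto simp: chain_sums_def)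
  show "chain_const * w n x \<le> s"
    using chain_inequality[of y 0 l n] y assms by (auto simp: w_def atLeast0LessThan)
qed

text \<open>A distance at level \<open>n\<close> exceeds \<open>R (n + 1)\<close>, hence
  \<open>10 * R (n + 2)\<close>; descending these two levels costs
  \<open>\<delta>\<^sup>2\<close>.\<close>

definition c\<^sub>1 where "c\<^sub>1 = chain_const * \<delta>\<^sup>2"

lemma c1_pos: "c\<^sub>1 > 0" using chain_const_pos \<delta> by (simp add: c\<^sub>1_def)

lemma \<theta>_lower_lev:
  assumes "x \<in> M" "z \<in> M" "x \<noteq> z"
  shows "c\<^sub>1 * w (lev (d x z)) x \<le> \<theta> x z"
proof -
  define n where "n = lev (d x z)"
  have "d x z > 0" using assms by simp
  then have "R (Suc n) < d x z" using lev(1) by (simp add: n_def)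
  then have "10 * R (Suc (Suc n)) \<le> d x z" using R_Suc_le[of "Suc n"] R_pos[of "Suc (Suc n)"] by simp
  then have "chain_const * w (n + 2) x \<le> \<theta> x z" using \<theta>_lower[OF assms(1,2), of "n + 2"] by simp
  moreover have "chain_const * (\<delta>\<^sup>2 * w n x) \<le> chain_const * w (n + 2) x"
    using w_growth[OF assms(1), of 2 n] chain_const_pos by (intro mult_left_mono) auto
  ultimately show ?thesis by (simp add: c\<^sub>1_def n_def)
qed

definition c\<^sub>2 :: real where "c\<^sub>2 = 1 + exp 2"

lemma c2_pos: "c\<^sub>2 > 0" by (simp add: c\<^sub>2_def add_pos_pos)

text \<open>The chain with one step is enough: its ends are within \<open>R n\<close> of each other,
  so their weights differ by a factor of at most \<open>exp 2\<close>.\<close>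

lemma \<theta>_upper_lev:
  assumes "x \<in> M" "z \<in> M" "x \<noteq> z"
  shows "\<theta> x z \<le> c\<^sub>2 * w (lev (d x z)) x"
proof -
  define n where "n = lev (d x z)"
  have "d x z \<le> R n" using lev(2)[of "d x z"] D(2)[OF assms(1,2)] assms by (simp add: n_def less_imp_le)
  then have "m n z \<le> exp (2 * 1) * m n x" using assms by (intro m_lip) (auto simp: commute)
  then have "w n z \<le> exp 2 * w n x" unfolding w_def
    using m_pos[OF assms(2), of n] by (intro root_mult_le) auto
  moreover have "\<theta> x z \<le> q x z" using assms by (intro \<theta>_le q_in_chain_sums)
  moreover have "q x z = w n x + w n z" by (simp add: q_def w_def n_def)
  ultimately show ?thesis by (simp add: c\<^sub>2_def n_def algebra_simps)
qed

lemma \<theta>_self: "x \<in> M \<Longrightarrow> \<theta> x x = 0"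
proof (rule antisym)
  assume x: "x \<in> M"
  have "0 \<in> chain_sums x x" unfolding chain_sums_def
    using x by (intro CollectI exI[of _ "\<lambda>_. x"] exI[of _ 0]) auto
  then show "\<theta> x x \<le> 0" by (rule \<theta>_le[OF x x])
  show "0 \<le> \<theta> x x" using x chain_sums_nonneg by (intro \<theta>_greatest)
qed

lemma \<theta>_metric: "Metric_space M \<theta>"
proof
  fix x y :: 'a
  show "0 \<le> \<theta> x y"
    using \<theta>_greatest[of x y 0] chain_sums_nonneg by (cases "x \<in> M \<and> y \<in> M") (auto simp: \<theta>_def)
  have "chain_sums x y = chain_sums y x" using chain_sums_commute by blast
  then show "\<theta> x y = \<theta> y x" by (simp add: \<theta>_def conj_commute)
next
  fix x y assume xy: "x \<in> M" "y \<in> M"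
  have "\<theta> x y > 0" if "x \<noteq> y"
    using \<theta>_lower_lev[OF xy that] c1_pos w_pos[OF xy(1)] by (smt (verit) mult_pos_pos)
  then show "\<theta> x y = 0 \<longleftrightarrow> x = y" using \<theta>_self xy by force
next
  fix x y z assume xyz: "x \<in> M" "y \<in> M" "z \<in> M"
  have "\<theta> x z - s' \<le> \<theta> x y" if s': "s' \<in> chain_sums y z" for s'
  proof (rule \<theta>_greatest[OF xyz(1,2)])
    fix s assume "s \<in> chain_sums x y"
    then have "\<theta> x z \<le> s + s'" using s' xyz by (intro \<theta>_le chain_sums_add)
    then show "\<theta> x z - s' \<le> s" by simp
  qed
  then have "\<theta> x z - \<theta> x y \<le> \<theta> y z" by (intro \<theta>_greatest[OF xyz(2,3)]) (auto simp: algebra_simps)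
  then show "\<theta> x z \<le> \<theta> x y + \<theta> y z" by simp
qed

text \<open>The argument is scaled by \<open>a\<close> because a level determines a distance only up
  to this factor.\<close>

definition \<eta> :: "real \<Rightarrow> real" where
  "\<eta> t = c\<^sub>2 * exp 8 / c\<^sub>1 * (((a * t) powr \<alpha>) + ((a * t) powr \<beta>))"

lemma \<eta>_strict_mono: "strict_mono_on {0..} \<eta>"
proof (rule strict_mono_onI)
  fix r s :: real assume "r \<in> {0..}" "r < s"
  then have "a * r < a * s" "a * r \<ge> 0" using a80 by auto
  then have "(a * r) powr \<alpha> + (a * r) powr \<beta> < (a * s) powr \<alpha> + (a * s) powr \<beta>"
    using \<alpha>_\<beta>_pos by (intro add_strict_mono powr_less_mono2) auto
  then show "\<eta> r < \<eta> s" unfolding \<eta>_def using c1_pos c2_pos by (intro mult_strict_left_mono) auto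
qed

lemma \<eta>_continuous: "continuous_on {0..} \<eta>"
  unfolding \<eta>_def using \<alpha>_\<beta>_pos a80
  by (intro continuous_on_mult continuous_on_add continuous_on_const continuous_on_powr' continuous_on_id) auto

lemma \<eta>_homeomorphism: "\<exists>\<eta>'. homeomorphism {0..} {0..} \<eta> \<eta>'"
proof (rule homeomorphism_into_1d)
  show "path_connected {0::real..}" by (intro convex_imp_path_connected) auto
  show "inj_on \<eta> {0..}" using \<eta>_strict_mono by (rule strict_mono_on_imp_inj_on)
  show "continuous_on {0..} \<eta>" by (rule \<eta>_continuous)
  define B where "B = c\<^sub>2 * exp 8 / c\<^sub>1"
  have B: "B > 0" using c1_pos c2_pos by (simp add: B_def)
  have nonneg: "\<eta> t \<ge> 0" for t unfolding \<eta>_def using c1_pos c2_pos by (intro mult_nonneg_nonneg add_nonneg_nonneg) auto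
  have "\<exists>t\<ge>0. \<eta> t = u" if u: "u \<ge> 0" for u
  proof -
    define t where "t = (u / B) powr (1 / \<alpha>)"
    have t: "t \<ge> 0" by (simp add: t_def)
    have "u / B = t powr \<alpha>" using u B \<alpha>_\<beta>_pos by (simp add: t_def powr_powr)
    also have "\<dots> \<le> (a * t) powr \<alpha>"
      using t a80 \<alpha>_\<beta>_pos mult_right_mono[of 1 a t] by (intro powr_mono2) auto
    also have "\<dots> \<le> (a * t) powr \<alpha> + (a * t) powr \<beta>" by simp
    finally have "u \<le> \<eta> t" using B by (simp add: \<eta>_def B_def[symmetric] field_simps)
    moreover have "\<eta> 0 \<le> u" using u by (simp add: \<eta>_def)
    moreover have "continuous_on {0..t} \<eta>" by (rule continuous_on_subset[OF \<eta>_continuous]) auto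
    ultimately obtain s where "0 \<le> s" "s \<le> t" "\<eta> s = u" using IVT'[of \<eta> 0 u t] t by auto
    then show ?thesis by blast
  qed
  then show "\<eta> ` {0..} = {0..}" using nonneg by (auto simp: image_def)
qed

text \<open>Both distances are compared with weights at their common end \<open>z\<close>, so only
  the ratio of \<open>w\<close> at two levels of one point enters.\<close>

lemma \<theta>_quasisymmetric: "quasisymmetric M \<theta> d"
proof -
  interpret T: Metric_space M \<theta> by (rule \<theta>_metric)
  have "\<theta> x z / \<theta> y z \<le> \<eta> (d x z / d y z)"
    if M: "x \<in> M" "y \<in> M" "z \<in> M" and ne: "x \<noteq> y" "x \<noteq> z" "y \<noteq> z" for x y z
  proof -
    define n where "n = lev (d z x)"
    define l where "l = lev (d z y)"
    have dpos: "d z x > 0" "d z y > 0" using M ne by auto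
    have "R (Suc n) < d z x" "d z y \<le> R l"
      using lev[OF dpos(1)] lev[OF dpos(2)] D(2)[OF M(3,2)] by (auto simp: n_def l_def)
    then have "R n \<le> a * d z x" "d z y \<le> R l" using a80 by (auto simp: R_Suc field_simps)
    then have "R n / R l \<le> (a * d z x) / d z y"
      using R_pos[of n] R_pos[of l] dpos a80 by (intro frac_le) auto
    then have r: "R n / R l \<le> a * (d x z / d y z)" by (simp add: commute)
    have r0: "R n / R l > 0" using R_pos by simp
    have "\<theta> z x \<le> c\<^sub>2 * w n z" unfolding n_def using M ne by (intro \<theta>_upper_lev) auto
    also have "\<dots> \<le> c\<^sub>2 * (exp 8 * ((R n / R l) powr \<alpha> + (R n / R l) powr \<beta>) * w l z)"
      using w_ratio[OF M(3), of n l] c2_pos by (intro mult_left_mono) auto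
    also have "\<dots> \<le> c\<^sub>2 * (exp 8 * ((a * (d x z / d y z)) powr \<alpha> + (a * (d x z / d y z)) powr \<beta>) * w l z)"
      using r r0 c2_pos \<alpha>_\<beta>_pos w_pos[OF M(3), of l]
      by (intro mult_left_mono mult_right_mono add_mono powr_mono2) auto
    also have "\<dots> = \<eta> (d x z / d y z) * (c\<^sub>1 * w l z)" using c1_pos by (simp add: \<eta>_def)
    also have "\<dots> \<le> \<eta> (d x z / d y z) * \<theta> z y"
    proof (rule mult_left_mono)
      show "c\<^sub>1 * w l z \<le> \<theta> z y" unfolding l_def using M ne by (intro \<theta>_lower_lev) auto
      show "0 \<le> \<eta> (d x z / d y z)" unfolding \<eta>_def using c1_pos c2_pos
        by (intro mult_nonneg_nonneg add_nonneg_nonneg) auto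
    qed
    finally have "\<theta> z x \<le> \<eta> (d x z / d y z) * \<theta> z y" .
    moreover have "\<theta> z y > 0" using M ne by simp
    ultimately have "\<theta> z x / \<theta> z y \<le> \<eta> (d x z / d y z)" by (simp add: pos_divide_le_eq)
    then show ?thesis by (simp add: T.commute)
  qed
  then show ?thesis
    unfolding quasisymmetric_def using \<theta>_metric \<eta>_strict_mono \<eta>_homeomorphism by blast
qed

end

subsection \<open>The measure\<close>

text \<open>This splits the interval of a net point among its children. Half-open intervals make the
  pieces disjoint and the cover exact.\<close>

lemma interval_partition:
  fixes len :: "'b \<Rightarrow> real" and x :: real
  assumes "finite A" "\<And>c. c \<in> A \<Longrightarrow> 0 \<le> len c"
  shows "\<exists>L. (\<forall>c\<in>A. \<forall>c'\<in>A. c \<noteq> c' \<longrightarrow> {L c..<L c + len c} \<inter> {L c'..<L c' + len c'} = {}) \<and>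
     (\<Union>c\<in>A. {L c..<L c + len c}) = {x..<x + sum len A}"
  using assms
proof (induction A rule: finite_induct)
  case empty
  show ?case by simp
next
  case (insert c A)
  obtain L where L: "\<forall>c\<in>A. \<forall>c'\<in>A. c \<noteq> c' \<longrightarrow> {L c..<L c + len c} \<inter> {L c'..<L c' + len c'} = {}"
    "(\<Union>c\<in>A. {L c..<L c + len c}) = {x..<x + sum len A}" using insert by auto
  define L' where "L' = L(c := x + sum len A)"
  have L'A: "L' b = L b" if "b \<in> A" for b using that insert(2) by (auto simp: L'_def)
  have new: "{L' c..<L' c + len c} = {x + sum len A..<x + sum len (insert c A)}"
    using insert by (simp add: L'_def algebra_simps)
  have old: "{L' b..<L' b + len b} \<subseteq> {x..<x + sum len A}" if "b \<in> A" for b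
  proof -
    have "{L b..<L b + len b} \<subseteq> {x..<x + sum len A}" using that unfolding L(2)[symmetric] by blast
    then show ?thesis using L'A[OF that] by simp
  qed
  have sep: "{L' c..<L' c + len c} \<inter> {L' b..<L' b + len b} = {}" if "b \<in> A" for b
    using old[OF that] new by fastforce
  have "{L' b..<L' b + len b} \<inter> {L' b'..<L' b' + len b'} = {}"
    if "b \<in> insert c A" "b' \<in> insert c A" "b \<noteq> b'" for b b'
  proof (cases "b = c \<or> b' = c")
    case True
    then show ?thesis using sep that by (metis inf_commute insertE)
  next
    case False
    then show ?thesis using that L(1) L'A by simp
  qed
  moreover have "(\<Union>b\<in>insert c A. {L' b..<L' b + len b}) = {x..<x + sum len (insert c A)}"
  proof -
    have "(\<Union>b\<in>A. {L' b..<L' b + len b}) = {x..<x + sum len A}" using L(2) L'A by simp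
    moreover have "0 \<le> sum len A" "sum len A \<le> sum len (insert c A)"
      using insert by (auto intro!: sum_nonneg)
    ultimately show ?thesis using new by auto
  qed
  ultimately show ?case by blast
qed

section \<open>Finite Borel measures on a compact metric space are Radon\<close>

context Metric_space
begin

text \<open>\<open>F n\<close> consists of the points at distance at least
  \<open>1 / (n + 1)\<close> from the complement of \<open>U\<close>.\<close>

lemma open_exhaustion:
  assumes U: "openin mtopology U"
  shows "\<exists>F :: nat \<Rightarrow> 'a set. (\<forall>n. closedin mtopology (F n)) \<and> incseq F \<and> (\<Union>n. F n) = U"
proof -
  have UM: "U \<subseteq> M" using openin_subset[OF U] by simp
  define F where "F n = M - (\<Union>y\<in>M - U. mball y (inverse (real (Suc n))))" for n
  have "closedin mtopology (F n)" for n
  proof -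
    have "openin mtopology (\<Union>y\<in>M - U. mball y (inverse (real (Suc n))))" by auto
    then show ?thesis unfolding F_def by (metis closedin_def openin_closedin_eq topspace_mtopology closedin_diff closedin_topspace)
  qed
  moreover have "incseq F"
  proof (rule incseq_SucI)
    fix n
    have "inverse (real (Suc (Suc n))) \<le> inverse (real (Suc n))" by (intro le_imp_inverse_le) auto
    then have "mball y (inverse (real (Suc (Suc n)))) \<subseteq> mball y (inverse (real (Suc n)))" for y
      by (rule mball_subset_concentric)
    then show "F n \<subseteq> F (Suc n)" unfolding F_def by blast
  qed
  moreover have "(\<Union>n. F n) = U"
  proof
    have "x \<in> U" if "x \<in> F n" for x n
    proof (rule ccontr)
      assume "x \<notin> U"
      moreover have "x \<in> mball x (inverse (real (Suc n)))" using that by (simp add: F_def)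
      ultimately show False using that by (auto simp: F_def)
    qed
    then show "(\<Union>n. F n) \<subseteq> U" by blast
    show "U \<subseteq> (\<Union>n. F n)"
    proof
      fix x assume x: "x \<in> U"
      then obtain e where e: "e > 0" "mball x e \<subseteq> U" using U by (auto simp: openin_mtopology)
      obtain n where n: "inverse (real (Suc n)) < e" using reals_Archimedean[OF e(1)] by blast
      have "x \<notin> mball y (inverse (real (Suc n)))" if y: "y \<in> M - U" for y
      proof
        assume "x \<in> mball y (inverse (real (Suc n)))"
        then have "y \<in> mball x e" using n by (auto simp: commute)
        then show False using e(2) y by auto
      qed
      then have "x \<in> F n" using x UM by (auto simp: F_def)
      then show "x \<in> (\<Union>n. F n)" by blast
    qed
  qed
  ultimately show ?thesis by blast
qed

text \<open>The sets with this property contain the open sets and are closed under complements,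
  which swap the two approximations, and under countable unions.\<close>

lemma borel_approximation:
  fixes \<mu> :: "'a measure"
  assumes fin: "finite_measure \<mu>" and sp: "space \<mu> = M" and st: "sets \<mu> = sigma_sets M {U. openin mtopology U}"
    and A: "A \<in> sets \<mu>"
  shows "\<forall>e>0. \<exists>F U. closedin mtopology F \<and> openin mtopology U \<and> F \<subseteq> A \<and> A \<subseteq> U \<and> measure \<mu> (U - F) < e"
proof -
  interpret finite_measure \<mu> by (rule fin)
  have op: "U \<in> sets \<mu>" if "openin mtopology U" for U using that st by (auto intro: sigma_sets.Basic)
  have cl: "F \<in> sets \<mu>" if "closedin mtopology F" for F
  proof -
    have "openin mtopology (M - F)" using that by (simp add: closedin_def)
    moreover have "F = space \<mu> - (M - F)" using closedin_subset[OF that] sp by auto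
    ultimately show ?thesis using op sets.compl_sets by metis
  qed
  show ?thesis
    using A unfolding st
  proof (induction A rule: sigma_sets.induct)
    case (Basic U)
    then have U: "openin mtopology U" by simp
    obtain F :: "nat \<Rightarrow> 'a set" where F: "\<And>n. closedin mtopology (F n)" "incseq F" "(\<Union>n. F n) = U"
      using open_exhaustion[OF U] by blast
    have lim: "(\<lambda>n. measure \<mu> (F n)) \<longlonglongrightarrow> measure \<mu> U"
      using finite_Lim_measure_incseq[of F] F cl by auto
    show ?case
    proof (intro allI impI)
      fix e :: real assume "e > 0"
      then have "eventually (\<lambda>n. measure \<mu> U - e < measure \<mu> (F n)) sequentially"
        by (intro order_tendstoD(1)[OF lim]) auto
      then obtain n where n: "measure \<mu> U - e < measure \<mu> (F n)" by (auto simp: eventually_sequentially)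
      have "F n \<subseteq> U" using F(3) by blast
      then have "measure \<mu> (U - F n) < e" using n finite_measure_Diff[of U "F n"] op[OF U] cl[OF F(1)] by simp
      then show "\<exists>F U'. closedin mtopology F \<and> openin mtopology U' \<and> F \<subseteq> U \<and> U \<subseteq> U' \<and> measure \<mu> (U' - F) < e"
        using F(1) U \<open>F n \<subseteq> U\<close> by blast
    qed
  next
    case Empty
    show ?case by (intro allI impI exI[of _ "{}"]) auto
  next
    case (Compl A)
    show ?case
    proof (intro allI impI)
      fix e :: real assume e: "e > 0"
      from Compl.IH[rule_format, OF e]
      obtain F U where FU: "closedin mtopology F" "openin mtopology U" "F \<subseteq> A" "A \<subseteq> U" "measure \<mu> (U - F) < e"
        by (elim exE conjE)
      have "U \<subseteq> M" using openin_subset[OF FU(2)] by simp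
      then have "(M - F) - (M - U) = U - F" by blast
      moreover have "openin mtopology (M - F)" using FU(1) by (simp add: closedin_def)
      moreover have "closedin mtopology (M - U)"
        using closedin_diff[OF closedin_topspace[of mtopology] FU(2)] by simp
      ultimately show "\<exists>F U. closedin mtopology F \<and> openin mtopology U \<and> F \<subseteq> M - A \<and> M - A \<subseteq> U \<and> measure \<mu> (U - F) < e"
        using FU by (metis Diff_mono order_refl)
    qed
  next
    case (Union A)
    show ?case
    proof (intro allI impI)
      fix e :: real assume e: "e > 0"
      have "\<exists>F U. closedin mtopology F \<and> openin mtopology U \<and> F \<subseteq> A i \<and> A i \<subseteq> U \<and>
          measure \<mu> (U - F) < e / 4 * (1 / 2) ^ i" for i
        using e by (intro Union.IH[rule_format]) simp
      then obtain F U where FU: "\<And>i. closedin mtopology (F i)" "\<And>i. openin mtopology (U i)" "\<And>i. F i \<subseteq> A i"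
        "\<And>i. A i \<subseteq> U i" "\<And>i. measure \<mu> (U i - F i) < e / 4 * (1 / 2) ^ i" by metis
      have UF: "range (\<lambda>i. U i - F i) \<subseteq> sets \<mu>" "range F \<subseteq> sets \<mu>" "range U \<subseteq> sets \<mu>"
        using op[OF FU(2)] cl[OF FU(1)] by auto
      have "(\<lambda>i. e / 4 * (1 / 2) ^ i) sums (e / 4 * (1 / (1 - 1 / 2)))"
        by (intro sums_mult geometric_sums) auto
      then have geo: "summable (\<lambda>i. e / 4 * (1 / 2) ^ i)" "(\<Sum>i. e / 4 * (1 / 2) ^ i) = e / 2"
        by (auto simp: sums_iff)
      have sm: "summable (\<lambda>i. measure \<mu> (U i - F i))"
        by (rule summable_comparison_test'[OF geo(1), of 0]) (use FU(5) in \<open>auto intro: less_imp_le\<close>)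
      have "measure \<mu> (\<Union>i. U i - F i) \<le> (\<Sum>i. measure \<mu> (U i - F i))"
        by (rule finite_measure_subadditive_countably[OF UF(1) sm])
      also have "\<dots> \<le> e / 2" using suminf_le[OF less_imp_le[OF FU(5)] sm geo(1)] geo(2) by simp
      finally have 1: "measure \<mu> (\<Union>i. U i - F i) \<le> e / 2" .
      \<comment> \<open>A countable union of closed sets need not be closed, so a finite part of it
        is taken. One half of \<open>e\<close> pays for the sets \<open>U i - F i\<close>, the other
        for the tail.\<close>
      define G where "G n = (\<Union>i\<le>n. F i)" for n
      have G: "closedin mtopology (G n)" for n unfolding G_def using FU(1) by (intro closedin_Union) auto
      have UG: "(\<Union>n. G n) = (\<Union>i. F i)" by (auto simp: G_def)
      have "(\<lambda>n. measure \<mu> (G n)) \<longlonglongrightarrow> measure \<mu> (\<Union>n. G n)"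
        using cl[OF G] by (intro finite_Lim_measure_incseq) (auto simp: G_def incseq_def, fastforce)
      then have "eventually (\<lambda>n. measure \<mu> (\<Union>n. G n) - e / 2 < measure \<mu> (G n)) sequentially"
        using e by (intro order_tendstoD(1)) auto
      then obtain n where n: "measure \<mu> (\<Union>i. F i) - e / 2 < measure \<mu> (G n)"
        unfolding UG by (auto simp: eventually_sequentially)
      have sF: "(\<Union>i. F i) \<in> sets \<mu>" using UF(2) by (intro sets.countable_UN) auto
      have "G n \<subseteq> (\<Union>i. F i)" using UG by blast
      then have 2: "measure \<mu> ((\<Union>i. F i) - G n) < e / 2"
        using n finite_measure_Diff[OF sF cl[OF G]] by simp
      have s1: "(\<Union>i. U i - F i) \<in> sets \<mu>" using UF(1) by (intro sets.countable_UN) auto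
      have s2: "(\<Union>i. F i) - G n \<in> sets \<mu>" using sF cl[OF G] by auto
      have "measure \<mu> ((\<Union>i. U i) - G n) \<le> measure \<mu> ((\<Union>i. U i - F i) \<union> ((\<Union>i. F i) - G n))"
        using s1 s2 by (intro finite_measure_mono) auto
      also have "\<dots> \<le> measure \<mu> (\<Union>i. U i - F i) + measure \<mu> ((\<Union>i. F i) - G n)"
        by (rule measure_Un_le[OF s1 s2])
      also have "\<dots> < e" using 1 2 by simp
      finally have "measure \<mu> ((\<Union>i. U i) - G n) < e" .
      moreover have "openin mtopology (\<Union>i. U i)" using FU(2) by auto
      moreover have "G n \<subseteq> (\<Union>i. A i)" "(\<Union>i. A i) \<subseteq> (\<Union>i. U i)"
        using FU(3) unfolding G_def by (blast, intro UN_mono FU(4) order_refl)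
      ultimately show "\<exists>F U. closedin mtopology F \<and> openin mtopology U \<and> F \<subseteq> \<Union> (range A) \<and> \<Union> (range A) \<subseteq> U \<and> measure \<mu> (U - F) < e"
        using G[of n] by - (rule exI[of _ "G n"], rule exI[of _ "\<Union> (range U)"], intro conjI)
    qed
  qed
qed

text \<open>Outer regularity comes from \<open>borel_approximation\<close>; inner regularity on open
  sets from their exhaustion, as closed sets are compact here.\<close>

lemma radon_measureI:
  fixes \<mu> :: "'a measure"
  assumes "compact_space mtopology"
    and fin: "finite_measure \<mu>" and sp: "space \<mu> = M" and st: "sets \<mu> = sigma_sets M {U. openin mtopology U}"
  shows "radon_measure \<mu>"
  unfolding radon_measure_def
proof (intro conjI allI impI ballI)
  interpret finite_measure \<mu> by (rule fin)
  have op: "U \<in> sets \<mu>" if "openin mtopology U" for U using that st by (auto intro: sigma_sets.Basic)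
  show "space \<mu> = M" "sets \<mu> = sigma_sets M {U. openin mtopology U}" by (fact sp, fact st)
  show "emeasure \<mu> K < \<infinity>" for K by (simp add: emeasure_eq_measure)
  show "emeasure \<mu> A = (INF U\<in>{U. openin mtopology U \<and> A \<subseteq> U}. emeasure \<mu> U)" if A: "A \<in> sets \<mu>" for A
  proof (rule antisym)
    show "emeasure \<mu> A \<le> (INF U\<in>{U. openin mtopology U \<and> A \<subseteq> U}. emeasure \<mu> U)"
      using op by (intro INF_greatest emeasure_mono) auto
    show "(INF U\<in>{U. openin mtopology U \<and> A \<subseteq> U}. emeasure \<mu> U) \<le> emeasure \<mu> A"
    proof (rule ennreal_le_epsilon)
      fix e :: real assume e: "e > 0"
      from borel_approximation[OF fin sp st A, rule_format, OF e]
      obtain F U where FU: "closedin mtopology F" "openin mtopology U" "F \<subseteq> A" "A \<subseteq> U" "measure \<mu> (U - F) < e"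
        by (elim exE conjE)
      have F: "F \<in> sets \<mu>"
      proof -
        have "openin mtopology (M - F)" using FU(1) by (simp add: closedin_def)
        moreover have "F = space \<mu> - (M - F)" using closedin_subset[OF FU(1)] sp by auto
        ultimately show ?thesis using op sets.compl_sets by metis
      qed
      have "(INF U\<in>{U. openin mtopology U \<and> A \<subseteq> U}. emeasure \<mu> U) \<le> emeasure \<mu> U"
        using FU by (intro INF_lower) auto
      also have "\<dots> = ennreal (measure \<mu> U)" by (simp add: emeasure_eq_measure)
      also have "measure \<mu> U \<le> measure \<mu> A + e"
      proof -
        have "measure \<mu> (U - F) = measure \<mu> U - measure \<mu> F" using FU F op by (intro finite_measure_Diff) auto
        moreover have "measure \<mu> F \<le> measure \<mu> A" using FU A by (intro finite_measure_mono) auto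
        ultimately show ?thesis using FU(5) by simp
      qed
      then have "ennreal (measure \<mu> U) \<le> ennreal (measure \<mu> A + e)" by (rule ennreal_leI)
      also have "\<dots> = emeasure \<mu> A + ennreal e" using e by (simp add: emeasure_eq_measure ennreal_plus)
      finally show "(INF U\<in>{U. openin mtopology U \<and> A \<subseteq> U}. emeasure \<mu> U) \<le> emeasure \<mu> A + ennreal e" .
    qed
  qed
  show "emeasure \<mu> U = (SUP K\<in>{K. compactin mtopology K \<and> K \<subseteq> U}. emeasure \<mu> K)" if U: "openin mtopology U" for U
  proof (rule antisym)
    show "(SUP K\<in>{K. compactin mtopology K \<and> K \<subseteq> U}. emeasure \<mu> K) \<le> emeasure \<mu> U"
      using op[OF U] by (intro SUP_least emeasure_mono) auto
    obtain F :: "nat \<Rightarrow> 'a set" where F: "\<And>n. closedin mtopology (F n)" "incseq F" "(\<Union>n. F n) = U"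
      using open_exhaustion[OF U] by blast
    have "F n \<in> sets \<mu>" for n
    proof -
      have "openin mtopology (M - F n)" using F(1)[of n] by (simp add: closedin_def)
      moreover have "F n = space \<mu> - (M - F n)" using closedin_subset[OF F(1)[of n]] sp by auto
      ultimately show ?thesis using op sets.compl_sets by metis
    qed
    then have "range F \<subseteq> sets \<mu>" by auto
    then have "emeasure \<mu> U = (SUP n. emeasure \<mu> (F n))"
      unfolding F(3)[symmetric] using F(2) by (rule SUP_emeasure_incseq[symmetric])
    also have "\<dots> \<le> (SUP K\<in>{K. compactin mtopology K \<and> K \<subseteq> U}. emeasure \<mu> K)"
    proof (rule SUP_least)
      fix n
      have "compactin mtopology (F n)" using closedin_compact_space[OF assms(1) F(1)] .
      moreover have "F n \<subseteq> U" using F(3) by blast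
      ultimately show "emeasure \<mu> (F n) \<le> (SUP K\<in>{K. compactin mtopology K \<and> K \<subseteq> U}. emeasure \<mu> K)"
        by (intro SUP_upper) auto
    qed
    finally show "emeasure \<mu> U \<le> (SUP K\<in>{K. compactin mtopology K \<and> K \<subseteq> U}. emeasure \<mu> K)" .
  qed
qed

end

section \<open>The limit of the masses\<close>

context cut_tower
begin

text \<open>\<open>R 0 = D\<close> exceeds every distance, so a separated set at this scale has at
  most one point.\<close>

lemma root: "\<exists>v\<in>M. S 0 = {v}"
proof -
  obtain x where x: "x \<in> M" using nonempty by blast
  obtain v where v: "v \<in> S 0" using S(2)[OF x] by blast
  have "u = v" if u: "u \<in> S 0" for u
  proof (rule ccontr)
    assume "u \<noteq> v"
    then have "R 0 \<le> d u v" using S(1)[of 0] u v by (auto simp: separated_def)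
    then show False using D(2)[of u v] S_sub u v by (auto simp: R_def)
  qed
  then show ?thesis using v S_sub by blast
qed

text \<open>Lebesgue measure on \<open>[0, 1)\<close> is pushed forward to \<open>M\<close> along these nested intervals.\<close>

lemma ex_interval_tower:
  "\<exists>L. \<forall>n. ((\<forall>v\<in>S n. \<forall>v'\<in>S n. v \<noteq> v' \<longrightarrow> {L n v..<L n v + m n v} \<inter> {L n v'..<L n v' + m n v'} = {}) \<and>
      (\<Union>v\<in>S n. {L n v..<L n v + m n v}) = {0..<1}) \<and>
    (\<forall>c\<in>S (Suc n). {L (Suc n) c..<L (Suc n) c + m (Suc n) c} \<subseteq> {L n (g n c)..<L n (g n c) + m n (g n c)})"
proof (rule dependent_nat_choice)
  obtain v where v: "v \<in> M" "S 0 = {v}" using root by blast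
  then show "\<exists>L. (\<forall>v\<in>S 0. \<forall>v'\<in>S 0. v \<noteq> v' \<longrightarrow> {L v..<L v + m 0 v} \<inter> {L v'..<L v' + m 0 v'} = {}) \<and>
      (\<Union>v\<in>S 0. {L v..<L v + m 0 v}) = {0..<1}"
    using m(4)[of v] by (intro exI[of _ "\<lambda>_. 0"]) auto
next
  fix L n
  assume L: "(\<forall>v\<in>S n. \<forall>v'\<in>S n. v \<noteq> v' \<longrightarrow> {L v..<L v + m n v} \<inter> {L v'..<L v' + m n v'} = {}) \<and>
      (\<Union>v\<in>S n. {L v..<L v + m n v}) = {0..<1}"
  define ch where "ch v = {c. c \<in> S (Suc n) \<and> g n c = v}" for v
  have fch: "finite (ch v)" for v using S_finite[of "Suc n"] by (simp add: ch_def)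
  define Q where "Q v L' \<longleftrightarrow>
    (\<forall>c\<in>ch v. \<forall>c'\<in>ch v. c \<noteq> c' \<longrightarrow> {L' c..<L' c + m (Suc n) c} \<inter> {L' c'..<L' c' + m (Suc n) c'} = {}) \<and>
     (\<Union>c\<in>ch v. {L' c..<L' c + m (Suc n) c}) = {L v..<L v + sum (m (Suc n)) (ch v)}" for v L'
  have "\<exists>L'. Q v L'" for v
    unfolding Q_def by (rule interval_partition[OF fch]) (auto simp: ch_def intro!: less_imp_le[OF m_pos] S_sub)
  then obtain L1 where L1_Q: "\<And>v. Q v (L1 v)" by metis
  have L1:
    "\<And>v c c'. c \<in> ch v \<Longrightarrow> c' \<in> ch v \<Longrightarrow> c \<noteq> c' \<Longrightarrow> {L1 v c..<L1 v c + m (Suc n) c} \<inter> {L1 v c'..<L1 v c' + m (Suc n) c'} = {}"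
    "\<And>v. (\<Union>c\<in>ch v. {L1 v c..<L1 v c + m (Suc n) c}) = {L v..<L v + sum (m (Suc n)) (ch v)}"
    using L1_Q unfolding Q_def by auto
  define L' where "L' c = L1 (g n c) c" for c
  define I where "I c = {L' c..<L' c + m (Suc n) c}" for c
  have msum: "sum (m (Suc n)) (ch v) = m n v" if "v \<in> S n" for v using m(3)[OF that] by (simp add: ch_def)
  have cover: "(\<Union>c\<in>ch v. I c) = {L v..<L v + m n v}" if "v \<in> S n" for v
  proof -
    have "(\<Union>c\<in>ch v. I c) = (\<Union>c\<in>ch v. {L1 v c..<L1 v c + m (Suc n) c})" by (auto simp: I_def L'_def ch_def)
    then show ?thesis using L1(2) msum[OF that] by simp
  qed
  have gS: "g n c \<in> S n" "c \<in> ch (g n c)" if "c \<in> S (Suc n)" for c using g(1)[OF that] that by (auto simp: ch_def)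
  have sub: "I c \<subseteq> {L (g n c)..<L (g n c) + m n (g n c)}" if "c \<in> S (Suc n)" for c
    using cover[OF gS(1)[OF that]] gS(2)[OF that] by blast
  have d1: "I c \<inter> I c' = {}" if c: "c \<in> S (Suc n)" "c' \<in> S (Suc n)" "c \<noteq> c'" for c c'
  proof (cases "g n c = g n c'")
    case True
    then show ?thesis using L1(1)[of c "g n c" c'] gS(2)[OF c(1)] gS(2)[OF c(2)] c by (simp add: I_def L'_def)
  next
    case False
    then have "{L (g n c)..<L (g n c) + m n (g n c)} \<inter> {L (g n c')..<L (g n c') + m n (g n c')} = {}"
      using L gS c by blast
    then show ?thesis using sub[OF c(1)] sub[OF c(2)] by blast
  qed
  have d2: "(\<Union>c\<in>S (Suc n). I c) = {0..<1}"
  proof -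
    have "(\<Union>c\<in>S (Suc n). I c) = (\<Union>v\<in>S n. \<Union>c\<in>ch v. I c)" using gS by (auto simp: ch_def)
    also have "\<dots> = (\<Union>v\<in>S n. {L v..<L v + m n v})" using cover by simp
    finally show ?thesis using L by simp
  qed
  show "\<exists>L'. ((\<forall>v\<in>S (Suc n). \<forall>v'\<in>S (Suc n). v \<noteq> v' \<longrightarrow>
        {L' v..<L' v + m (Suc n) v} \<inter> {L' v'..<L' v' + m (Suc n) v'} = {}) \<and>
      (\<Union>v\<in>S (Suc n). {L' v..<L' v + m (Suc n) v}) = {0..<1}) \<and>
      (\<forall>c\<in>S (Suc n). {L' c..<L' c + m (Suc n) c} \<subseteq> {L (g n c)..<L (g n c) + m n (g n c)})"
    by (intro exI[of _ L'] conjI ballI impI) (fact d1[unfolded I_def] d2[unfolded I_def] sub[unfolded I_def])+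
qed

text \<open>The map \<open>f\<close> sends the interval of \<open>v\<close> into
  \<open>mcball v (2 * R n)\<close>, and nothing finer is known about it. Hence the bound from above
  counts the balls that meet \<open>A\<close>, and the bound from below takes one ball inside
  \<open>A\<close>.\<close>

lemma ex_measure:
  "\<exists>\<mu>. finite_measure \<mu> \<and> space \<mu> = M \<and> sets \<mu> = sigma_sets M {U. openin mtopology U} \<and>
     (\<forall>n. \<forall>A\<in>sets \<mu>. emeasure \<mu> A \<le> ennreal (\<Sum>v\<in>{v \<in> S n. mcball v (2 * R n) \<inter> A \<noteq> {}}. m n v)) \<and>
     (\<forall>n. \<forall>A\<in>sets \<mu>. \<forall>v\<in>S n. mcball v (2 * R n) \<subseteq> A \<longrightarrow> ennreal (m n v) \<le> emeasure \<mu> A)"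
proof -
  obtain L where L: "\<forall>n. ((\<forall>v\<in>S n. \<forall>v'\<in>S n. v \<noteq> v' \<longrightarrow> {L n v..<L n v + m n v} \<inter> {L n v'..<L n v' + m n v'} = {}) \<and>
      (\<Union>v\<in>S n. {L n v..<L n v + m n v}) = {0..<1}) \<and>
    (\<forall>c\<in>S (Suc n). {L (Suc n) c..<L (Suc n) c + m (Suc n) c} \<subseteq> {L n (g n c)..<L n (g n c) + m n (g n c)})"
    using ex_interval_tower by (rule exE)
  define I where "I n v = {L n v..<L n v + m n v}" for n v
  have I_disj: "v = v'" if "v \<in> S n" "v' \<in> S n" "t \<in> I n v" "t \<in> I n v'" for n v v' t
    using L that unfolding I_def by blast
  have I_union: "(\<Union>v\<in>S n. I n v) = {0..<1}" for n using L by (simp add: I_def)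
  have I_nest: "I (Suc n) c \<subseteq> I n (g n c)" if "c \<in> S (Suc n)" for n c using L that by (simp add: I_def)
  define cell where "cell n t = (SOME v. v \<in> S n \<and> t \<in> I n v)" for n t
  have cell: "cell n t \<in> S n \<and> t \<in> I n (cell n t)" if "t \<in> {0..<1}" for n t
  proof -
    have "t \<in> (\<Union>v\<in>S n. I n v)" using that by (simp add: I_union)
    then have "\<exists>v. v \<in> S n \<and> t \<in> I n v" by blast
    then show ?thesis unfolding cell_def by (rule someI_ex)
  qed
  have cell_parent: "g n (cell (Suc n) t) = cell n t" if t: "t \<in> {0..<1}" for n t
  proof (rule I_disj)
    show "g n (cell (Suc n) t) \<in> S n" using g(1) cell[OF t] by blast
    show "cell n t \<in> S n" "t \<in> I n (cell n t)" using cell[OF t] by auto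
    show "t \<in> I n (g n (cell (Suc n) t))" using I_nest cell[OF t] by blast
  qed
  \<comment> \<open>The radius \<open>2 * R n\<close> makes the ball of a child lie in that of its
    parent, as \<open>R n + 2 * R (Suc n) \<le> 2 * R n\<close>; compactness then yields a common
    point.\<close>
  have "\<exists>x. \<forall>n. x \<in> mcball (cell n t) (2 * R n)" if t: "t \<in> {0..<1}" for t
  proof -
    have "(\<Inter>n. mcball (cell n t) (2 * R n)) \<noteq> {}"
    proof (rule compact_space_imp_nest[OF compact])
      show "closedin mtopology (mcball (cell n t) (2 * R n))" for n by simp
      show "mcball (cell n t) (2 * R n) \<noteq> {}" for n
        using S_sub cell[OF t, of n] R_pos[of n] centre_in_mcball_iff[of "cell n t" "2 * R n"] by force
      show "decseq (\<lambda>n. mcball (cell n t) (2 * R n))"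
      proof (rule decseq_SucI, rule subsetI)
        fix n x assume x: "x \<in> mcball (cell (Suc n) t) (2 * R (Suc n))"
        have "d (cell (Suc n) t) (cell n t) < R n"
          using g(1)[of "cell (Suc n) t" n] cell[OF t, of "Suc n"] cell_parent[OF t, of n] by simp
        moreover have "d (cell n t) x \<le> d (cell n t) (cell (Suc n) t) + d (cell (Suc n) t) x"
          using x cell[OF t] S_sub by (intro triangle) auto
        ultimately show "x \<in> mcball (cell n t) (2 * R n)"
          using x R_Suc_le[of n] R_pos[of n] cell[OF t, of n] S_sub by (auto simp: commute)
      qed
    qed
    then show ?thesis by blast
  qed
  then obtain f where f: "\<And>t n. t \<in> {0..<1} \<Longrightarrow> f t \<in> mcball (cell n t) (2 * R n)" by metis
  have f_I: "f t \<in> mcball v (2 * R n)" if "v \<in> S n" "t \<in> I n v" for t n v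
  proof -
    have t: "t \<in> {0..<1}" using I_union[of n] that by blast
    have "cell n t = v" using I_disj[of "cell n t" n v t] cell[OF t] that by blast
    then show ?thesis using f[OF t, of n] by simp
  qed
  define \<nu> where "\<nu> = restrict_space lborel {0..<1::real}"
  have sp\<nu>: "space \<nu> = {0..<1}" by (simp add: \<nu>_def space_restrict_space)
  have I_sub: "I n v \<subseteq> {0..<1}" if "v \<in> S n" for n v using I_union that by blast
  have I_sets: "I n v \<in> sets \<nu>" if "v \<in> S n" for n v
    unfolding \<nu>_def using I_sub[OF that] by (subst sets_restrict_space_iff) (auto simp: I_def)
  have I_meas: "emeasure \<nu> (I n v) = ennreal (m n v)" if "v \<in> S n" for n v
    unfolding \<nu>_def using I_sub[OF that] m_pos[OF S_sub[OF that], of n]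
    by (subst emeasure_restrict_space) (auto simp: I_def)
  define \<B> where "\<B> = sigma M {U. openin mtopology U}"
  have opens: "{U. openin mtopology U} \<subseteq> Pow M" using openin_subset by fastforce
  have f_meas: "f \<in> measurable \<nu> \<B>"
    unfolding \<B>_def
  proof (rule measurable_measure_of[OF opens])
    show "f \<in> space \<nu> \<rightarrow> M" using f unfolding sp\<nu> by fastforce
    fix U assume "U \<in> {U. openin mtopology U}"
    then have U: "openin mtopology U" by simp
    \<comment> \<open>Measurability: the balls of the cells containing \<open>t\<close> shrink to
      \<open>f t\<close>, so an open set has a countable union of intervals as its preimage.\<close>
    have "f -` U \<inter> space \<nu> = (\<Union>n. \<Union>v\<in>{v \<in> S n. mcball v (2 * R n) \<subseteq> U}. I n v)"
    proof (rule antisym; rule subsetI)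
      fix t assume t: "t \<in> f -` U \<inter> space \<nu>"
      then have t1: "t \<in> {0..<1}" and tU: "f t \<in> U" by (auto simp: sp\<nu>)
      obtain e where e: "e > 0" "mball (f t) e \<subseteq> U" using U tU by (auto simp: openin_mtopology)
      obtain n where n: "R n < e / 4" using R_small[of "e / 4"] e(1) by auto
      define v where "v = cell n t"
      have v: "v \<in> S n" "t \<in> I n v" using cell[OF t1] by (auto simp: v_def)
      have "mcball v (2 * R n) \<subseteq> mball (f t) e"
      proof
        fix x assume x: "x \<in> mcball v (2 * R n)"
        moreover have "f t \<in> mcball v (2 * R n)" using f_I[OF v] .
        moreover have "d (f t) x \<le> d (f t) v + d v x" using x f_I[OF v] by (intro triangle) auto
        ultimately show "x \<in> mball (f t) e" using n by (auto simp: commute)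
      qed
      then show "t \<in> (\<Union>n. \<Union>v\<in>{v \<in> S n. mcball v (2 * R n) \<subseteq> U}. I n v)" using e v by blast
    next
      fix t assume "t \<in> (\<Union>n. \<Union>v\<in>{v \<in> S n. mcball v (2 * R n) \<subseteq> U}. I n v)"
      then obtain n v where v: "v \<in> S n" "mcball v (2 * R n) \<subseteq> U" "t \<in> I n v" by blast
      then show "t \<in> f -` U \<inter> space \<nu>" using f_I[OF v(1,3)] I_sub[OF v(1)] unfolding sp\<nu> by blast
    qed
    moreover have "(\<Union>n. \<Union>v\<in>{v \<in> S n. mcball v (2 * R n) \<subseteq> U}. I n v) \<in> sets \<nu>"
      using I_sets S_finite by (intro sets.countable_UN' sets.finite_UN) auto
    ultimately show "f -` U \<inter> space \<nu> \<in> sets \<nu>" by simp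
  qed
  define \<mu> where "\<mu> = distr \<nu> \<B> f"
  have st: "sets \<mu> = sigma_sets M {U. openin mtopology U}" and sp: "space \<mu> = M"
    using opens by (simp_all add: \<mu>_def \<B>_def)
  have em: "emeasure \<mu> A = emeasure \<nu> (f -` A \<inter> {0..<1})" if "A \<in> sets \<mu>" for A
    using that f_meas by (simp add: \<mu>_def emeasure_distr sp\<nu>)
  have pre: "f -` A \<inter> {0..<1} \<in> sets \<nu>" if "A \<in> sets \<mu>" for A
    using measurable_sets[OF f_meas] that by (simp add: \<mu>_def sp\<nu>)
  have fm: "finite_measure \<mu>"
  proof (rule finite_measureI)
    have "emeasure \<nu> {0..<1} = 1" unfolding \<nu>_def by (subst emeasure_restrict_space) auto
    moreover have "emeasure \<mu> (space \<mu>) \<le> emeasure \<nu> {0..<1}"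
      using em[OF sets.top] emeasure_mono[of "f -` space \<mu> \<inter> {0..<1}" "{0..<1}" \<nu>] sets.top[of \<nu>] sp\<nu> by simp
    ultimately show "emeasure \<mu> (space \<mu>) \<noteq> \<infinity>" by (auto simp: top_unique)
  qed
  have up: "emeasure \<mu> A \<le> ennreal (\<Sum>v\<in>{v \<in> S n. mcball v (2 * R n) \<inter> A \<noteq> {}}. m n v)" if A: "A \<in> sets \<mu>" for n A
  proof -
    let ?V = "{v \<in> S n. mcball v (2 * R n) \<inter> A \<noteq> {}}"
    have "f -` A \<inter> {0..<1} \<subseteq> (\<Union>v\<in>?V. I n v)"
    proof
      fix t assume t: "t \<in> f -` A \<inter> {0..<1}"
      then have "cell n t \<in> ?V" "t \<in> I n (cell n t)" using cell[of t n] f[of t n] by auto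
      then show "t \<in> (\<Union>v\<in>?V. I n v)" by blast
    qed
    then have "emeasure \<mu> A \<le> emeasure \<nu> (\<Union>v\<in>?V. I n v)"
      unfolding em[OF A] using I_sets S_finite by (intro emeasure_mono sets.finite_UN) auto
    also have "\<dots> \<le> (\<Sum>v\<in>?V. emeasure \<nu> (I n v))"
      using I_sets S_finite by (intro emeasure_subadditive_finite) auto
    also have "\<dots> = (\<Sum>v\<in>?V. ennreal (m n v))" using I_meas by (intro sum.cong) auto
    also have "\<dots> = ennreal (\<Sum>v\<in>?V. m n v)"
      by (intro sum_ennreal) (auto intro!: less_imp_le[OF m_pos] S_sub)
    finally show ?thesis .
  qed
  have lo: "ennreal (m n v) \<le> emeasure \<mu> A"
    if A: "A \<in> sets \<mu>" and v: "v \<in> S n" "mcball v (2 * R n) \<subseteq> A" for n A v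
  proof -
    have "I n v \<subseteq> f -` A \<inter> {0..<1}" using f_I[OF v(1)] v(2) I_sub[OF v(1)] by blast
    then have "emeasure \<nu> (I n v) \<le> emeasure \<mu> A" unfolding em[OF A] using pre[OF A] by (intro emeasure_mono)
    then show ?thesis using I_meas[OF v(1)] by simp
  qed
  show ?thesis
    by (intro exI[of _ \<mu>] conjI allI ballI impI) (assumption | rule fm sp st up lo)+
qed

end

subsection \<open>Quasisymmetric distances and Ahlfors regularity\<close>

text \<open>An increasing map of the half-line onto itself vanishes at 0, and it is continuous
  there.\<close>

lemma quasisymmetric_control_zero:
  fixes \<eta> :: "real \<Rightarrow> real"
  assumes mono: "strict_mono_on {0..} \<eta>" and homeo: "homeomorphism {0..} {0..} \<eta> \<eta>'" and e: "e > 0"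
  shows "\<exists>s>0. \<forall>t. 0 \<le> t \<and> t < s \<longrightarrow> \<eta> t < e"
proof -
  have img: "\<eta> ` {0..} = {0..}" and cont: "continuous_on {0..} \<eta>" using homeo by (auto simp: homeomorphism_def)
  obtain z where z: "z \<ge> 0" "\<eta> z = 0" using img by (metis atLeast_iff imageE order_refl)
  have "\<eta> 0 \<ge> 0" using img by auto
  then have "z = 0" using z strict_mono_onD[OF mono, of 0 z] by fastforce
  then have 0: "\<eta> 0 = 0" using z by simp
  obtain s where s: "s > 0" "\<forall>t\<in>{0..}. dist t 0 < s \<longrightarrow> dist (\<eta> t) (\<eta> 0) < e"
    using cont e unfolding continuous_on_iff by (metis atLeast_iff order_refl)
  then have "\<eta> t < e" if "0 \<le> t" "t < s" for t using that 0 by (auto simp: dist_real_def abs_less_iff)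
  then show ?thesis using s(1) by blast
qed

text \<open>A fixed \<open>y\<close> other than \<open>x\<close> serves as a yardstick:
  \<open>\<theta> z x\<close> is at most \<open>\<eta> (d z x / d y x) * \<theta> y x\<close>, which
  is small for \<open>z\<close> near \<open>x\<close>.\<close>

lemma quasisymmetric_continuous:
  assumes d: "Metric_space X d" and qs: "quasisymmetric X \<theta> d"
  shows "continuous_map (Metric_space.mtopology X d) (Metric_space.mtopology X \<theta>) id"
proof -
  interpret D: Metric_space X d by (rule d)
  interpret T: Metric_space X \<theta> using qs by (simp add: quasisymmetric_def)
  from qs obtain \<eta> \<eta>' where \<eta>12: "strict_mono_on {0..} \<eta>" "homeomorphism {0..} {0..} \<eta> \<eta>'"
    and \<eta>3: "\<forall>x\<in>X. \<forall>y\<in>X. \<forall>a\<in>X. x \<noteq> y \<and> x \<noteq> a \<and> y \<noteq> a \<longrightarrow> \<theta> x a / \<theta> y a \<le> \<eta> (d x a / d y a)"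
    unfolding quasisymmetric_def by (elim conjE exE)
  have "openin D.mtopology U" if U: "openin T.mtopology U" for U
    unfolding D.openin_mtopology
  proof (intro conjI allI impI)
    show "U \<subseteq> X" using openin_subset[OF U] by simp
    fix x assume x: "x \<in> U"
    obtain e where e: "e > 0" "T.mball x e \<subseteq> U" using U x by (auto simp: T.openin_mtopology)
    have xX: "x \<in> X" using x \<open>U \<subseteq> X\<close> by blast
    show "\<exists>r>0. D.mball x r \<subseteq> U"
    proof (cases "\<exists>y\<in>X. y \<noteq> x")
      case False
      then show ?thesis using x by (intro exI[of _ 1]) auto
    next
      case True
      then obtain y where y: "y \<in> X" "y \<noteq> x" by blast
      have pos: "\<theta> y x > 0" "d y x > 0" using y xX by auto
      obtain s where s: "s > 0" "\<And>t. 0 \<le> t \<Longrightarrow> t < s \<Longrightarrow> \<eta> t < e / \<theta> y x"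
        using quasisymmetric_control_zero[OF \<eta>12, of "e / \<theta> y x"] e pos by auto
      \<comment> \<open>The second entry of the minimum keeps \<open>z\<close> different from
        \<open>y\<close>; the quasisymmetry condition speaks of distinct points only.\<close>
      have "z \<in> U" if z: "z \<in> D.mball x (min (s * d y x) (d y x))" for z
      proof (cases "z = x")
        case True
        then show ?thesis using x by simp
      next
        case False
        have zX: "z \<in> X" "d z x < s * d y x" "d z x < d y x" using z by (auto simp: D.commute)
        have "z \<noteq> y" using zX by auto
        then have "\<theta> z x / \<theta> y x \<le> \<eta> (d z x / d y x)" using zX y xX False \<eta>3 by simp
        also have "\<dots> < e / \<theta> y x" using zX pos by (intro s(2)) (auto simp: pos_divide_less_eq)
        finally have "\<theta> z x < e" using pos by (simp add: divide_less_cancel)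
        then show ?thesis using e(2) zX xX by (auto simp: T.commute)
      qed
      then show ?thesis using s(1) pos by (intro exI[of _ "min (s * d y x) (d y x)"]) auto
    qed
  qed
  then show ?thesis
    using openin_subset by (fastforce simp: continuous_map_def vimage_def Collect_conj_eq Int_absorb1 inf_commute)
qed

text \<open>A continuous bijection from a compact space to a Hausdorff space is a homeomorphism, so
  one direction of continuity is enough.\<close>

lemma quasisymmetric_mtopology:
  assumes d: "Metric_space X d" and qs: "quasisymmetric X \<theta> d"
    and compact: "compact_space (Metric_space.mtopology X d)"
  shows "Metric_space.mtopology X \<theta> = Metric_space.mtopology X d"
proof -
  interpret D: Metric_space X d by (rule d)
  interpret T: Metric_space X \<theta> using qs by (simp add: quasisymmetric_def)
  have cont: "continuous_map D.mtopology T.mtopology id" by (rule quasisymmetric_continuous[OF d qs])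
  have "closed_map D.mtopology T.mtopology id"
    using continuous_imp_closed_map[OF cont compact T.Hausdorff_space_mtopology] .
  then have "closedin T.mtopology U" if "closedin D.mtopology U" for U
    using that by (auto simp: closed_map_def)
  moreover have "closedin D.mtopology U" if U: "closedin T.mtopology U" for U
  proof -
    have "closedin D.mtopology {x \<in> topspace D.mtopology. id x \<in> U}"
      using U by (intro closedin_continuous_map_preimage[OF cont])
    moreover have "{x \<in> topspace D.mtopology. id x \<in> U} = U" using closedin_subset[OF U] by auto
    ultimately show ?thesis by simp
  qed
  ultimately show ?thesis by (auto simp: topology_eq openin_closedin_eq)
qed

section \<open>Ahlfors regularity and dimension of the chain metric\<close>

context cut_tower
begin

lemma mtopology_\<theta>: "Metric_space.mtopology M \<theta> = mtopology"
  by (rule quasisymmetric_mtopology[OF Metric_space_axioms \<theta>_quasisymmetric compact])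

lemma sum_m: "(\<Sum>v\<in>S n. m n v) = 1"
proof (induction n)
  case 0
  then show ?case using root m(4) by fastforce
next
  case (Suc n)
  have "(\<Sum>c\<in>S (Suc n). m (Suc n) c) = (\<Sum>v\<in>S n. \<Sum>c | c \<in> S (Suc n) \<and> g n c = v. m (Suc n) c)"
    using S_finite g(1) by (intro sum.group[symmetric]) auto
  also have "\<dots> = (\<Sum>v\<in>S n. m n v)" using m(3) by simp
  finally show ?case using Suc by simp
qed

lemma w_powr: "x \<in> M \<Longrightarrow> w n x powr p = m n x"
  using m_pos[of x n] p by (simp add: w_def powr_powr)

lemma w_zero: "x \<in> M \<Longrightarrow> w 0 x = 1"
  by (simp add: w_def m(4))

definition decay :: "nat \<Rightarrow> real" where
  "decay n = exp 8 * (\<sigma> powr (1 / p)) ^ n"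

lemma decay: "decay n > 0" "decay \<longlonglongrightarrow> 0"
proof -
  show "decay n > 0" using \<sigma> by (simp add: decay_def)
  have "\<sigma> powr (1 / p) < 1 powr (1 / p)" using \<sigma> p by (intro powr_less_mono2) auto
  then have "(\<lambda>n. (\<sigma> powr (1 / p)) ^ n) \<longlonglongrightarrow> 0" using \<sigma> by (intro LIMSEQ_power_zero) auto
  then show "decay \<longlonglongrightarrow> 0" unfolding decay_def by (rule tendsto_mult_right_zero)
qed

lemma w_le_decay: "x \<in> M \<Longrightarrow> w n x \<le> decay n"
  using w_decay[of x 0 n] w_zero by (simp add: decay_def)

lemma w_small: "x \<in> M \<Longrightarrow> e > 0 \<Longrightarrow> \<exists>n. w n x < e"
proof -
  assume x: "x \<in> M" and e: "e > 0"
  have "eventually (\<lambda>n. decay n < e) sequentially" using order_tendstoD(2)[OF decay(2) e] .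
  then obtain n where "decay n < e" by (auto simp: eventually_sequentially)
  then show ?thesis using w_le_decay[OF x, of n] by (meson le_less_trans)
qed

lemma lev_ge: 
  assumes "x \<in> M" "y \<in> M" "x \<noteq> y" "d x y \<le> R n"
  shows "n \<le> lev (d x y)"
proof (rule ccontr)
  assume "\<not> n \<le> lev (d x y)"
  then have "R n \<le> R (Suc (lev (d x y)))" by (intro R_antimono) simp
  then show False using lev(1)[of "d x y"] assms by auto
qed

definition c\<^sub>3 where "c\<^sub>3 = c\<^sub>2 * exp 8"

lemma c3_pos: "c\<^sub>3 > 0" using c2_pos by (simp add: c\<^sub>3_def)

lemma \<theta>_le_if_close:
  assumes "x \<in> M" "y \<in> M" "d x y \<le> R n"
  shows "\<theta> x y \<le> c\<^sub>3 * w n x"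
proof (cases "x = y")
  case True
  then show ?thesis using \<theta>_self assms c3_pos w_pos[OF assms(1), of n] by simp
next
  case False
  have "\<theta> x y \<le> c\<^sub>2 * w (lev (d x y)) x" by (rule \<theta>_upper_lev[OF assms(1,2) False])
  also have "\<dots> \<le> c\<^sub>2 * (exp 8 * w n x)"
    using c2_pos lev_ge[OF assms(1,2) False assms(3)] assms by (intro mult_left_mono w_quasi_decreasing) auto
  finally show ?thesis by (simp add: c\<^sub>3_def)
qed

lemma close_if_\<theta>_less:
  assumes "x \<in> M" "y \<in> M" "\<theta> x y < r" "\<And>j. j < n \<Longrightarrow> r \<le> c\<^sub>1 * w j x"
  shows "d x y \<le> R n"
proof (cases "x = y")
  case True
  then show ?thesis using R_pos[of n] assms by simp
next
  case False
  have "c\<^sub>1 * w (lev (d x y)) x < r" using \<theta>_lower_lev[OF assms(1,2) False] assms(3) by simp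
  then have "n \<le> lev (d x y)" using assms(4)[of "lev (d x y)"] by force
  then have "R (lev (d x y)) \<le> R n" by (rule R_antimono)
  then show ?thesis using lev(2)[of "d x y"] D(2)[OF assms(1,2)] False assms by auto
qed

text \<open>A \<open>\<theta>\<close>-ball of radius \<open>r\<close> is compared with
  \<open>d\<close>-balls of radius \<open>R n\<close> for levels where \<open>w n x\<close> is about
  \<open>r\<close>; their mass is about \<open>m n x = w n x powr p\<close>.\<close>

lemma \<theta>_ahlfors_regular: "Metric_space.ahlfors_regular_of_dim M \<theta> p"
proof -
  interpret T: Metric_space M \<theta> by (rule \<theta>_metric)
  from ex_measure obtain \<mu>
    where \<mu>: "finite_measure \<mu>" "space \<mu> = M" "sets \<mu> = sigma_sets M {U. openin mtopology U}"
    and up: "\<forall>n. \<forall>X\<in>sets \<mu>. emeasure \<mu> X \<le> ennreal (\<Sum>v\<in>{v \<in> S n. mcball v (2 * R n) \<inter> X \<noteq> {}}. m n v)"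
    and lo: "\<forall>n. \<forall>X\<in>sets \<mu>. \<forall>v\<in>S n. mcball v (2 * R n) \<subseteq> X \<longrightarrow> ennreal (m n v) \<le> emeasure \<mu> X"
    by (elim exE conjE)
  have "radon_measure \<mu>" by (rule radon_measureI[OF compact \<mu>])
  then have radon: "T.radon_measure \<mu>"
    unfolding T.radon_measure_def radon_measure_def mtopology_\<theta> .
  have ball_sets: "T.mball x r \<in> sets \<mu>" for x r
  proof -
    have "openin mtopology (T.mball x r)" using T.openin_mball[of x r] by (simp add: mtopology_\<theta>)
    then show ?thesis using \<mu>(3) by (auto intro: sigma_sets.Basic)
  qed
  have A0: "A \<ge> 0" using root kernel[of _ 0] by (smt (verit) exp_ge_zero sum_nonneg)
  have upper: "emeasure \<mu> X \<le> ennreal (exp 7 * A * m n x)"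
    if X: "X \<in> sets \<mu>" "X \<subseteq> mcball x (R n)" and x: "x \<in> M" for X x n
  proof -
    define V where "V = {v \<in> S n. mcball v (2 * R n) \<inter> X \<noteq> {}}"
    have V: "d x v \<le> 3 * R n" "v \<in> M" if v: "v \<in> V" for v
    proof -
      obtain y where y: "y \<in> mcball v (2 * R n)" "y \<in> mcball x (R n)"
        using v X(2) unfolding V_def by blast
      show "v \<in> M" using v S_sub by (auto simp: V_def)
      have "d x v \<le> d x y + d y v" using x y by (intro triangle) auto
      then show "d x v \<le> 3 * R n" using y by (auto simp: commute)
    qed
    \<comment> \<open>The points of \<open>V\<close> are not counted: each has kernel weight at
      least \<open>exp (- 1)\<close>, being within \<open>3 * R n\<close> of \<open>x\<close>, so
      \<open>A\<close> takes the place of their number. The factor \<open>exp 6\<close> moves the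
      base point.\<close>
    have "(\<Sum>v\<in>V. m n v) \<le> (\<Sum>v\<in>V. exp 7 * m n x * exp (- d x v / (8 * R n)))"
    proof (rule sum_mono)
      fix v assume v: "v \<in> V"
      have 1: "m n v \<le> exp (2 * 3) * m n x" using V[OF v] x by (intro m_lip) (auto simp: commute)
      have "d x v / (8 * R n) \<le> 1" using V[OF v] R_pos[of n] by (simp add: field_simps)
      then have "exp 6 \<le> exp 7 * exp (- d x v / (8 * R n))" by (simp flip: exp_add)
      then have "exp 6 * m n x \<le> exp 7 * exp (- d x v / (8 * R n)) * m n x"
        using m_pos[OF x, of n] by (intro mult_right_mono) auto
      then show "m n v \<le> exp 7 * m n x * exp (- d x v / (8 * R n))" using 1 by (simp add: mult_ac)
    qed
    also have "\<dots> = exp 7 * m n x * (\<Sum>v\<in>V. exp (- d x v / (8 * R n)))" by (simp add: sum_distrib_left)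
    also have "\<dots> \<le> exp 7 * m n x * (\<Sum>v\<in>S n. exp (- d x v / (8 * R n)))"
      using S_finite m_pos[OF x, of n] by (intro mult_left_mono sum_mono2) (auto simp: V_def)
    also have "\<dots> \<le> exp 7 * m n x * A" using kernel[OF x, of n] m_pos[OF x, of n] by (intro mult_left_mono) auto
    finally have "(\<Sum>v\<in>V. m n v) \<le> exp 7 * A * m n x" by (simp add: mult_ac)
    then show ?thesis using up[rule_format, OF X(1), of n] unfolding V_def by (meson ennreal_leI order_trans)
  qed
  have lower: "ennreal (exp (- 2) * \<delta> * m n x) \<le> emeasure \<mu> X"
    if X: "X \<in> sets \<mu>" "mcball x (R n) \<subseteq> X" and x: "x \<in> M" for X x n
  proof -
    obtain v where v: "v \<in> S (Suc n)" "d x v < R (Suc n)" using S(2)[OF x] by blast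
    have vM: "v \<in> M" by (rule S_sub[OF v(1)])
    have "mcball v (2 * R (Suc n)) \<subseteq> mcball x (R n)"
    proof
      fix y assume y: "y \<in> mcball v (2 * R (Suc n))"
      then have "d x y \<le> d x v + d v y" using x vM by (intro triangle) auto
      then show "y \<in> mcball x (R n)" using y v x R_Suc_le[of n] R_pos[of "Suc n"] by auto
    qed
    then have 1: "ennreal (m (Suc n) v) \<le> emeasure \<mu> X" using X by (intro lo[rule_format, OF X(1) v(1)]) auto
    have "\<delta> * m n x \<le> m (Suc n) x" by (rule m(2)[OF x])
    also have "\<dots> \<le> exp (2 * 1) * m (Suc n) v" using v x vM by (intro m_lip) auto
    finally have "exp (- 2) * \<delta> * m n x \<le> m (Suc n) v" by (simp add: exp_minus field_simps)
    then show ?thesis using 1 by (meson ennreal_leI order_trans)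
  qed
  define K1 where "K1 = exp 7 * A / c\<^sub>1 powr p"
  define K2 where "K2 = exp (- 2) * \<delta> * (\<delta> / c\<^sub>3) powr p"
  have K2: "K2 > 0" unfolding K2_def using \<delta> c3_pos by simp
  have K1: "K1 \<ge> 0" unfolding K1_def using A0 by simp
  define K where "K = max 1 (max K1 (1 / K2))"
  have "ennreal (r powr p / K) \<le> emeasure \<mu> (T.mball x r) \<and> emeasure \<mu> (T.mball x r) \<le> ennreal (K * r powr p)"
    if x: "x \<in> M" and r: "0 < r" "ennreal r \<le> T.mdiam M" for x r
  proof
    \<comment> \<open>Minimality of \<open>n\<close> gives the inclusion of the ball and the
      inequality at \<open>n\<close> the bound on the mass. In the bound from below the two exchange
      their roles.\<close>
    define n where "n = (LEAST n. c\<^sub>1 * w n x < r)"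
    obtain i where "w i x < r / c\<^sub>1" using w_small[OF x, of "r / c\<^sub>1"] r c1_pos by auto
    then have "c\<^sub>1 * w i x < r" using c1_pos by (simp add: field_simps)
    then have n: "c\<^sub>1 * w n x < r" unfolding n_def by (rule LeastI)
    have n': "r \<le> c\<^sub>1 * w j x" if "j < n" for j using not_less_Least[of j] that unfolding n_def by force
    have "T.mball x r \<subseteq> mcball x (R n)" using close_if_\<theta>_less[OF x _ _ n'] x by auto
    then have "emeasure \<mu> (T.mball x r) \<le> ennreal (exp 7 * A * m n x)" using x ball_sets by (intro upper)
    also have "\<dots> \<le> ennreal (K * r powr p)"
    proof (rule ennreal_leI)
      have "(c\<^sub>1 * w n x) powr p \<le> r powr p" using n p c1_pos w_pos[OF x, of n] by (intro powr_mono2) auto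
      then have "c\<^sub>1 powr p * m n x \<le> r powr p" using c1_pos w_pos[OF x, of n] by (simp add: powr_mult w_powr[OF x])
      then have "m n x \<le> r powr p / c\<^sub>1 powr p" using c1_pos by (simp add: field_simps)
      then have "exp 7 * A * m n x \<le> exp 7 * A * (r powr p / c\<^sub>1 powr p)" using A0 by (intro mult_left_mono) auto
      also have "\<dots> = K1 * r powr p" by (simp add: K1_def)
      also have "\<dots> \<le> K * r powr p" by (intro mult_right_mono) (auto simp: K_def)
      finally show "exp 7 * A * m n x \<le> K * r powr p" .
    qed
    finally show "emeasure \<mu> (T.mball x r) \<le> ennreal (K * r powr p)" .
  next
    have "T.mdiam M \<le> ennreal c\<^sub>3"
      unfolding T.mdiam_def
    proof (rule SUP_least, clarify)
      fix y z assume yz: "y \<in> M" "z \<in> M"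
      have "d y z \<le> R 0" using D(2)[OF yz] by (simp add: R_def)
      then have "\<theta> y z \<le> c\<^sub>3" using \<theta>_le_if_close[OF yz, of 0] w_zero[OF yz(1)] by simp
      then show "ennreal (\<theta> y z) \<le> ennreal c\<^sub>3" by (rule ennreal_leI)
    qed
    then have "ennreal r \<le> ennreal c\<^sub>3" using r(2) by (rule order_trans[rotated])
    then have rc: "r \<le> c\<^sub>3" using c3_pos by (simp add: ennreal_le_iff)
    define n where "n = (LEAST n. c\<^sub>3 * w n x < r)"
    obtain i where "w i x < r / c\<^sub>3" using w_small[OF x, of "r / c\<^sub>3"] r c3_pos by auto
    then have "c\<^sub>3 * w i x < r" using c3_pos by (simp add: field_simps)
    then have n: "c\<^sub>3 * w n x < r" unfolding n_def by (rule LeastI)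
    have n': "\<not> c\<^sub>3 * w j x < r" if "j < n" for j using not_less_Least[of j] that unfolding n_def by force
    \<comment> \<open>Minimality bounds \<open>r\<close> at level \<open>n - 1\<close>, and one
      level costs \<open>\<delta>\<close>. At \<open>n = 0\<close> there is no previous level; there
      \<open>r\<close> is bounded by the diameter, hence by \<open>c\<^sub>3\<close>.\<close>
    have wn: "\<delta> * r \<le> c\<^sub>3 * w n x"
    proof (cases n)
      case 0
      have "\<delta> * r \<le> 1 * c\<^sub>3" using rc r \<delta> by (intro mult_mono) auto
      then show ?thesis using 0 w_zero[OF x] by simp
    next
      case (Suc j)
      have "\<delta> * r \<le> \<delta> * (c\<^sub>3 * w j x)" using n'[of j] Suc \<delta> by (intro mult_left_mono) auto
      also have "\<dots> \<le> c\<^sub>3 * w n x" using w_growth[OF x, of 1 j] c3_pos Suc by (simp add: mult.left_commute)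
      finally show ?thesis .
    qed
    have "mcball x (R n) \<subseteq> T.mball x r"
    proof
      fix y assume y: "y \<in> mcball x (R n)"
      then have "\<theta> x y \<le> c\<^sub>3 * w n x" using x by (intro \<theta>_le_if_close) auto
      then show "y \<in> T.mball x r" using n x y by auto
    qed
    then have "ennreal (exp (- 2) * \<delta> * m n x) \<le> emeasure \<mu> (T.mball x r)" using x ball_sets by (intro lower)
    moreover have "r powr p / K \<le> exp (- 2) * \<delta> * m n x"
    proof -
      have "(\<delta> / c\<^sub>3 * r) powr p \<le> w n x powr p"
        using wn \<delta> c3_pos r p by (intro powr_mono2) (auto simp: field_simps)
      moreover have "(\<delta> / c\<^sub>3 * r) powr p = (\<delta> / c\<^sub>3) powr p * r powr p"
        using \<delta> c3_pos r by (intro powr_mult)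
      ultimately have "(\<delta> / c\<^sub>3) powr p * r powr p \<le> m n x" by (simp add: w_powr[OF x])
      then have "exp (- 2) * \<delta> * ((\<delta> / c\<^sub>3) powr p * r powr p) \<le> exp (- 2) * \<delta> * m n x"
        using \<delta> by (intro mult_left_mono) auto
      then have "K2 * r powr p \<le> exp (- 2) * \<delta> * m n x" by (simp add: K2_def mult.assoc)
      moreover have "r powr p / K \<le> r powr p / (1 / K2)"
        using K2 by (intro divide_left_mono) (auto simp: K_def)
      ultimately show ?thesis by (simp add: mult.commute)
    qed
    ultimately show "ennreal (r powr p / K) \<le> emeasure \<mu> (T.mball x r)" by (meson ennreal_leI order_trans)
  qed
  moreover have "K \<ge> 1" by (simp add: K_def)
  ultimately show ?thesis unfolding T.ahlfors_regular_of_dim_def using radon by blast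
qed

text \<open>Balls of radius \<open>R n\<close> around the net have diameters to the power
  \<open>s\<close> bounded by a constant times \<open>decay n powr (s - p)\<close> times their
  masses, which add up to 1.\<close>

lemma \<theta>_hausdorff_measure:
  assumes s: "s > p"
  shows "Metric_space.hausdorff_measure M \<theta> s M = 0"
proof -
  interpret T: Metric_space M \<theta> by (rule \<theta>_metric)
  have "T.hausdorff_premeasure s e M = 0" if e: "e > 0" for e
  proof -
    define b where "b n = (2 * c\<^sub>3) powr s * decay n powr (s - p)" for n
    have bound: "T.hausdorff_premeasure s e M \<le> ennreal (b n)" if n: "2 * c\<^sub>3 * decay n \<le> e" for n
    proof -
      obtain f where f: "bij_betw f {..<card (S n)} (S n)"
        using ex_bij_betw_nat_finite[OF S_finite, of n] by (auto simp: atLeast0LessThan)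
      have fS: "f i \<in> S n" "f i \<in> M" if "i < card (S n)" for i
        using f that S_sub by (auto simp: bij_betw_def)
      define U where "U i = (if i < card (S n) then mcball (f i) (R n) else {})" for i
      have diam: "T.mdiam (U i) \<le> ennreal (2 * c\<^sub>3 * w n (f i))" if i: "i < card (S n)" for i
        unfolding T.mdiam_def
      proof (rule SUP_least, clarify)
        fix y z assume "y \<in> U i" "z \<in> U i"
        then have yz: "y \<in> M" "z \<in> M" "d (f i) y \<le> R n" "d (f i) z \<le> R n" using i by (auto simp: U_def)
        have "\<theta> y z \<le> \<theta> (f i) y + \<theta> (f i) z"
          using T.triangle[of y "f i" z] fS[OF i] yz by (simp add: T.commute)
        also have "\<dots> \<le> c\<^sub>3 * w n (f i) + c\<^sub>3 * w n (f i)"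
          using fS[OF i] yz by (intro add_mono \<theta>_le_if_close)
        finally show "ennreal (\<theta> y z) \<le> ennreal (2 * c\<^sub>3 * w n (f i))" by (intro ennreal_leI) simp
      qed
      have admissible: "U i \<subseteq> M \<and> T.mdiam (U i) \<le> ennreal e" for i
      proof (cases "i < card (S n)")
        case True
        have "2 * c\<^sub>3 * w n (f i) \<le> 2 * c\<^sub>3 * decay n"
          using w_le_decay[OF fS(2)[OF True]] c3_pos by (intro mult_left_mono) auto
        then have "ennreal (2 * c\<^sub>3 * w n (f i)) \<le> ennreal e" using n by (intro ennreal_leI) simp
        then show ?thesis using diam[OF True] True by (auto simp: U_def)
      next
        case False
        then show ?thesis by (simp add: U_def T.mdiam_def)
      qed
      have cover: "M \<subseteq> (\<Union>i. U i)"
      proof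
        fix x assume x: "x \<in> M"
        obtain v where v: "v \<in> S n" "d x v < R n" using S(2)[OF x] by blast
        then have "v \<in> f ` {..<card (S n)}" using bij_betw_imp_surj_on[OF f] by simp
        then obtain i where "i < card (S n)" "f i = v" by auto
        then have "x \<in> U i" using v x S_sub by (auto simp: U_def commute)
        then show "x \<in> (\<Union>i. U i)" by blast
      qed
      have term_le: "T.diam_pow s (U i) \<le> (if i < card (S n) then ennreal (b n * m n (f i)) else 0)" for i
      proof (cases "i < card (S n)")
        case True
        have wp: "w n (f i) > 0" by (rule w_pos[OF fS(2)[OF True]])
        have "enn2real (T.mdiam (U i)) \<le> 2 * c\<^sub>3 * w n (f i)"
          using enn2real_mono[OF diam[OF True]] c3_pos wp by simp
        then have "enn2real (T.mdiam (U i)) powr s \<le> (2 * c\<^sub>3 * w n (f i)) powr s"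
          using s p by (intro powr_mono2) auto
        also have "\<dots> = (2 * c\<^sub>3) powr s * (w n (f i) powr (s - p) * w n (f i) powr p)"
          using c3_pos wp by (simp add: powr_mult flip: powr_add)
        also have "\<dots> \<le> (2 * c\<^sub>3) powr s * (decay n powr (s - p) * w n (f i) powr p)"
          using wp w_le_decay[OF fS(2)[OF True]] s by (intro mult_left_mono mult_right_mono powr_mono2) auto
        also have "\<dots> = b n * m n (f i)" using w_powr[OF fS(2)[OF True]] by (simp add: b_def)
        finally show ?thesis using True s p by (simp add: T.diam_pow_def ennreal_leI)
      next
        case False
        then show ?thesis by (simp add: U_def T.diam_pow_def)
      qed
      have "T.hausdorff_premeasure s e M \<le> (\<Sum>i. T.diam_pow s (U i))"
        unfolding T.hausdorff_premeasure_def using admissible cover by (intro INF_lower) auto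
      also have "\<dots> \<le> (\<Sum>i. if i < card (S n) then ennreal (b n * m n (f i)) else 0)"
        by (intro suminf_le term_le) auto
      also have "\<dots> = (\<Sum>i<card (S n). ennreal (b n * m n (f i)))"
        by (subst suminf_finite[of "{..<card (S n)}"]) auto
      also have "\<dots> = (\<Sum>v\<in>S n. ennreal (b n * m n v))" by (rule sum.reindex_bij_betw[OF f])
      also have "\<dots> = ennreal (\<Sum>v\<in>S n. b n * m n v)"
        using m_pos[OF S_sub] by (intro sum_ennreal) (auto simp: b_def less_imp_le)
      also have "(\<Sum>v\<in>S n. b n * m n v) = b n" by (simp add: sum_m flip: sum_distrib_left)
      finally show ?thesis .
    qed
    have "b \<longlonglongrightarrow> 0"
    proof -
      have "(\<lambda>n. decay n powr (s - p)) \<longlonglongrightarrow> 0"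
        using decay s by (intro tendsto_zero_powrI[OF decay(2) tendsto_const]) (auto intro!: always_eventually less_imp_le)
      then show ?thesis unfolding b_def by (rule tendsto_mult_right_zero)
    qed
    have small: "eventually (\<lambda>n. 2 * c\<^sub>3 * decay n \<le> e) sequentially"
    proof -
      have "(\<lambda>n. 2 * c\<^sub>3 * decay n) \<longlonglongrightarrow> 0" by (intro tendsto_mult_right_zero decay)
      then have "eventually (\<lambda>n. 2 * c\<^sub>3 * decay n < e) sequentially" by (rule order_tendstoD(2)[OF _ e])
      then show ?thesis by (rule eventually_mono) simp
    qed
    have "T.hausdorff_premeasure s e M \<le> ennreal 0"
    proof (rule tendsto_lowerbound)
      show "(\<lambda>n. ennreal (b n)) \<longlonglongrightarrow> ennreal 0" using \<open>b \<longlonglongrightarrow> 0\<close> by (intro tendsto_ennrealI)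
      show "eventually (\<lambda>n. T.hausdorff_premeasure s e M \<le> ennreal (b n)) sequentially"
        using small by (rule eventually_mono) (rule bound)
    qed simp
    then show ?thesis by simp
  qed
  then show ?thesis unfolding T.hausdorff_measure_def by (simp add: SUP_eq_const)
qed

lemma AR_conformal_dim_le: "AR_conformal_dim M d \<le> ennreal p"
proof -
  interpret T: Metric_space M \<theta> by (rule \<theta>_metric)
  have "T.ahlfors_regular" using \<theta>_ahlfors_regular p by (auto simp: T.ahlfors_regular_def intro!: exI[of _ p])
  then have "AR_conformal_dim M d \<le> T.hausdorff_dim"
    unfolding AR_conformal_dim_def using \<theta>_quasisymmetric by (intro INF_lower) auto
  also have "\<dots> \<le> ennreal p"
  proof (rule ennreal_le_epsilon)
    fix e :: real assume e: "e > 0"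
    have "T.hausdorff_dim \<le> ennreal (p + e)"
      unfolding T.hausdorff_dim_def using \<theta>_hausdorff_measure[of "p + e"] e p by (intro INF_lower) auto
    then show "T.hausdorff_dim \<le> ennreal p + ennreal e" using e p by (simp add: ennreal_plus)
  qed
  finally show ?thesis .
qed

end

subsection \<open>The bound from below and the construction of the densities\<close>

context Metric_space
begin

lemma mdiam_le_diam_pow:
  assumes "0 \<le> s" "s < 1" "mdiam U \<le> 1"
  shows "mdiam U \<le> diam_pow s U"
proof -
  consider "U = {}" | "U \<noteq> {}" "s = 0" | "U \<noteq> {}" "s > 0" using assms by force
  then show ?thesis
  proof cases
    case 1
    then show ?thesis by (simp add: mdiam_def)
  next
    case 2
    then show ?thesis using assms by (simp add: diam_pow_def)
  next
    case 3
    define t where "t = enn2real (mdiam U)"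
    have fin: "mdiam U < top" using assms(3) by (metis ennreal_one_less_top le_less_trans)
    then have t: "mdiam U = ennreal t" by (simp add: t_def)
    have "0 \<le> t" "t \<le> 1" using assms(3) by (auto simp: t_def enn2real_leI)
    then have "t powr 1 \<le> t powr s" using assms by (intro powr_mono') auto
    then have "ennreal t \<le> ennreal (t powr s)" using \<open>0 \<le> t\<close> by (intro ennreal_leI) simp
    then show ?thesis using 3 t \<open>0 \<le> t\<close> by (simp add: diam_pow_def)
  qed
qed

text \<open>The distance to a point maps a connected space onto an interval, whose length is at most the sum of
  the lengths of the images of the covering sets.\<close>

lemma dist_le_sum_mdiam:
  assumes connected: "connected_space mtopology" and xy: "x \<in> M" "y \<in> M"
    and U: "\<And>i::nat. U i \<subseteq> M" "\<And>i. mdiam (U i) \<le> 1" "M \<subseteq> (\<Union>i. U i)"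
  shows "ennreal (d x y) \<le> 2 * (\<Sum>i. mdiam (U i))"
proof -
  define t where "t i = enn2real (mdiam (U i))" for i
  have t: "mdiam (U i) = ennreal (t i)" for i
    using U(2)[of i] unfolding t_def by (metis ennreal_enn2real ennreal_one_less_top le_less_trans)
  have t0: "t i \<ge> 0" for i by (simp add: t_def)
  define z where "z i = (SOME u. u \<in> U i)" for i
  \<comment> \<open>The image of \<open>U i\<close> may fail to be measurable. An interval of twice
    its length, centred at the image of some point of \<open>U i\<close>, replaces it, whence the
    factor 2.\<close>
  define J where "J i = (if U i = {} then {} else {d x (z i) - t i..d x (z i) + t i})" for i
  have "{0..<d x y} \<subseteq> (\<Union>i. J i)"
  proof
    fix r assume r: "r \<in> {0..<d x y}"
    then obtain u where u: "u \<in> M" "d x u = r" using sphere_point[OF connected xy, of r] by auto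
    then obtain i where i: "u \<in> U i" using U(3) by blast
    have z: "z i \<in> U i" unfolding z_def using i by (rule someI)
    have "d u (z i) \<le> t i" using mdiam_leD[of "U i" "t i" u "z i"] t t0 i z by simp
    moreover have "d x u \<le> d x (z i) + d u (z i)" "d x (z i) \<le> d x u + d u (z i)"
      using triangle[of x "z i" u] triangle[of x u "z i"] xy u z U(1) by (auto simp: commute)
    ultimately have "r \<in> J i" using u i by (auto simp: J_def)
    then show "r \<in> (\<Union>i. J i)" by blast
  qed
  then have "emeasure lborel {0..<d x y} \<le> emeasure lborel (\<Union>i. J i)"
    by (intro emeasure_mono) (auto simp: J_def)
  also have "\<dots> \<le> (\<Sum>i. emeasure lborel (J i))"
    by (intro emeasure_subadditive_countably) (auto simp: J_def)
  also have "\<dots> \<le> (\<Sum>i. 2 * mdiam (U i))"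
  proof (intro suminf_le)
    show "emeasure lborel (J i) \<le> 2 * mdiam (U i)" for i
      using t0[of i] by (auto simp: J_def t ennreal_mult' simp flip: ennreal_numeral)
  qed auto
  also have "\<dots> = 2 * (\<Sum>i. mdiam (U i))" by simp
  finally show ?thesis by simp
qed

text \<open>For \<open>s < 1\<close> and sets of diameter at most 1, the diameter is at most its
  \<open>s\<close>-th power; hence already the premeasure at scale 1 is positive.\<close>

lemma hausdorff_dim_ge_1:
  assumes connected: "connected_space mtopology" and xy: "x \<in> M" "y \<in> M" "x \<noteq> y"
  shows "1 \<le> hausdorff_dim"
  unfolding hausdorff_dim_def
proof (rule INF_greatest)
  fix s assume "s \<in> {s. 0 \<le> s \<and> hausdorff_measure s M = 0}"
  then have s: "0 \<le> s" "hausdorff_measure s M = 0" by auto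
  have "1 \<le> s"
  proof (rule ccontr)
    assume "\<not> 1 \<le> s"
    have "ennreal (d x y) / 2 \<le> hausdorff_premeasure s 1 M"
      unfolding hausdorff_premeasure_def
    proof (rule INF_greatest, clarify)
      fix U :: "nat \<Rightarrow> 'a set" assume U: "\<forall>i. U i \<subseteq> M \<and> mdiam (U i) \<le> ennreal 1" "M \<subseteq> (\<Union>i. U i)"
      have "ennreal (d x y) \<le> 2 * (\<Sum>i. mdiam (U i))" using U by (intro dist_le_sum_mdiam[OF connected xy(1,2)]) auto
      also have "\<dots> \<le> 2 * (\<Sum>i. diam_pow s (U i))"
        using U s \<open>\<not> 1 \<le> s\<close> by (intro mult_left_mono suminf_le mdiam_le_diam_pow) auto
      finally show "ennreal (d x y) / 2 \<le> (\<Sum>i. diam_pow s (U i))"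
        by (simp add: divide_le_posI_ennreal mult.commute)
    qed
    also have "hausdorff_premeasure s 1 M \<le> hausdorff_measure s M"
      unfolding hausdorff_measure_def by (intro SUP_upper) auto
    finally have "ennreal (d x y) / 2 = 0" using s(2) by simp
    then show False using xy by (simp add: ennreal_divide_eq_0_iff)
  qed
  then show "1 \<le> ennreal s" by (metis ennreal_1 ennreal_leI)
qed

end

lemma AR_conformal_dim_ge_1:
  assumes d: "Metric_space X d" and compact: "compact_space (Metric_space.mtopology X d)"
    and connected: "connected_space (Metric_space.mtopology X d)"
    and xy: "x \<in> X" "y \<in> X" "x \<noteq> y"
  shows "1 \<le> AR_conformal_dim X d"
  unfolding AR_conformal_dim_def
proof (rule INF_greatest)
  fix \<theta> assume "\<theta> \<in> {\<theta>. quasisymmetric X \<theta> d \<and> Metric_space.ahlfors_regular X \<theta>}"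
  then have qs: "quasisymmetric X \<theta> d" by simp
  then have T: "Metric_space X \<theta>" by (simp add: quasisymmetric_def)
  have "connected_space (Metric_space.mtopology X \<theta>)"
    using quasisymmetric_mtopology[OF d qs compact] connected by simp
  then show "1 \<le> Metric_space.hausdorff_dim X \<theta>"
    by (rule Metric_space.hausdorff_dim_ge_1[OF T _ xy])
qed

section \<open>Uniform choices and the construction of the tower\<close>

context Metric_space
begin

lemma linearly_connectedE:
  assumes linearly_connected
  obtains C where "C \<ge> 0" "\<And>x y. x \<in> M \<Longrightarrow> y \<in> M \<Longrightarrow> \<exists>J. compactin mtopology J \<and> connectedin mtopology J \<and>
      x \<in> J \<and> y \<in> J \<and> mdiam J \<le> ennreal (C * d x y)"
proof -
  obtain C where C: "\<forall>x\<in>M. \<forall>y\<in>M. \<exists>J. compactin mtopology J \<and> connectedin mtopology J \<and>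
      x \<in> J \<and> y \<in> J \<and> mdiam J \<le> ennreal (C * d x y)"
    using assms unfolding linearly_connected_def by (rule exE)
  have mono: "ennreal (C * d x y) \<le> ennreal (max C 0 * d x y)" for x y
    by (intro ennreal_leI mult_right_mono) auto
  have J: "\<exists>J. compactin mtopology J \<and> connectedin mtopology J \<and>
      x \<in> J \<and> y \<in> J \<and> mdiam J \<le> ennreal (max C 0 * d x y)" if "x \<in> M" "y \<in> M" for x y
    using C[rule_format, OF that] mono by (meson order_trans)
  have "max C 0 \<ge> 0" by simp
  then show ?thesis using J by (rule that)
qed

lemma linearly_connected_imp_connected:
  assumes linearly_connected
  shows "connected_space mtopology"
proof (cases "M = {}")
  case True
  then show ?thesis by (metis connectedin_empty connectedin_topspace topspace_mtopology)
next
  case False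
  then obtain x where x: "x \<in> M" by blast
  define \<J> where "\<J> = {J. connectedin mtopology J \<and> x \<in> J}"
  have "connectedin mtopology (\<Union>\<J>)"
    using connectedin_sing[of mtopology x] x by (intro connectedin_Union) (auto simp: \<J>_def)
  moreover have "\<Union>\<J> = M"
  proof
    show "\<Union>\<J> \<subseteq> M" using connectedin_subset_topspace by (fastforce simp: \<J>_def)
    show "M \<subseteq> \<Union>\<J>"
    proof
      fix y assume "y \<in> M"
      then have "\<exists>J. connectedin mtopology J \<and> x \<in> J \<and> y \<in> J"
        using assms x unfolding linearly_connected_def by meson
      then show "y \<in> \<Union>\<J>" by (auto simp: \<J>_def)
    qed
  qed
  ultimately show ?thesis by (metis connectedin_topspace topspace_mtopology)
qed

text \<open>\<open>D\<close> is twice the diameter, to make the upper bound strict. Any point is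
  farther than a quarter of the diameter from one of two points that are more than half of it
  apart.\<close>

lemma ex_scale:
  assumes compact: "compact_space mtopology" and xy: "x \<in> M" "y \<in> M" "x \<noteq> y"
  shows "\<exists>D>0. (\<forall>x\<in>M. \<forall>y\<in>M. d x y < D) \<and> (\<forall>x\<in>M. \<exists>y\<in>M. D / 8 < d x y)"
proof -
  have "mbounded M" using compact compactin_imp_mbounded by (simp add: compact_space_def)
  then obtain B where B: "\<forall>x\<in>M. \<forall>y\<in>M. d x y \<le> B" by (auto simp: mbounded_alt)
  define \<Delta> where "\<Delta> = (SUP (u, v)\<in>M \<times> M. d u v)"
  have bdd: "bdd_above ((\<lambda>(u, v). d u v) ` (M \<times> M))" using B by (intro bdd_aboveI[of _ B]) auto
  have le: "d u v \<le> \<Delta>" if "u \<in> M" "v \<in> M" for u v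
    unfolding \<Delta>_def using that by (intro cSUP_upper2[OF bdd, of "(u, v)"]) auto
  have pos: "\<Delta> > 0" using le[OF xy(1,2)] xy mdist_pos_less[of x y] by linarith
  have "\<exists>u\<in>M \<times> M. \<Delta> / 2 < (case u of (u, v) \<Rightarrow> d u v)"
    using less_cSUP_iff[OF _ bdd, of "\<Delta> / 2"] xy pos by (auto simp flip: \<Delta>_def)
  then obtain u v where uv: "u \<in> M" "v \<in> M" "\<Delta> / 2 < d u v" by auto
  have "\<exists>z\<in>M. 2 * \<Delta> / 8 < d x z" if x: "x \<in> M" for x
  proof -
    have "d u v \<le> d x u + d x v" using triangle[of u x v] x uv by (simp add: commute)
    then have "\<Delta> / 4 < d x u \<or> \<Delta> / 4 < d x v" using uv(3) by linarith
    then show ?thesis using uv by auto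
  qed
  moreover have "\<forall>u\<in>M. \<forall>v\<in>M. d u v < 2 * \<Delta>" using le pos by force
  ultimately show ?thesis using pos by (intro exI[of _ "2 * \<Delta>"]) auto
qed

text \<open>Two net points within \<open>r / 2\<close> of \<open>c\<close> would be closer than
  \<open>r\<close> to each other, so the nearby candidate is unique if there is one.\<close>

lemma ex_parent:
  assumes S: "separated r S" "\<exists>v\<in>S. d c v < r" and c: "c \<in> M"
  shows "\<exists>v\<in>S. d c v < r \<and> (\<forall>u\<in>S. d c u < r / 2 \<longrightarrow> v = u)"
proof (cases "\<exists>v\<in>S. d c v < r / 2")
  case False
  then show ?thesis using S(2) by blast
next
  case True
  then obtain v where v: "v \<in> S" "d c v < r / 2" by blast
  have "v = u" if u: "u \<in> S" "d c u < r / 2" for u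
  proof (rule ccontr)
    assume "v \<noteq> u"
    then have "r \<le> d v u" using S(1) u v by (simp add: separated_def)
    also have "\<dots> \<le> d v c + d c u" using u v c S(1) by (intro triangle) (auto simp: separated_def)
    also have "d v c = d c v" by (rule commute)
    finally show False using u v by simp
  qed
  moreover have "d c v < r" using v(2) nonneg[of c v] by linarith
  ultimately show ?thesis using v by blast
qed

lemma AR_conformal_dim_le_if_UWS:
  assumes compact: "compact_space mtopology" and doubling and xy: "x\<^sub>0 \<in> M" "y\<^sub>0 \<in> M" "x\<^sub>0 \<noteq> y\<^sub>0"
    and lc: linearly_connected and uws: UWS and p: "p > 1"
  shows "AR_conformal_dim M d \<le> ennreal p"
proof -
  obtain A where A: "A \<ge> 1"
    "\<And>r T x. r > 0 \<Longrightarrow> separated r T \<Longrightarrow> x \<in> M \<Longrightarrow> (\<Sum>c\<in>T. exp (- d x c / (8 * r))) \<le> A"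
    using ex_kernel_bound[OF \<open>doubling\<close>] by blast
  obtain C where C: "C \<ge> 0" "\<And>x y. x \<in> M \<Longrightarrow> y \<in> M \<Longrightarrow> \<exists>J. compactin mtopology J \<and> connectedin mtopology J \<and>
      x \<in> J \<and> y \<in> J \<and> mdiam J \<le> ennreal (C * d x y)" using linearly_connectedE[OF lc] by blast
  define cuts where "cuts x r P \<longleftrightarrow> \<not> (\<exists>K \<in> connected_components_of (subtopology mtopology (M - P)).
          K \<inter> mball x (r / 2) \<noteq> {} \<and> K \<inter> (M - mcball x r) \<noteq> {})" for x r P
  obtain B where B: "B \<ge> 1" "\<And>x r. x \<in> M \<Longrightarrow> r > 0 \<Longrightarrow> \<exists>P. finite P \<and> P \<subseteq> mball x r \<and> real (card P) \<le> B \<and> cuts x r P"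
    using uws unfolding UWS_def cuts_def[symmetric] by blast
  define P where "P x r = (SOME P. finite P \<and> P \<subseteq> mball x r \<and> real (card P) \<le> B \<and> cuts x r P)" for x r
  have P: "finite (P x r)" "P x r \<subseteq> mball x r" "real (card (P x r)) \<le> B" "cuts x r (P x r)" if "x \<in> M" "r > 0" for x r
    using someI_ex[OF B(2)[OF that]] unfolding P_def[symmetric] by auto
  obtain D where D: "D > 0" "\<And>x y. x \<in> M \<Longrightarrow> y \<in> M \<Longrightarrow> d x y < D" "\<And>x. x \<in> M \<Longrightarrow> \<exists>y\<in>M. D / 8 < d x y"
    using ex_scale[OF compact xy] by blast
  \<comment> \<open>A net point has at most \<open>B * (k * B)\<close> heavy points of share
    \<open>exp 3 / k powr p\<close>, so the quantity bounded in \<open>refine_density\<close> is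
    \<open>Z * k / k powr p\<close>. The choice of \<open>k\<close> makes it at most 1 / 4; here
    \<open>p > 1\<close> is decisive.\<close>
  define Z where "Z = exp 3 * exp 18 * A\<^sup>2 * (B * B)"
  obtain k :: nat where k0: "(max 1 (4 * Z)) powr (1 / (p - 1)) \<le> real k" using real_arch_simple by blast
  have "1 powr (1 / (p - 1)) \<le> max 1 (4 * Z) powr (1 / (p - 1))" using p by (intro powr_mono2) auto
  then have k1: "real k \<ge> 1" using k0 by simp
  have "(max 1 (4 * Z) powr (1 / (p - 1))) powr (p - 1) \<le> real k powr (p - 1)" using k0 p by (intro powr_mono2) auto
  then have "4 * Z \<le> real k powr (p - 1)" using p by (simp add: powr_powr)
  then have k: "4 * Z * real k \<le> real k powr p"
    using k1 mult_right_mono[of "4 * Z" "real k powr (p - 1)" "real k"] by (simp add: powr_mult_base mult.commute)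
  define \<kappa> where "\<kappa> = exp 3 / real k powr p"
  have \<kappa>: "\<kappa> \<ge> 0" "\<kappa> * exp 18 * A\<^sup>2 * (B * (real k * B)) \<le> 1 / 4"
  proof -
    have "\<kappa> * exp 18 * A\<^sup>2 * (B * (real k * B)) = Z * real k / real k powr p" by (simp add: \<kappa>_def Z_def)
    also have "\<dots> \<le> 1 / 4" using k k1 by (simp add: pos_divide_le_eq)
    finally show "\<kappa> * exp 18 * A\<^sup>2 * (B * (real k * B)) \<le> 1 / 4" .
  qed (simp add: \<kappa>_def)
  \<comment> \<open>A sum, so that each summand is a lower bound. The number 48 makes
    \<open>3 * a / 8\<close> at least \<open>18 * exp 3 * A\<close>, and
    \<open>exp u \<ge> 1 + u\<close> does the rest.\<close>
  define a where "a = 10 * 8 ^ k + 10 * C + 48 * exp 3 * A"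
  have a: "a \<ge> 10 * 8 ^ k" "a \<ge> 10 * C" "a \<ge> 48 * exp 3 * A" using A(1) C(1) by (auto simp: a_def)
  have a80: "a \<ge> 80"
  proof -
    have "(8::real) ^ 1 \<le> 8 ^ k" using k1 by (intro power_increasing) auto
    then show ?thesis using a(1) by simp
  qed
  have aA: "16 * exp 3 * A \<le> exp (3 * a / 8)"
  proof -
    have "exp 3 * A \<ge> 0" using A(1) by simp
    then show ?thesis using exp_ge_add_one_self[of "3 * a / 8"] a(3) by linarith
  qed
  define \<delta> where "\<delta> = 4 * exp (1 - a / 2)"
  have \<delta>: "0 < \<delta>" "\<delta> < 1"
  proof -
    have "4 < exp (a / 2 - 1)" using exp_ge_add_one_self[of "a / 2 - 1"] a80 by linarith
    moreover have "\<delta> * exp (a / 2 - 1) = 4" by (simp add: \<delta>_def flip: exp_add)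
    ultimately show "\<delta> < 1" by (smt (verit) mult_le_cancel_right1 exp_gt_zero)
  qed (simp add: \<delta>_def)
  define R where "R n = D / a ^ n" for n :: nat
  have R: "R n > 0" "R (Suc n) = R n / a" for n using D a80 by (auto simp: R_def)
  have "\<exists>T. separated (R n) T \<and> (\<forall>x\<in>M. \<exists>v\<in>T. d x v < R n)" for n by (rule ex_net[OF compact R(1)])
  then obtain S where S: "\<And>n. separated (R n) (S n)" "\<And>n. \<forall>x\<in>M. \<exists>v\<in>S n. d x v < R n" by metis
  have SM: "S n \<subseteq> M" for n using S(1) by (auto simp: separated_def)
  define g where "g n c = (SOME v. v \<in> S n \<and> d c v < R n \<and> (\<forall>u\<in>S n. d c u < R n / 2 \<longrightarrow> v = u))" for n c
  have g: "g n c \<in> S n" "d c (g n c) < R n" "\<And>u. u \<in> S n \<Longrightarrow> d c u < R n / 2 \<Longrightarrow> g n c = u"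
    if c: "c \<in> S (Suc n)" for n c
  proof -
    have cM: "c \<in> M" using c SM by blast
    have "\<exists>v. v \<in> S n \<and> d c v < R n \<and> (\<forall>u\<in>S n. d c u < R n / 2 \<longrightarrow> v = u)"
      using ex_parent[OF S(1) bspec[OF S(2) cM] cM] by blast
    from someI_ex[OF this] show "g n c \<in> S n" "d c (g n c) < R n" "\<And>u. u \<in> S n \<Longrightarrow> d c u < R n / 2 \<Longrightarrow> g n c = u"
      unfolding g_def[symmetric] by auto
  qed
  define H where "H n v = (\<Union>z\<in>P v (4 * R n). \<Union>j<k. P z (3 * (R n * 8 ^ j / 8 ^ k)))" for n v
  have H: "finite (H n v) \<and> H n v \<subseteq> mball v (5 * R n) \<and> real (card (H n v)) \<le> B * (real k * B)"
    if v: "v \<in> S n" for n v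
  proof -
    have vM: "v \<in> M" using v SM by blast
    note PP = P[OF vM, of "4 * R n"]
    have r0: "4 * R n > 0" using R(1)[of n] by simp
    have zM: "z \<in> M" if "z \<in> P v (4 * R n)" for z using PP(2)[OF r0] that by auto
    define T where "T j = 3 * (R n * 8 ^ j / 8 ^ k)" for j
    have T0: "T j > 0" for j using R(1)[of n] by (simp add: T_def)
    \<comment> \<open>The factor 8 between consecutive radii absorbs the 3, which keeps all heavy
      points within \<open>4 * R n + R n\<close> of \<open>v\<close>.\<close>
    have T1: "T j \<le> R n" if "j < k" for j
    proof -
      have "8 ^ Suc j \<le> (8::real) ^ k" using that by (intro power_increasing) auto
      moreover have "(0::real) \<le> 8 ^ j" by simp
      ultimately have "3 * 8 ^ j \<le> (8::real) ^ k" unfolding power_Suc by linarith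
      then have "R n * (3 * 8 ^ j) \<le> R n * 8 ^ k" using R(1)[of n] by (intro mult_left_mono) auto
      then show ?thesis by (simp add: T_def pos_divide_le_eq mult_ac)
    qed
    have HT: "H n v = (\<Union>z\<in>P v (4 * R n). \<Union>j<k. P z (T j))" by (simp add: H_def T_def)
    have fin: "finite (H n v)" unfolding HT using PP(1)[OF r0] P(1)[OF zM T0] by auto
    have sub: "H n v \<subseteq> mball v (5 * R n)"
    proof
      fix h assume "h \<in> H n v"
      then obtain z j where z: "z \<in> P v (4 * R n)" and j: "j < k" "h \<in> P z (T j)" by (auto simp: HT)
      have "h \<in> mball z (T j)" using P(2)[OF zM[OF z] T0[of j]] j by blast
      moreover have "z \<in> mball v (4 * R n)" using PP(2)[OF r0] z by blast
      ultimately show "h \<in> mball v (5 * R n)" using T1[OF j(1)] triangle[of v z h] by auto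
    qed
    have inner: "real (card (\<Union>j<k. P z (T j))) \<le> real k * B" if z: "z \<in> P v (4 * R n)" for z
    proof -
      have "real (card (\<Union>j<k. P z (T j))) \<le> (\<Sum>j<k. real (card (P z (T j))))"
        using card_UN_le[of "{..<k}" "\<lambda>j. P z (T j)"] by (simp flip: of_nat_sum)
      also have "\<dots> \<le> (\<Sum>j<k. B)" using P(3)[OF zM[OF z] T0] by (intro sum_mono) auto
      finally show ?thesis by simp
    qed
    have "real (card (H n v)) \<le> (\<Sum>z\<in>P v (4 * R n). real (card (\<Union>j<k. P z (T j))))"
      unfolding HT using card_UN_le[OF PP(1)[OF r0], of "\<lambda>z. \<Union>j<k. P z (T j)"] by (simp flip: of_nat_sum)
    also have "\<dots> \<le> (\<Sum>z\<in>P v (4 * R n). real k * B)" by (intro sum_mono inner)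
    also have "\<dots> = real (card (P v (4 * R n))) * (real k * B)" by simp
    also have "\<dots> \<le> B * (real k * B)" using PP(3)[OF r0] B(1) by (intro mult_right_mono) auto
    finally show ?thesis using fin sub by blast
  qed
  define good where "good n w w' \<longleftrightarrow> (\<forall>x\<in>M. \<delta> * w x \<le> w' x) \<and>
     (\<forall>v\<in>S n. (\<Sum>c | c \<in> S (Suc n) \<and> g n c = v. w' c) = w v) \<and> (\<forall>v\<in>S n. \<forall>h\<in>H n v. \<kappa> * w v \<le> w' h)"
    for n and w w' :: "'a \<Rightarrow> real"
  \<comment> \<open>The condition at \<open>n = 0\<close> pins the first density to the constant 1,
    which dependent choice alone would leave open.\<close>
  have "\<exists>m. \<forall>n. (loglip (R n) (m n) \<and> (n = 0 \<longrightarrow> m n = (\<lambda>_. 1))) \<and> good n (m n) (m (Suc n))"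
  proof (rule dependent_nat_choice)
    show "\<exists>w. loglip (R 0) w \<and> ((0::nat) = 0 \<longrightarrow> w = (\<lambda>_. 1))"
      using R(1)[of 0] by (auto simp: loglip_def)
    fix w n assume w: "loglip (R n) w \<and> (n = 0 \<longrightarrow> w = (\<lambda>_. 1))"
    have "\<exists>w'. loglip (R n / a) w' \<and> (\<forall>x\<in>M. 4 * exp (1 - a / 2) * w x \<le> w' x) \<and>
     (\<forall>v\<in>S n. (\<Sum>c | c \<in> S (Suc n) \<and> g n c = v. w' c) = w v) \<and> (\<forall>v\<in>S n. \<forall>h\<in>H n v. \<kappa> * w v \<le> w' h)"
    proof (rule refine_density[OF A(2) A(1) R(1) _ aA \<kappa>])
      show "a \<ge> 6" using a80 by simp
      show "loglip (R n) w" using w by simp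
      show "separated (R n) (S n)" by (rule S(1))
      show "separated (R n / a) (S (Suc n))" using S(1)[of "Suc n"] by (simp add: R(2))
      show "\<exists>c\<in>S (Suc n). d x c < R n / a" if "x \<in> M" for x using S(2)[of "Suc n"] that by (simp add: R(2))
      show "g n c \<in> S n \<and> d c (g n c) < R n" if "c \<in> S (Suc n)" for c using g[OF that] by blast
      show "g n c = v" if "c \<in> S (Suc n)" "v \<in> S n" "d c v < R n / 2" for c v using g(3)[OF that] .
      show "finite (H n v) \<and> H n v \<subseteq> mball v (5 * R n) \<and> real (card (H n v)) \<le> B * (real k * B)"
        if "v \<in> S n" for v by (rule H[OF that])
    qed
    then show "\<exists>w'. (loglip (R (Suc n)) w' \<and> (Suc n = 0 \<longrightarrow> w' = (\<lambda>_. 1))) \<and> good n w w'"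
      unfolding good_def \<delta>_def R(2) by (elim exE, intro exI) simp
  qed
  then obtain m where m: "\<And>n. loglip (R n) (m n)" "m 0 = (\<lambda>_. 1)" "\<And>n. good n (m n) (m (Suc n))" by auto
  interpret cut_tower M d a D \<delta> p A C k S g m P R
  proof
    show "R n = D / a ^ n" for n by (simp add: R_def)
    show "M \<noteq> {}" using xy by blast
    show "connected_space mtopology" by (rule linearly_connected_imp_connected[OF lc])
    show "1 \<le> k" using k1 by simp
    show "(\<Sum>v\<in>S n. exp (- d x v / (8 * R n))) \<le> A" if "x \<in> M" for n x using A(2)[OF R(1) S(1) that] .
    show "\<exists>v\<in>S n. d x v < R n" if "x \<in> M" for n x using S(2) that by blast
    show "g n c \<in> S n \<and> d c (g n c) < R n" if "c \<in> S (Suc n)" for n c using g[OF that] by blast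
    show "g n c = v" if "c \<in> S (Suc n)" "v \<in> S n" "d c v < R n / 2" for n c v using g(3)[OF that] .
    show "\<delta> * m n x \<le> m (Suc n) x" if "x \<in> M" for n x using m(3)[of n] that by (simp add: good_def)
    show "(\<Sum>c | c \<in> S (Suc n) \<and> g n c = v. m (Suc n) c) = m n v" if "v \<in> S n" for n v
      using m(3)[of n] that by (simp add: good_def)
    show "m 0 x = 1" if "x \<in> M" for x by (simp add: m(2))
    show "P x r \<subseteq> mball x r \<and>
      \<not> (\<exists>K \<in> connected_components_of (subtopology mtopology (M - P x r)).
          K \<inter> mball x (r / 2) \<noteq> {} \<and> K \<inter> (M - mcball x r) \<noteq> {})" if "x \<in> M" "r > 0" for x r
      using P(2,4)[OF that] unfolding cuts_def by (rule conjI)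
    show "exp 3 / real k powr p * m n v \<le> m (Suc n) h"
      if "v \<in> S n" "z \<in> P v (4 * R n)" "j < k" "h \<in> P z (3 * (R n * 8 ^ j / 8 ^ k))" for n v z j h
    proof -
      have "h \<in> H n v" using that unfolding H_def by blast
      then show ?thesis using m(3)[of n] that(1) unfolding good_def \<kappa>_def by blast
    qed
  qed (fact compact D C a \<delta> p S(1) m(1))+
  show ?thesis by (rule AR_conformal_dim_le)
qed

end

theorem theorem1p2:
  fixes X :: "'a set" and d :: "'a \<Rightarrow> 'a \<Rightarrow> real"
  assumes "Metric_space X d"
    and "compact_space (Metric_space.mtopology X d)"
    and "Metric_space.doubling X d"
    and "\<exists>x\<in>X. \<exists>y\<in>X. x \<noteq> y"
    and "Metric_space.linearly_connected X d"
    and "Metric_space.UWS X d"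
  shows "AR_conformal_dim X d = 1"
proof (rule antisym)
  obtain x y where xy: "x \<in> X" "y \<in> X" "x \<noteq> y" using assms(4) by blast
  show "1 \<le> AR_conformal_dim X d"
    by (rule AR_conformal_dim_ge_1[OF assms(1,2) Metric_space.linearly_connected_imp_connected[OF assms(1,5)] xy])
  show "AR_conformal_dim X d \<le> 1"
  proof (rule ennreal_le_epsilon)
    fix e :: real assume e: "e > 0"
    have "AR_conformal_dim X d \<le> ennreal (1 + e)"
      using e by (intro Metric_space.AR_conformal_dim_le_if_UWS[OF assms(1-3) xy assms(5,6)]) simp
    then show "AR_conformal_dim X d \<le> 1 + ennreal e" using e by (simp add: ennreal_plus)
  qed
qed

end
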